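(* There is a constant $C>0$ such that for all non-negative integers $n,r,h$, $$\mathbb{E}\left(L_n(r)-L_n(r+h)\right)^4\le C\,h^2n.$$ Consequently, the sequence of processes $(l_n(t))_{t\ge0}$, $l_n(t)=\frac1{\sqrt n}L_n(t\sqrt n)$, is tight in $C[0,\infty)$.
   Context: For a uniformly random unlabelled rooted tree (rooted tree up to root-preserving isomorphism) with $n$ vertices, $L_n(k)$ ($k$ a non-negative integer) is the number of vertices at distance $k$ from the root, and for non-integer $t\ge0$, $L_n(t)=(\lfloor t\rfloor+1-t)L_n(\lfloor t\rfloor)+(t-\lfloor t\rfloor)L_n(\lfloor t\rfloor+1)$. *)

theory Defs
  imports "HOL-Analysis.Analysis" "HOL-Library.Multiset"
begin

text \<open>Unlabelled rooted trees up to root-preserving isomorphism: a tree is the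
  multiset of its root subtrees.\<close>
datatype utree = Node "utree multiset"

primrec tsize :: "utree \<Rightarrow> nat" where
  "tsize (Node M) = Suc (\<Sum>\<^sub># (image_mset tsize M))"

primrec lev :: "utree \<Rightarrow> nat \<Rightarrow> nat" where
  "lev (Node M) = (\<lambda>k. case k of 0 \<Rightarrow> 1
       | Suc j \<Rightarrow> \<Sum>\<^sub># (image_mset (\<lambda>f. f j) (image_mset lev M)))"

definition trees :: "nat \<Rightarrow> utree set" where
  "trees n = {T. tsize T = n}"

definition Eunif :: "nat \<Rightarrow> (utree \<Rightarrow> real) \<Rightarrow> real" where
  "Eunif n X = (\<Sum>T\<in>trees n. X T) / real (card (trees n))"

definition Lr :: "utree \<Rightarrow> real \<Rightarrow> real" where
  "Lr T t = (real_of_int \<lfloor>t\<rfloor> + 1 - t) * real (lev T (nat \<lfloor>t\<rfloor>))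
            + (t - real_of_int \<lfloor>t\<rfloor>) * real (lev T (nat \<lfloor>t\<rfloor> + 1))"

definition lproc :: "nat \<Rightarrow> utree \<Rightarrow> real \<Rightarrow> real" where
  "lproc n T t = Lr T (t * sqrt (real n)) / sqrt (real n)"

text \<open>C[0,\<infinity>) with the topology of uniform convergence on compacts (metrizable,
  so compactness = sequential compactness). Functions are real \<Rightarrow> real,
  only their values on [0,\<infinity>) matter.\<close>
definition compactC :: "(real \<Rightarrow> real) set \<Rightarrow> bool" where
  "compactC K \<longleftrightarrow> (\<forall>f\<in>K. continuous_on {0..} f) \<and>
     (\<forall>s::nat \<Rightarrow> real \<Rightarrow> real. (\<forall>i. s i \<in> K) \<longrightarrow> (\<exists>r g. strict_mono r \<and> g \<in> K \<and>
        (\<forall>k::nat. uniform_limit {0..real k} (\<lambda>i. s (r i)) g sequentially)))"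

definition tightC :: "(nat \<Rightarrow> utree \<Rightarrow> real \<Rightarrow> real) \<Rightarrow> bool" where
  "tightC X \<longleftrightarrow> (\<forall>\<epsilon>>0. \<exists>K. compactC K \<and>
     (\<forall>n\<ge>1. real (card {T\<in>trees n. X n T \<in> K}) \<ge> (1 - \<epsilon>) * real (card (trees n))))"

end

theory Submission
  imports Defs "HOL-Complex_Analysis.Great_Picard"
begin

text \<open>
  Let \<open>y\<close> be the generating function of the trees and \<open>q(x) = \<Sum>\<^sub>j\<^sub>\<ge>\<^sub>2 y(x\<^sup>j)/j\<close>, so that
  \<open>y exp (1 - y) = \<psi>\<close> with \<open>\<psi>(x) = x exp (1 + q(x))\<close>. Here \<open>\<psi>\<close> has nonnegative coefficients and is
  analytic beyond the point \<open>\<rho>\<close> where \<open>\<psi>(\<rho>) = 1\<close>. In the disc \<open>\<bar>x\<bar> < \<rho>\<close> the bound \<open>\<bar>\<psi>\<bar> \<le> 1\<close> forces \<open>y\<close>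
  into a Stolz angle at 1, so with \<open>\<delta> = \<bar>1 - y\<bar>\<close> one has \<open>\<bar>y\<bar> \<le> exp (- \<delta>/2)\<close> and
  \<open>\<delta>\<^sup>2 \<ge> c \<bar>1 - x/\<rho>\<bar>\<close>; no analytic continuation is needed.

  The generating functions \<open>A\<^sub>k\<close> of \<open>(L(r) - L(r+h))\<^sup>k\<close> satisfy recursions in \<open>r\<close> of the form
  \<open>A\<^sub>k(r+1) = y A\<^sub>k(r) + (products of lower moments) + (exponentially small terms)\<close>, and since
  \<open>A\<^sub>1(r)\<close> is essentially \<open>y\<^sup>r (1 - y\<^sup>h)\<close>, solving them gives successively the orders
  \<open>A\<^sub>2 = O(h)\<close>, \<open>A\<^sub>3 = O(h\<^sup>2)\<close>, \<open>A\<^sub>4 = O(h\<^sup>2/\<delta>)\<close>. The same computation in the ring of dual numbers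
  bounds the derivative of \<open>A\<^sub>4\<close> by \<open>O(h\<^sup>2/\<delta>\<^sup>3)\<close>, which, averaged over a circle of radius \<open>\<rho> n/(n+1)\<close>,
  bounds its \<open>n\<close>-th coefficient by \<open>O(h\<^sup>2 n\<^bsup>-1/2\<^esup> \<rho>\<^bsup>-n\<^esup>)\<close>. Lagrange inversion and an elementary renewal
  estimate give at least \<open>c n\<^bsup>-3/2\<^esup> \<rho>\<^bsup>-n\<^esup>\<close> trees with \<open>n\<close> vertices, and the quotient is \<open>O(h\<^sup>2 n)\<close>.
  Tightness follows by dyadic chaining and the Arzela-Ascoli theorem.
\<close>

section \<open>Counting and marking\<close>

text \<open>Why a derivative is needed: on the circle, \<delta> is at least of order (1/n +
  |t|)^(1/2) at angle t, so 1/\<delta> has average O(1), and bounding the coefficient of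
  \<open>A\<^sub>4\<close> directly would lose a factor sqrt n. The derivative yields n times the
  coefficient, while \<delta>^(-3) has average O(sqrt n), so one differentiation gains the missing
  factor inside the disc.

  Where powers of h come from: the initial values at r = 0 are polynomials in the single-level
  moments at h, and the first moment carries a factor min(1, h\<delta>). A sum over 1/\<delta>
  levels that contains this factor costs h instead of 1/\<delta>.

  Why repeated subtrees are harmless: their series converge up to 1/2 > \<rho>, and as a tree
  reaching level r has more than r vertices, they start at order 2r or later. They decay like
  (81/100)^r, whereas powers of y are only bounded by (1 - \<delta>/20)^r, which is at least
  (9/10)^r. Convolving the two therefore costs a constant independent of \<delta>.\<close>

lemma tsize_pos [simp]: "0 < tsize T"
  by (cases T) simp

primrec children :: "utree \<Rightarrow> utree multiset" where
  "children (Node M) = M"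

lemma Node_children [simp]: "Node (children T) = T"
  by (cases T) simp

definition graft :: "utree \<Rightarrow> nat \<Rightarrow> utree \<Rightarrow> utree" where
  "graft T j S = Node (children T + replicate_mset j S)"

lemma children_graft [simp]: "children (graft T j S) = children T + replicate_mset j S"
  by (simp add: graft_def)

lemma tsize_children: "tsize T = Suc (\<Sum>S\<in>#children T. tsize S)"
  by (cases T) simp

lemma tsize_graft [simp]: "tsize (graft T j S) = tsize T + j * tsize S"
  by (simp add: tsize_children[of "graft T j S"] tsize_children[of T])

lemma lev_0 [simp]: "lev T 0 = 1"
  by (cases T) simp

lemma lev_Suc: "lev T (Suc k) = (\<Sum>S\<in>#children T. lev S k)"
  by (cases T) (simp add: image_mset.compositionality o_def)

lemma trees_0 [simp]: "trees 0 = {}"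
  by (auto simp: trees_def)

lemma tsize_eq_1_iff: "tsize T = 1 \<longleftrightarrow> T = Node {#}"
proof
  assume a: "tsize T = 1"
  show "T = Node {#}"
  proof (cases T)
    case (Node M)
    then have "\<forall>n\<in>#image_mset tsize M. n = 0" using a by simp
    then have "M = {#}" using tsize_pos by (metis image_eqI less_irrefl multiset_nonemptyE set_image_mset)
    then show ?thesis using Node by simp
  qed
qed simp

lemma trees_1 [simp]: "trees (Suc 0) = {Node {#}}"
  using tsize_eq_1_iff by (auto simp: trees_def)

lemma ex_graft:
  assumes "tsize T \<noteq> 1"
  shows "\<exists>T' S. T = graft T' 1 S"
proof -
  have "children T \<noteq> {#}" using assms tsize_children[of T] by auto
  then obtain S where "S \<in># children T" by auto
  then have "T = graft (Node (children T - {#S#})) 1 S"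
    by (cases T) (simp add: graft_def)
  then show ?thesis by blast
qed

text \<open>The detached root subtree is not unique, so this is only an inclusion. It suffices for
  finiteness and for the crude growth bound 4^n, which is needed before any generating function can
  be evaluated.\<close>

lemma trees_subset_graft:
  assumes "n \<noteq> 1"
  shows "trees n \<subseteq> (\<Union>a\<in>{..n}. (\<lambda>(T, S). graft T 1 S) ` (trees a \<times> trees (n - a)))"
proof
  fix T assume T: "T \<in> trees n"
  then obtain T' S where TS: "T = graft T' 1 S"
    using ex_graft[of T] assms unfolding trees_def by blast
  then have "tsize T' + tsize S = n" using T by (auto simp: trees_def)
  then have "T' \<in> trees (tsize T')" "S \<in> trees (n - tsize T')" "tsize T' \<in> {..n}"
    by (auto simp: trees_def)
  then show "T \<in> (\<Union>a\<in>{..n}. (\<lambda>(T, S). graft T 1 S) ` (trees a \<times> trees (n - a)))"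
    unfolding TS by fast
qed

lemma finite_trees [simp]: "finite (trees n)"
proof (induction n rule: less_induct)
  case (less n)
  show ?case
  proof (cases "n \<le> 1")
    case True
    then show ?thesis by (cases n) auto
  next
    case False
    have "finite (trees a \<times> trees (n - a))" if "a \<in> {..n}" for a
      using less[of a] less[of "n - a"] that by (cases "a = 0"; cases "a = n") auto
    then have "finite (\<Union>a\<in>{..n}. (\<lambda>(T, S). graft T 1 S) ` (trees a \<times> trees (n - a)))"
      by blast
    then show ?thesis using trees_subset_graft[of n] False
      by (metis finite_subset le_refl)
  qed
qed

lemma card_trees_le_convolution:
  assumes "n \<noteq> 1"
  shows "card (trees n) \<le> (\<Sum>a\<le>n. card (trees a) * card (trees (n - a)))"
proof -
  have "card (trees n) \<le> card (\<Union>a\<in>{..n}. (\<lambda>(T, S). graft T 1 S) ` (trees a \<times> trees (n - a)))"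
    by (intro card_mono trees_subset_graft assms) auto
  also have "\<dots> \<le> (\<Sum>a\<le>n. card ((\<lambda>(T, S). graft T 1 S) ` (trees a \<times> trees (n - a))))"
    by (rule card_UN_le) simp
  also have "\<dots> \<le> (\<Sum>a\<le>n. card (trees a \<times> trees (n - a)))"
    by (intro sum_mono card_image_le) auto
  finally show ?thesis by (simp add: card_cartesian_product)
qed

text \<open>By the convolution bound the partial sums satisfy s_(N+1) \<le> x + s_N^2. At x = 1/4,
  the largest x for which s = x + s^2 has a real root, the bound 1/2 reproduces itself.\<close>

lemma sum_trees_quarter_le: "(\<Sum>n\<le>N. real (card (trees n)) * (1/4) ^ n) \<le> 1/2"
proof (induction N)
  case (Suc N)
  let ?c = "\<lambda>n. real (card (trees n)) * (1/4) ^ n"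
  have "?c n \<le> (if n = 1 then 1/4 else 0) + (\<Sum>a\<le>n. ?c a * ?c (n - a))" for n
  proof (cases "n = 1")
    case False
    have "?c n \<le> real (\<Sum>a\<le>n. card (trees a) * card (trees (n - a))) * (1/4) ^ n"
      using card_trees_le_convolution[OF False] by (intro mult_right_mono of_nat_mono) auto
    also have "\<dots> = (\<Sum>a\<le>n. ?c a * ?c (n - a))"
      by (simp add: sum_distrib_right mult_ac flip: power_add)
         (simp add: sum_distrib_left mult_ac)
    finally show ?thesis using False by simp
  qed (auto intro: sum_nonneg)
  then have "(\<Sum>n\<le>Suc N. ?c n) \<le> (\<Sum>n\<le>Suc N. (if n = 1 then 1/4 else 0) + (\<Sum>a\<le>n. ?c a * ?c (n - a)))"
    by (rule sum_mono)
  also have "\<dots> = 1/4 + (\<Sum>n\<le>Suc N. \<Sum>a\<le>n. ?c a * ?c (n - a))"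
    by (simp add: sum.distrib)
  also have "(\<Sum>n\<le>Suc N. \<Sum>a\<le>n. ?c a * ?c (n - a)) = (\<Sum>(a, b)\<in>{(a, b). a + b \<le> Suc N}. ?c a * ?c b)"
    by (rule sum.triangle_reindex_eq[symmetric])
  \<comment> \<open>No tree has size 0, so in a nonzero term both indices are positive and hence at
    most \<open>N\<close>, where the induction hypothesis applies.\<close>
  also have "\<dots> \<le> (\<Sum>(a, b)\<in>{..N} \<times> {..N}. ?c a * ?c b)"
  proof (rule order.trans)
    have fin: "finite {(a, b). a + b \<le> Suc N}"
      by (rule finite_subset[of _ "{..Suc N} \<times> {..Suc N}"]) auto
    have z: "?c 0 = 0" by simp
    show "(\<Sum>(a, b)\<in>{(a, b). a + b \<le> Suc N}. ?c a * ?c b) \<le>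
        (\<Sum>(a, b)\<in>{(a, b). a + b \<le> Suc N \<and> a \<noteq> 0 \<and> b \<noteq> 0}. ?c a * ?c b)"
      by (rule eq_refl, rule sum.mono_neutral_right[OF fin]) auto
    show "(\<Sum>(a, b)\<in>{(a, b). a + b \<le> Suc N \<and> a \<noteq> 0 \<and> b \<noteq> 0}. ?c a * ?c b) \<le> (\<Sum>(a, b)\<in>{..N} \<times> {..N}. ?c a * ?c b)"
      by (intro sum_mono2) auto
  qed
  also have "\<dots> = (\<Sum>n\<le>N. ?c n) * (\<Sum>n\<le>N. ?c n)"
    by (simp add: sum_product sum.cartesian_product)
  also have "\<dots> \<le> 1/2 * (1/2)"
    by (intro mult_mono Suc.IH sum_nonneg) auto
  finally show ?case by simp
qed simp

lemma card_trees_le: "real (card (trees n)) \<le> 4 ^ n"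
proof -
  have "real (card (trees n)) * (1/4) ^ n \<le> (\<Sum>n\<le>n. real (card (trees n)) * (1/4) ^ n)"
    by (rule member_le_sum) auto
  also have "\<dots> \<le> 1" using sum_trees_quarter_le[of n] by simp
  finally show ?thesis by (simp add: field_simps)
qed

text \<open>Multiplicity c is spread over an index j = 1, ..., c. In the marking bijection j becomes
  the number of copies that are removed.\<close>

lemma sum_mset_count_levels:
  fixes f :: "'a \<Rightarrow> 'b::comm_semiring_1"
  shows "(\<Sum>S\<in>#M. f S) = (\<Sum>S\<in>set_mset M. \<Sum>j\<in>{1..count M S}. f S)"
proof -
  have "(\<Sum>S\<in>#M. f S) = (\<Sum>S\<in>A. of_nat (count M S) * f S)" if "finite A" "set_mset M \<subseteq> A" for A
    using that
  proof (induction M)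
    case (add x M)
    have "(\<Sum>S\<in>A. of_nat (count (add_mset x M) S) * f S) = (\<Sum>S\<in>A. (if S = x then f S else 0) + of_nat (count M S) * f S)"
      by (intro sum.cong) (auto simp: algebra_simps)
    also have "\<dots> = f x + (\<Sum>S\<in>A. of_nat (count M S) * f S)"
      using add.prems by (simp add: sum.distrib)
    finally show ?case using add by simp
  qed simp
  from this[of "set_mset M"] show ?thesis by simp
qed

text \<open>The index set of the coefficient of x^m in Polya's sum of y(x^j) over j \<ge> 1.\<close>

definition copies :: "nat \<Rightarrow> (utree \<times> nat) set" where
  "copies m = {(S, j). 0 < j \<and> j * tsize S = m}"

lemma finite_copies [simp]: "finite (copies m)"
proof (rule finite_subset)
  show "copies m \<subseteq> (\<Union>a\<in>{..m}. trees a) \<times> {..m}"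
  proof (clarify)
    fix S j assume "(S, j) \<in> copies m"
    then have "0 < j" "j * tsize S = m" by (auto simp: copies_def)
    moreover have "j \<le> j * tsize S" "tsize S \<le> j * tsize S"
      using \<open>0 < j\<close> tsize_pos[of S] by (simp_all add: Suc_leI)
    ultimately show "S \<in> (\<Union>a\<in>{..m}. trees a) \<and> j \<in> {..m}"
      by (auto simp: trees_def)
  qed
qed auto

text \<open>Marking \<open>j\<close> copies of a root subtree, counted with multiplicity, replaces Polya's exponential
  formula: a tree with \<open>j\<close> marked copies of \<open>S\<close> is the same as an arbitrary tree onto which
  \<open>j\<close> copies of \<open>S\<close> have been grafted.\<close>
lemma sum_trees_mark_child:
  fixes d g :: "utree \<Rightarrow> 'a::comm_semiring_1"
  shows "(\<Sum>T\<in>trees n. (\<Sum>S\<in>#children T. d S) * g T) =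
         (\<Sum>i\<le>n. \<Sum>T\<in>trees i. \<Sum>(S, j)\<in>copies (n - i). d S * g (graft T j S))"
proof -
  have "(\<Sum>T\<in>trees n. (\<Sum>S\<in>#children T. d S) * g T) =
     (\<Sum>T\<in>trees n. \<Sum>S\<in>set_mset (children T). \<Sum>j\<in>{1..count (children T) S}. d S * g T)"
    by (simp add: sum_mset_count_levels sum_distrib_right mult.assoc)
  also have "\<dots> = (\<Sum>T\<in>trees n. \<Sum>(S, j)\<in>(SIGMA S:set_mset (children T). {1..count (children T) S}). d S * g T)"
    by (intro sum.cong refl, subst sum.Sigma) auto
  also have "\<dots> = (\<Sum>(T, S, j)\<in>(SIGMA T:trees n. SIGMA S:set_mset (children T). {1..count (children T) S}). d S * g T)"
    by (subst sum.Sigma) (auto simp: case_prod_unfold)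
  also have "\<dots> = (\<Sum>(i, T, S, j)\<in>(SIGMA i:{..n}. trees i \<times> copies (n - i)). d S * g (graft T j S))"
  proof (rule sum.reindex_bij_witness[where
      i = "\<lambda>(i, T, S, j). (graft T j S, S, j)" and
      j = "\<lambda>(T, S, j). (n - j * tsize S, Node (children T - replicate_mset j S), S, j)"])
    fix a assume "a \<in> (SIGMA T:trees n. SIGMA S:set_mset (children T). {1..count (children T) S})"
    then obtain T S j where a: "a = (T, S, j)" and T: "T \<in> trees n" and j: "1 \<le> j" "j \<le> count (children T) S"
      by auto
    have sub: "replicate_mset j S \<subseteq># children T"
      using j by (simp add: count_le_replicate_mset_subset_eq)
    then have eq: "graft (Node (children T - replicate_mset j S)) j S = T"
      by (simp add: graft_def)
    then have "tsize (Node (children T - replicate_mset j S)) + j * tsize S = n"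
      using T by (metis mem_Collect_eq trees_def tsize_graft)
    then show "(\<lambda>(i, T, S, j). (graft T j S, S, j)) ((\<lambda>(T, S, j). (n - j * tsize S, Node (children T - replicate_mset j S), S, j)) a) = a"
      "(\<lambda>(T, S, j). (n - j * tsize S, Node (children T - replicate_mset j S), S, j)) a \<in> (SIGMA i:{..n}. trees i \<times> copies (n - i))"
      "(case (\<lambda>(T, S, j). (n - j * tsize S, Node (children T - replicate_mset j S), S, j)) a of (i, T, S, j) \<Rightarrow> d S * g (graft T j S)) = (case a of (T, S, j) \<Rightarrow> d S * g T)"
      using eq j by (auto simp: a trees_def copies_def simp del: tsize.simps)
  next
    fix b assume "b \<in> (SIGMA i:{..n}. trees i \<times> copies (n - i))"
    then obtain i T S j where b: "b = (i, T, S, j)" "i \<le> n" "tsize T = i" "0 < j" "j * tsize S = n - i"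
      by (auto simp: trees_def copies_def)
    then show "(\<lambda>(T, S, j). (n - j * tsize S, Node (children T - replicate_mset j S), S, j)) ((\<lambda>(i, T, S, j). (graft T j S, S, j)) b) = b"
      "(\<lambda>(i, T, S, j). (graft T j S, S, j)) b \<in> (SIGMA T:trees n. SIGMA S:set_mset (children T). {1..count (children T) S})"
      by (auto simp: trees_def)
  qed
  also have "\<dots> = (\<Sum>i\<le>n. \<Sum>(T, S, j)\<in>trees i \<times> copies (n - i). d S * g (graft T j S))"
    by (subst sum.Sigma) (auto simp: case_prod_unfold)
  also have "\<dots> = (\<Sum>i\<le>n. \<Sum>T\<in>trees i. \<Sum>(S, j)\<in>copies (n - i). d S * g (graft T j S))"
    by (intro sum.cong refl) (simp add: sum.cartesian_product case_prod_unfold)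
  finally show ?thesis .
qed

definition tree_gf :: "(utree \<Rightarrow> 'a::comm_ring_1) \<Rightarrow> 'a fps" where
  "tree_gf f = Abs_fps (\<lambda>n. \<Sum>T\<in>trees n. f T)"

definition copies_gf :: "(utree \<Rightarrow> nat \<Rightarrow> 'a::comm_ring_1) \<Rightarrow> 'a fps" where
  "copies_gf f = Abs_fps (\<lambda>m. \<Sum>(S, j)\<in>copies m. f S j)"

text \<open>One of the \<open>Suc k\<close> factors is expanded over the root subtrees and marked.
  After grafting, the other k factors read \<open>D T + of_nat j * d S\<close>, and the binomial
  theorem separates the remaining tree from the grafted copies.\<close>

lemma tree_gf_additive_power:
  fixes D d :: "utree \<Rightarrow> 'a::comm_ring_1"
  assumes D: "\<And>T. D T = (\<Sum>S\<in>#children T. d S)"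
  shows "tree_gf (\<lambda>T. D T ^ Suc k) =
    (\<Sum>l\<le>k. of_nat (k choose l) * (tree_gf (\<lambda>T. D T ^ (k - l)) * copies_gf (\<lambda>S j. of_nat j ^ l * d S ^ Suc l)))"
proof (rule fps_ext)
  fix n
  have of_nat_mult_nth: "fps_nth (of_nat c * f) n = of_nat c * fps_nth f n" for c and f :: "'a fps"
    by (metis fps_mult_left_const_nth fps_of_nat)
  have Dg: "D (graft T j S) = of_nat j * d S + D T" for T j S
    by (simp add: D image_replicate_mset add.commute)
  have "fps_nth (tree_gf (\<lambda>T. D T ^ Suc k)) n = (\<Sum>T\<in>trees n. (\<Sum>S\<in>#children T. d S) * D T ^ k)"
    by (simp add: tree_gf_def flip: D)
  also have "\<dots> = (\<Sum>i\<le>n. \<Sum>T\<in>trees i. \<Sum>(S, j)\<in>copies (n - i). d S * (of_nat j * d S + D T) ^ k)"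
    by (subst sum_trees_mark_child) (simp add: Dg)
  also have "\<dots> = (\<Sum>i\<le>n. \<Sum>T\<in>trees i. \<Sum>(S, j)\<in>copies (n - i). \<Sum>l\<le>k. of_nat (k choose l) * (D T ^ (k - l) * (of_nat j ^ l * d S ^ Suc l)))"
    by (intro sum.cong refl)
       (auto simp: binomial_ring sum_distrib_left power_mult_distrib mult_ac intro!: sum.cong)
  also have "\<dots> = (\<Sum>i\<le>n. \<Sum>T\<in>trees i. \<Sum>l\<le>k. \<Sum>(S, j)\<in>copies (n - i). of_nat (k choose l) * (D T ^ (k - l) * (of_nat j ^ l * d S ^ Suc l)))"
    by (intro sum.cong refl) (subst sum.swap, simp add: case_prod_unfold)
  also have "\<dots> = (\<Sum>i\<le>n. \<Sum>l\<le>k. \<Sum>T\<in>trees i. \<Sum>(S, j)\<in>copies (n - i). of_nat (k choose l) * (D T ^ (k - l) * (of_nat j ^ l * d S ^ Suc l)))"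
    by (intro sum.cong refl) (rule sum.swap)
  also have "\<dots> = (\<Sum>l\<le>k. \<Sum>i\<le>n. \<Sum>T\<in>trees i. \<Sum>(S, j)\<in>copies (n - i). of_nat (k choose l) * (D T ^ (k - l) * (of_nat j ^ l * d S ^ Suc l)))"
    by (rule sum.swap)
  also have "\<dots> = (\<Sum>l\<le>k. of_nat (k choose l) * (\<Sum>i\<le>n. (\<Sum>T\<in>trees i. D T ^ (k - l)) * (\<Sum>(S, j)\<in>copies (n - i). of_nat j ^ l * d S ^ Suc l)))"
    by (simp only: sum_product case_prod_unfold) (simp only: sum_distrib_left)
  also have "\<dots> = fps_nth (\<Sum>l\<le>k. of_nat (k choose l) * (tree_gf (\<lambda>T. D T ^ (k - l)) * copies_gf (\<lambda>S j. of_nat j ^ l * d S ^ Suc l))) n"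
    by (simp only: fps_sum_nth of_nat_mult_nth) (simp add: fps_mult_nth tree_gf_def copies_gf_def atMost_atLeast0)
  finally show "fps_nth (tree_gf (\<lambda>T. D T ^ Suc k)) n = \<dots>" .
qed

section \<open>The functional equation of the tree series\<close>

lemma summable_power_times_geometric:
  fixes a :: real
  assumes "0 \<le> a" "a < 1"
  shows "summable (\<lambda>n. real n ^ p * a ^ n)"
proof -
  have "(\<lambda>n. (real n / real (Suc n)) ^ p) \<longlonglongrightarrow> 1 ^ p"
    by (intro tendsto_power LIMSEQ_n_over_Suc_n)
  then have "conv_radius (\<lambda>n. real n ^ p) = 1"
    by (intro conv_radius_ratio_limit_nonzero[where c = 1]) (auto simp: power_divide one_ereal_def)
  then show ?thesis using assms
    by (intro summable_in_conv_radius) (auto simp: one_ereal_def)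
qed

lemma power_times_geometric_bounded:
  fixes a :: real
  assumes "0 \<le> a" "a < 1"
  obtains K where "0 < K" "\<And>n. real n ^ p * a ^ n \<le> K"
proof -
  have "Bseq (\<lambda>n. real n ^ p * a ^ n)"
    using summable_LIMSEQ_zero[OF summable_power_times_geometric[OF assms]] convergent_def
    by (intro convergent_imp_Bseq) blast
  then obtain K where "0 < K" "\<And>n. norm (real n ^ p * a ^ n) \<le> K"
    by (auto elim: BseqE)
  then show thesis using that by (metis abs_le_D1 real_norm_def)
qed

text \<open>Truncated sums are used because convergence at \<open>rho\<close> is only a consequence
  of such bounds. For nonnegative terms the triangle i + j \<le> N lies inside the square.\<close>

lemma sum_fps_mult_le:
  fixes f g :: "real fps"
  assumes "\<And>n. 0 \<le> fps_nth f n" "\<And>n. 0 \<le> fps_nth g n" "0 \<le> x"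
  shows "(\<Sum>n\<le>N. fps_nth (f * g) n * x ^ n) \<le> (\<Sum>n\<le>N. fps_nth f n * x ^ n) * (\<Sum>n\<le>N. fps_nth g n * x ^ n)"
proof -
  have "(\<Sum>n\<le>N. fps_nth (f * g) n * x ^ n) = (\<Sum>n\<le>N. \<Sum>i\<le>n. (fps_nth f i * x ^ i) * (fps_nth g (n - i) * x ^ (n - i)))"
    by (intro sum.cong refl)
       (auto simp: fps_mult_nth atMost_atLeast0 sum_distrib_left mult_ac simp flip: power_add intro!: sum.cong)
  also have "\<dots> = (\<Sum>(i, j)\<in>{(i, j). i + j \<le> N}. (fps_nth f i * x ^ i) * (fps_nth g j * x ^ j))"
    by (rule sum.triangle_reindex_eq[symmetric])
  also have "\<dots> \<le> (\<Sum>(i, j)\<in>{..N} \<times> {..N}. (fps_nth f i * x ^ i) * (fps_nth g j * x ^ j))"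
    using assms by (intro sum_mono2) auto
  also have "\<dots> = (\<Sum>n\<le>N. fps_nth f n * x ^ n) * (\<Sum>n\<le>N. fps_nth g n * x ^ n)"
    by (simp add: sum_product sum.cartesian_product)
  finally show ?thesis .
qed

lemma fps_power_nth_nonneg:
  fixes f :: "real fps"
  assumes "\<And>n. 0 \<le> fps_nth f n"
  shows "0 \<le> fps_nth (f ^ k) n"
  using assms by (induction k arbitrary: n) (auto simp: fps_mult_nth intro!: sum_nonneg)

lemma sum_fps_power_le:
  fixes f :: "real fps"
  assumes f: "\<And>n. 0 \<le> fps_nth f n" and x: "0 \<le> x"
  shows "(\<Sum>n\<le>N. fps_nth (f ^ k) n * x ^ n) \<le> (\<Sum>n\<le>N. fps_nth f n * x ^ n) ^ k"
proof (induction k)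
  case 0
  have "(\<Sum>n\<le>N. fps_nth (1::real fps) n * x ^ n) = (\<Sum>n\<le>N. if n = 0 then 1 else 0)"
    by (intro sum.cong) auto
  then show ?case by simp
next
  case (Suc k)
  have "(\<Sum>n\<le>N. fps_nth (f ^ Suc k) n * x ^ n) \<le> (\<Sum>n\<le>N. fps_nth f n * x ^ n) * (\<Sum>n\<le>N. fps_nth (f ^ k) n * x ^ n)"
    using f x by (simp add: sum_fps_mult_le fps_power_nth_nonneg)
  also have "\<dots> \<le> (\<Sum>n\<le>N. fps_nth f n * x ^ n) * (\<Sum>n\<le>N. fps_nth f n * x ^ n) ^ k"
    using f x by (intro mult_left_mono Suc.IH sum_nonneg) auto
  finally show ?case by simp
qed

abbreviation fexp :: "real fps \<Rightarrow> real fps" where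
  "fexp f \<equiv> fps_compose (fps_exp 1) f"

lemma fexp_nth_nonneg:
  assumes "\<And>n. 0 \<le> fps_nth f n"
  shows "0 \<le> fps_nth (fexp f) n"
  using assms by (auto simp: fps_compose_nth intro!: sum_nonneg fps_power_nth_nonneg divide_nonneg_nonneg)

lemma sum_fexp_le:
  assumes f: "\<And>n. 0 \<le> fps_nth f n" and x: "0 \<le> x"
  shows "(\<Sum>n\<le>N. fps_nth (fexp f) n * x ^ n) \<le> exp (\<Sum>n\<le>N. fps_nth f n * x ^ n)"
proof -
  let ?G = "\<Sum>n\<le>N. fps_nth f n * x ^ n"
  have "(\<Sum>n\<le>N. fps_nth (fexp f) n * x ^ n) \<le> (\<Sum>n\<le>N. \<Sum>k\<le>N. 1 / fact k * (fps_nth (f ^ k) n * x ^ n))"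
  proof (rule sum_mono)
    fix n assume n: "n \<in> {..N}"
    have "fps_nth (fexp f) n * x ^ n = (\<Sum>k\<in>{0..n}. 1 / fact k * (fps_nth (f ^ k) n * x ^ n))"
      by (simp add: fps_compose_nth sum_distrib_right)
    also have "\<dots> \<le> (\<Sum>k\<le>N. 1 / fact k * (fps_nth (f ^ k) n * x ^ n))"
      using n f x by (intro sum_mono2 mult_nonneg_nonneg fps_power_nth_nonneg) auto
    finally show "fps_nth (fexp f) n * x ^ n \<le> (\<Sum>k\<le>N. 1 / fact k * (fps_nth (f ^ k) n * x ^ n))" .
  qed
  also have "\<dots> = (\<Sum>k\<le>N. 1 / fact k * (\<Sum>n\<le>N. fps_nth (f ^ k) n * x ^ n))"
    by (subst sum.swap) (simp add: sum_distrib_left)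
  also have "\<dots> \<le> (\<Sum>k\<le>N. 1 / fact k * ?G ^ k)"
    using f x by (intro sum_mono mult_left_mono sum_fps_power_le) auto
  also have "\<dots> \<le> (\<Sum>k. ?G ^ k /\<^sub>R fact k)"
  proof -
    have "0 \<le> ?G" using f x by (intro sum_nonneg) auto
    then have "(\<Sum>k\<le>N. ?G ^ k /\<^sub>R fact k) \<le> (\<Sum>k. ?G ^ k /\<^sub>R fact k)"
      by (intro sum_le_suminf summable_exp_generic) auto
    then show ?thesis by (simp add: divide_inverse)
  qed
  finally show ?thesis by (simp add: exp_def)
qed

section \<open>The tree series and Polya's equation\<close>

definition tree_series :: "real fps" where "tree_series = tree_gf (\<lambda>_. 1)"

text \<open>The contribution of repeated subtrees. These are series in \<open>x\<^sup>2, x\<^sup>3, \<dots>\<close>, so they have a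
  larger radius of convergence than the tree series itself.\<close>
definition twin_gf :: "(utree \<Rightarrow> nat \<Rightarrow> 'a::comm_ring_1) \<Rightarrow> 'a fps" where
  "twin_gf f = copies_gf (\<lambda>S j. if 2 \<le> j then f S j else 0)"

definition twin_series :: "real fps" where "twin_series = twin_gf (\<lambda>S j. 1 / real j)"

lemma tree_series_nth: "fps_nth tree_series n = real (card (trees n))"
  by (simp add: tree_series_def tree_gf_def)

lemma copies_gf_split: "copies_gf f = tree_gf (\<lambda>S. f S 1) + twin_gf f"
proof (rule fps_ext)
  fix m
  have "(\<Sum>(S, j)\<in>copies m. f S j) = (\<Sum>(S, j)\<in>copies m. (if j = 1 then f S j else 0) + (if 2 \<le> j then f S j else 0))"
    by (intro sum.cong refl) (auto simp: copies_def)
  also have "\<dots> = (\<Sum>(S, j)\<in>copies m. if j = 1 then f S j else 0) + (\<Sum>(S, j)\<in>copies m. if 2 \<le> j then f S j else 0)"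
    by (simp add: case_prod_unfold sum.distrib)
  also have "(\<Sum>(S, j)\<in>copies m. if j = 1 then f S j else 0) = (\<Sum>(S, j)\<in>(\<lambda>S. (S, 1)) ` trees m. f S j)"
    by (rule sum.mono_neutral_cong_right[OF finite_copies]) (auto simp: copies_def trees_def split: if_splits)
  also have "\<dots> = (\<Sum>S\<in>trees m. f S 1)"
    by (subst sum.reindex) (auto simp: inj_on_def)
  finally show "fps_nth (copies_gf f) m = fps_nth (tree_gf (\<lambda>S. f S 1) + twin_gf f) m"
    by (simp add: copies_gf_def tree_gf_def twin_gf_def)
qed

lemma tree_series_nth_0 [simp]: "fps_nth tree_series 0 = 0" and tree_series_nth_1 [simp]: "fps_nth tree_series (Suc 0) = 1"
  by (simp_all add: tree_series_nth)

lemma copies_0 [simp]: "copies 0 = {}"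
  by (auto simp: copies_def)

lemma twin_series_nth_0 [simp]: "fps_nth twin_series 0 = 0"
  by (simp add: twin_series_def twin_gf_def copies_gf_def)

lemma tree_series_nth_nonneg: "0 \<le> fps_nth tree_series n"
  by (simp add: tree_series_nth)

lemma twin_series_nth_nonneg: "0 \<le> fps_nth twin_series n"
  by (auto simp: twin_series_def twin_gf_def copies_gf_def intro!: sum_nonneg)

text \<open>The marking identity for first powers, with the size as additive function: the sizes of
  the root subtrees add up to |T| - 1. Since j |S| = n for the copies, |S| = n/j, which turns their
  series into x times the derivative of the sum of y(x^j)/j.\<close>

lemma tree_series_deriv_eq: "fps_X * fps_deriv tree_series - tree_series = tree_series * (fps_X * fps_deriv (tree_series + twin_series))"
proof -
  define D where "D = (\<lambda>T. \<Sum>S\<in>#children T. real (tsize S))"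
  have D: "D T = real (tsize T) - 1" for T
    by (simp add: D_def tsize_children[of T] of_nat_sum_mset image_mset.compositionality o_def)
  have "tree_gf (\<lambda>T. D T ^ Suc 0) = (\<Sum>l\<le>(0::nat). of_nat (0 choose l) *
      (tree_gf (\<lambda>T. D T ^ (0 - l)) * copies_gf (\<lambda>S j. of_nat j ^ l * real (tsize S) ^ Suc l)))"
    by (rule tree_gf_additive_power) (simp add: D_def)
  then have 1: "tree_gf D = tree_series * copies_gf (\<lambda>S j. real (tsize S))"
    by (simp add: tree_series_def)
  have 2: "tree_gf D = fps_X * fps_deriv tree_series - tree_series"
  proof (rule fps_ext)
    fix n
    have "(\<Sum>T\<in>trees n. D T) = (\<Sum>T\<in>trees n. real n - 1)"
      by (intro sum.cong) (auto simp: D trees_def)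
    then show "fps_nth (tree_gf D) n = fps_nth (fps_X * fps_deriv tree_series - tree_series) n"
      by (cases n) (simp_all add: tree_gf_def tree_series_nth algebra_simps)
  qed
  have YQ: "tree_series + twin_series = copies_gf (\<lambda>S j. 1 / real j)"
    by (simp add: tree_series_def twin_series_def copies_gf_split)
  have 3: "copies_gf (\<lambda>S j. real (tsize S)) = fps_X * fps_deriv (tree_series + twin_series)"
  proof (rule fps_ext)
    fix n
    have "(\<Sum>(S, j)\<in>copies n. real (tsize S)) = (\<Sum>(S, j)\<in>copies n. real n * (1 / real j))"
      by (intro sum.cong) (auto simp: copies_def)
    then show "fps_nth (copies_gf (\<lambda>S j. real (tsize S))) n = fps_nth (fps_X * fps_deriv (tree_series + twin_series)) n"
      unfolding YQ by (cases n) (simp_all add: copies_gf_def sum_distrib_left case_prod_unfold)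
  qed
  show ?thesis using 1 2 3 by simp
qed

text \<open>y/x, the series of multisets of trees. Its constant term 1 allows the comparison with an
  exponential.\<close>

definition forest_series :: "real fps" where "forest_series = fps_shift 1 tree_series"

lemma tree_series_eq_X_Z: "tree_series = fps_X * forest_series"
proof (rule fps_ext)
  fix n show "fps_nth tree_series n = fps_nth (fps_X * forest_series) n"
    by (cases n) (simp_all add: forest_series_def)
qed

lemma forest_series_deriv: "fps_deriv forest_series = forest_series * fps_deriv (tree_series + twin_series)"
proof -
  have "fps_X * fps_deriv tree_series - tree_series = fps_X * (fps_X * fps_deriv forest_series)"
    by (simp add: tree_series_eq_X_Z algebra_simps)
  also have "fps_X * fps_deriv tree_series - tree_series = fps_X * (fps_X * (forest_series * fps_deriv (tree_series + twin_series)))"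
    unfolding tree_series_deriv_eq by (subst tree_series_eq_X_Z) (simp only: mult_ac)
  finally show ?thesis by (metis fps_X_neq_zero mult_left_cancel)
qed

lemma fexp_deriv:
  assumes "fps_nth f 0 = 0"
  shows "fps_deriv (fexp f) = fexp f * fps_deriv f"
  using assms by (simp add: fps_compose_deriv)

text \<open>The quotient of \<open>G\<close> by the exponential has derivative 0 and constant term
  1.\<close>

lemma fexp_unique:
  assumes "fps_deriv G = G * fps_deriv f" "fps_nth f 0 = 0" "fps_nth G 0 = 1"
  shows "G = fexp f"
proof -
  let ?W = "fexp f"
  have W0: "fps_nth ?W 0 = 1" by simp
  then have inv: "inverse ?W * ?W = 1" by (intro inverse_mult_eq_1) simp
  have "fps_deriv (G * inverse ?W) = 0"
    using W0 inv assms
    by (simp add: fps_inverse_deriv fexp_deriv power2_eq_square) (simp add: algebra_simps)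
  then have "G * inverse ?W = fps_const (fps_nth (G * inverse ?W) 0)"
    by (metis fps_deriv_eq_0_iff)
  also have "fps_nth (G * inverse ?W) 0 = 1" using W0 assms by simp
  finally have "G * inverse ?W * ?W = ?W" by simp
  then show ?thesis using inv by (simp add: mult.assoc)
qed

lemma forest_series_eq_fexp: "forest_series = fexp (tree_series + twin_series)"
  by (rule fexp_unique[OF forest_series_deriv]) (simp_all add: forest_series_def)

lemma tree_series_eq: "tree_series = fps_X * fexp (tree_series + twin_series)"
  using tree_series_eq_X_Z forest_series_eq_fexp by simp

text \<open>With at least two copies the subtree has at most m/2 vertices, leaving at most 4^(m/2) =
  2^m choices for each j. This is why the twin series converge up to 1/2, beyond \<open>rho\<close>
  \<le> 2/5.\<close>

lemma card_twins_le: "real (card {(S, j) \<in> copies m. 2 \<le> j}) \<le> real m * 2 ^ m"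
proof -
  have "{(S, j) \<in> copies m. 2 \<le> j} \<subseteq> (\<Union>j\<in>{2..m}. trees (m div j) \<times> {j})"
  proof clarify
    fix S j assume "(S, j) \<in> copies m" "2 \<le> j"
    moreover have "j \<le> j * tsize S" using tsize_pos[of S] by (simp add: Suc_leI)
    ultimately show "(S, j) \<in> (\<Union>j\<in>{2..m}. trees (m div j) \<times> {j})"
      by (auto simp: copies_def trees_def)
  qed
  then have "card {(S, j) \<in> copies m. 2 \<le> j} \<le> card (\<Union>j\<in>{2..m}. trees (m div j) \<times> {j})"
    by (intro card_mono) auto
  also have "\<dots> \<le> (\<Sum>j\<in>{2..m}. card (trees (m div j) \<times> {j}))"
    by (rule card_UN_le) simp
  finally have "real (card {(S, j) \<in> copies m. 2 \<le> j}) \<le> (\<Sum>j\<in>{2..m}. real (card (trees (m div j))))"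
    by (simp add: card_cartesian_product flip: of_nat_sum)
  also have "\<dots> \<le> (\<Sum>j\<in>{2..m}. 2 ^ m)"
  proof (rule sum_mono)
    fix j assume "j \<in> {2..m}"
    then have "2 * (m div j) \<le> j * (m div j)" by (intro mult_right_mono) auto
    also have "j * (m div j) \<le> m" by simp
    finally have "(2::real) ^ (2 * (m div j)) \<le> 2 ^ m" by (intro power_increasing) auto
    then have "(4::real) ^ (m div j) \<le> 2 ^ m" by (simp add: power_mult)
    then show "real (card (trees (m div j))) \<le> 2 ^ m"
      by (rule order.trans[OF card_trees_le])
  qed
  also have "\<dots> \<le> real m * 2 ^ m" by simp
  finally show ?thesis .
qed

lemma twin_gf_nth_le:
  fixes f :: "utree \<Rightarrow> nat \<Rightarrow> 'a::{real_normed_algebra,comm_ring_1}"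
  assumes "\<And>S j. (S, j) \<in> copies m \<Longrightarrow> 2 \<le> j \<Longrightarrow> norm (f S j) \<le> B" and B: "0 \<le> B"
  shows "norm (fps_nth (twin_gf f) m) \<le> B * (real m * 2 ^ m)"
proof -
  have "fps_nth (twin_gf f) m = (\<Sum>(S, j)\<in>{(S, j) \<in> copies m. 2 \<le> j}. f S j)"
    unfolding twin_gf_def copies_gf_def fps_nth_Abs_fps
    by (intro sum.mono_neutral_cong_right) (auto split: if_splits)
  also have "norm \<dots> \<le> (\<Sum>(S, j)\<in>{(S, j) \<in> copies m. 2 \<le> j}. B)"
    using assms by (intro sum_norm_le) auto
  also have "\<dots> = real (card {(S, j) \<in> copies m. 2 \<le> j}) * B" by simp
  also have "\<dots> \<le> (real m * 2 ^ m) * B" by (intro mult_right_mono card_twins_le B)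
  finally show ?thesis by (simp add: mult.commute)
qed

section \<open>The dominant singularity\<close>

definition cfps :: "real fps \<Rightarrow> complex fps" where
  "cfps f = Abs_fps (\<lambda>n. of_real (fps_nth f n))"

lemma cfps_nth [simp]: "fps_nth (cfps f) n = of_real (fps_nth f n)"
  by (simp add: cfps_def)

lemma cfps_add: "cfps (f + g) = cfps f + cfps g"
  by (rule fps_ext) simp

lemma cfps_mult: "cfps (f * g) = cfps f * cfps g"
  by (rule fps_ext) (simp add: fps_mult_nth)

lemma cfps_deriv: "cfps (fps_deriv f) = fps_deriv (cfps f)"
  by (rule fps_ext) simp

lemma cfps_X: "cfps fps_X = fps_X"
  by (rule fps_ext) (simp add: fps_X_def)

lemma fps_conv_radius_geI:
  fixes f :: "'a::{banach,real_normed_div_algebra} fps"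
  assumes "\<And>r. 0 < r \<Longrightarrow> r < R \<Longrightarrow> summable (\<lambda>n. norm (fps_nth f n) * r ^ n)"
  shows "fps_conv_radius f \<ge> ereal R"
  unfolding fps_conv_radius_def
proof (rule conv_radius_geI_ex')
  fix r assume r: "0 < r" "ereal r < ereal R"
  show "summable (\<lambda>n. fps_nth f n * of_real r ^ n)"
    by (rule summable_norm_cancel) (use assms[of r] r in \<open>simp add: norm_mult norm_power\<close>)
qed

lemma less_conv_radius: "a < b \<Longrightarrow> ereal b \<le> R \<Longrightarrow> ereal a < R"
  by (metis less_ereal.simps(1) less_le_trans)

lemma fps_conv_radius_cfps: "fps_conv_radius (cfps f) = fps_conv_radius f"
proof -
  have "conv_radius (fps_nth (cfps f)) = conv_radius (fps_nth f)"
    by (rule conv_radius_cong) simp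
  then show ?thesis by (simp add: fps_conv_radius_def)
qed

lemma norm_eval_fps_le:
  fixes f :: "'a::{banach,real_normed_div_algebra} fps"
  assumes "summable (\<lambda>n. norm (fps_nth f n) * r ^ n)" "norm x \<le> r"
  shows "norm (eval_fps f x) \<le> (\<Sum>n. norm (fps_nth f n) * r ^ n)"
proof -
  have le: "norm (fps_nth f n * x ^ n) \<le> norm (fps_nth f n) * r ^ n" for n
    using assms(2) by (simp add: norm_mult norm_power mult_left_mono power_mono)
  have sm: "summable (\<lambda>n. norm (fps_nth f n * x ^ n))"
    by (rule summable_comparison_test'[OF assms(1)]) (use le in simp)
  then have "norm (eval_fps f x) \<le> (\<Sum>n. norm (fps_nth f n * x ^ n))"
    unfolding eval_fps_def by (rule summable_norm)
  also have "\<dots> \<le> (\<Sum>n. norm (fps_nth f n) * r ^ n)"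
    by (intro suminf_le le sm assms)
  finally show ?thesis .
qed

lemma fps_conv_radius_twin:
  fixes f :: "'a::{banach,real_normed_div_algebra} fps"
  assumes "\<And>m. norm (fps_nth f m) \<le> K * (real m ^ p * 2 ^ m)"
  shows "fps_conv_radius f \<ge> ereal (1/2)"
proof (rule fps_conv_radius_geI)
  fix r :: real assume r: "0 < r" "r < 1/2"
  have "summable (\<lambda>m. K * (real m ^ p * (2 * r) ^ m))"
    using r by (intro summable_mult summable_power_times_geometric) auto
  then show "summable (\<lambda>n. norm (fps_nth f n) * r ^ n)"
  proof (rule summable_comparison_test')
    fix n
    have "norm (fps_nth f n) * r ^ n \<le> (K * (real n ^ p * 2 ^ n)) * r ^ n"
      using r assms by (intro mult_right_mono) auto
    then show "norm (norm (fps_nth f n) * r ^ n) \<le> K * (real n ^ p * (2 * r) ^ n)"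
      using r by (simp add: power_mult_distrib mult_ac)
  qed
qed

lemma twin_series_conv_radius: "fps_conv_radius twin_series \<ge> ereal (1/2)"
proof (rule fps_conv_radius_twin[where K = 1 and p = 1])
  fix m
  have "norm (fps_nth twin_series m) \<le> 1 * (real m * 2 ^ m)"
    unfolding twin_series_def by (rule twin_gf_nth_le) auto
  then show "norm (fps_nth twin_series m) \<le> 1 * (real m ^ 1 * 2 ^ m)" by simp
qed

lemma summable_Q: "0 \<le> x \<Longrightarrow> x < 1/2 \<Longrightarrow> summable (\<lambda>n. fps_nth twin_series n * x ^ n)"
  by (intro summable_fps less_conv_radius[OF _ twin_series_conv_radius]) simp

lemma eval_Q_nonneg: "0 \<le> x \<Longrightarrow> x < 1/2 \<Longrightarrow> 0 \<le> eval_fps twin_series x"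
  unfolding eval_fps_def by (intro suminf_nonneg summable_Q) (auto simp: twin_series_nth_nonneg)

text \<open>Intermediate value theorem on [0, 2/5]: since e \<ge> 1 + 1 + 1/2 = 5/2, the value at
  2/5 is already at least 1, and 2/5 < 1/2 stays inside the disc where q converges.\<close>

lemma ex_rho: "\<exists>x>0. x \<le> 2/5 \<and> x * exp (1 + eval_fps twin_series x) = 1"
proof -
  let ?f = "\<lambda>x::real. x * exp (1 + eval_fps twin_series x)"
  have "continuous_on {0..2/5} (eval_fps twin_series)"
    by (rule continuous_on_subset[OF continuous_on_eval_fps])
       (auto intro!: less_conv_radius[OF _ twin_series_conv_radius])
  then have cont: "continuous_on {0..2/5} ?f"
    by (intro continuous_on_mult continuous_on_id continuous_on_exp continuous_on_add continuous_on_const)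
  have "5/2 \<le> exp (1::real)"
    using exp_lower_Taylor_quadratic[of 1] by simp
  also have "\<dots> \<le> exp (1 + eval_fps twin_series (2/5))"
    using eval_Q_nonneg[of "2/5"] by simp
  finally have "1 \<le> ?f (2/5)" by simp
  moreover have "?f 0 \<le> 1" by simp
  ultimately obtain x where x: "0 \<le> x" "x \<le> 2/5" "?f x = 1"
    using IVT'[of ?f 0 1 "2/5"] cont by auto
  then have "x \<noteq> 0" by auto
  with x show ?thesis by (intro exI[of _ x]) auto
qed

text \<open>The reciprocal of Otter's constant 2.9557..., about 0.338. As x exp (1 + q(x))
  increases, the choice is unique.\<close>

definition rho :: real where
  "rho = (SOME x. 0 < x \<and> x \<le> 2/5 \<and> x * exp (1 + eval_fps twin_series x) = 1)"

lemma rho_pos: "0 < rho" and rho_le: "rho \<le> 2/5" and rho_eq: "rho * exp (1 + eval_fps twin_series rho) = 1"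
proof -
  have "0 < rho \<and> rho \<le> 2/5 \<and> rho * exp (1 + eval_fps twin_series rho) = 1"
    unfolding rho_def by (rule someI_ex) (use ex_rho in blast)
  then show "0 < rho" "rho \<le> 2/5" "rho * exp (1 + eval_fps twin_series rho) = 1" by auto
qed

text \<open>The truncations satisfy s_(N+1) \<le> \<open>rho\<close> exp (s_N +
  q(\<open>rho\<close>)), and by the definition of \<open>rho\<close> the number 1 is a fixed point
  of this increasing map.\<close>

lemma sum_Y_rho_le: "(\<Sum>n\<le>N. fps_nth tree_series n * rho ^ n) \<le> 1"
proof (induction N)
  case (Suc N)
  have "(\<Sum>n\<le>Suc N. fps_nth tree_series n * rho ^ n) = (\<Sum>n\<le>N. fps_nth tree_series (Suc n) * rho ^ Suc n)"
    by (subst sum.atMost_Suc_shift) simp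
  also have "\<dots> = rho * (\<Sum>n\<le>N. fps_nth (fexp (tree_series + twin_series)) n * rho ^ n)"
    by (subst tree_series_eq) (simp add: sum_distrib_left mult_ac)
  also have "\<dots> \<le> rho * exp (\<Sum>n\<le>N. fps_nth (tree_series + twin_series) n * rho ^ n)"
    using rho_pos by (intro mult_left_mono sum_fexp_le) (auto simp: tree_series_nth_nonneg twin_series_nth_nonneg)
  also have "\<dots> \<le> rho * exp (1 + eval_fps twin_series rho)"
  proof -
    have "(\<Sum>n\<le>N. fps_nth twin_series n * rho ^ n) \<le> eval_fps twin_series rho"
      unfolding eval_fps_def using rho_pos rho_le
      by (intro sum_le_suminf summable_Q) (auto simp: twin_series_nth_nonneg)
    then show ?thesis using Suc.IH rho_pos by (simp add: ring_distribs sum.distrib)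
  qed
  finally show ?case by (simp add: rho_eq)
qed simp

lemma summable_Y_rho: "summable (\<lambda>n. fps_nth tree_series n * rho ^ n)"
  and suminf_Y_rho_le: "(\<Sum>n. fps_nth tree_series n * rho ^ n) \<le> 1"
proof -
  have "(\<Sum>n<N. fps_nth tree_series n * rho ^ n) \<le> 1" for N
    using sum_Y_rho_le[of "N - 1"] by (cases N) (auto simp: lessThan_Suc_atMost)
  then show "summable (\<lambda>n. fps_nth tree_series n * rho ^ n)" "(\<Sum>n. fps_nth tree_series n * rho ^ n) \<le> 1"
    using rho_pos sum_Y_rho_le
    by (auto intro!: bounded_imp_summable[where B = 1] suminf_le_const simp: tree_series_nth_nonneg)
qed

lemma card_trees_rho_le: "real (card (trees n)) * rho ^ n \<le> 1"
proof -
  have "real (card (trees n)) * rho ^ n \<le> (\<Sum>n\<le>n. fps_nth tree_series n * rho ^ n)"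
    unfolding tree_series_nth using rho_pos by (intro member_le_sum) auto
  then show ?thesis using sum_Y_rho_le[of n] by simp
qed

lemma fps_conv_radius_tree:
  fixes f :: "'a::{banach,real_normed_div_algebra} fps"
  assumes "\<And>n. norm (fps_nth f n) \<le> K * real n ^ p * real (card (trees n))" and K: "0 \<le> K"
  shows "fps_conv_radius f \<ge> ereal rho"
proof (rule fps_conv_radius_geI)
  fix r :: real assume r: "0 < r" "r < rho"
  have "summable (\<lambda>n. K * (real n ^ p * (r / rho) ^ n))"
    using r rho_pos by (intro summable_mult summable_power_times_geometric) auto
  then show "summable (\<lambda>n. norm (fps_nth f n) * r ^ n)"
  proof (rule summable_comparison_test')
    fix n
    have "norm (fps_nth f n) * r ^ n \<le> (K * real n ^ p * real (card (trees n))) * r ^ n"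
      using r assms by (intro mult_right_mono) auto
    also have "\<dots> = (K * real n ^ p * (r / rho) ^ n) * (real (card (trees n)) * rho ^ n)"
      using rho_pos by (simp add: power_divide)
    also have "\<dots> \<le> (K * real n ^ p * (r / rho) ^ n) * 1"
      using r rho_pos K by (intro mult_left_mono card_trees_rho_le) auto
    finally show "norm (norm (fps_nth f n) * r ^ n) \<le> K * (real n ^ p * (r / rho) ^ n)"
      using r by (simp add: mult_ac)
  qed
qed

lemma tree_series_conv_radius: "fps_conv_radius tree_series \<ge> ereal rho"
  by (rule fps_conv_radius_tree[where K = 1 and p = 0]) (auto simp: tree_series_nth)

text \<open>f exp (-g) has derivative 0 on the disc up to x. This carries a formal exponential
  identity over to values without discussing convergence of a composition.\<close>

lemma eval_fps_exp_ODE: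
  fixes f g :: "complex fps"
  assumes "fps_deriv f = f * fps_deriv g" "ereal (norm x) < fps_conv_radius f" "ereal (norm x) < fps_conv_radius g"
  shows "eval_fps f x = fps_nth f 0 * exp (eval_fps g x - fps_nth g 0)"
proof -
  let ?h = "\<lambda>x. eval_fps f x * exp (- eval_fps g x)"
  have "(?h has_field_derivative 0) (at t within cball 0 (norm x))" if "t \<in> cball 0 (norm x)" for t
  proof -
    have t: "ereal (norm t) < fps_conv_radius f" "ereal (norm t) < fps_conv_radius g"
      using that le_less_trans[OF _ assms(2)] le_less_trans[OF _ assms(3)] by auto
    have t': "ereal (norm t) < fps_conv_radius (fps_deriv g)"
      using t(2) fps_conv_radius_deriv[of g] by (rule less_le_trans)
    have d: "eval_fps (fps_deriv f) t = eval_fps f t * eval_fps (fps_deriv g) t"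
      unfolding assms(1) using t(1) t' by (rule eval_fps_mult)
    show ?thesis
      by (rule derivative_eq_intros has_field_derivative_eval_fps t refl)+ (simp add: d)
  qed
  then obtain c where c: "\<And>t. t \<in> cball 0 (norm x) \<Longrightarrow> ?h t = c"
    using has_field_derivative_zero_constant[of "cball 0 (norm x)" ?h] by auto
  have "?h x = ?h 0" using c[of x] c[of 0] by simp
  then have "eval_fps f x * exp (- eval_fps g x) * exp (eval_fps g x) = fps_nth f 0 * exp (- fps_nth g 0) * exp (eval_fps g x)"
    by (simp add: eval_fps_at_0)
  then show ?thesis by (simp add: mult.assoc flip: exp_add)
qed

section \<open>Values of y and q in the disc of radius rho\<close>

abbreviation yv :: "complex \<Rightarrow> complex" where "yv x \<equiv> eval_fps (cfps tree_series) x"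
abbreviation qv :: "complex \<Rightarrow> complex" where "qv x \<equiv> eval_fps (cfps twin_series) x"

lemma conv_radius_lt_rho:
  assumes "norm x < rho" "ereal rho \<le> fps_conv_radius f"
  shows "ereal (norm x) < fps_conv_radius f"
  using assms by (rule less_conv_radius)

lemma cY_radius: "fps_conv_radius (cfps tree_series) \<ge> ereal rho"
  by (simp add: fps_conv_radius_cfps tree_series_conv_radius)

lemma cZ_radius: "fps_conv_radius (cfps forest_series) \<ge> ereal rho"
  by (simp add: fps_conv_radius_cfps forest_series_def tree_series_conv_radius)

lemma cQ_radius: "fps_conv_radius (cfps twin_series) \<ge> ereal rho"
proof -
  have "ereal rho \<le> ereal (1/2)" using rho_le by simp
  also note twin_series_conv_radius
  finally show ?thesis by (simp add: fps_conv_radius_cfps)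
qed

lemma eval_Z: 
  assumes "norm x < rho"
  shows "eval_fps (cfps forest_series) x = exp (yv x + qv x)"
proof -
  have r: "ereal (norm x) < fps_conv_radius (cfps tree_series)" "ereal (norm x) < fps_conv_radius (cfps twin_series)"
     "ereal (norm x) < fps_conv_radius (cfps forest_series)"
    using assms conv_radius_lt_rho cY_radius cQ_radius cZ_radius by auto
  have "eval_fps (cfps forest_series) x = fps_nth (cfps forest_series) 0 * exp (eval_fps (cfps tree_series + cfps twin_series) x - fps_nth (cfps tree_series + cfps twin_series) 0)"
  proof (rule eval_fps_exp_ODE)
    show "fps_deriv (cfps forest_series) = cfps forest_series * fps_deriv (cfps tree_series + cfps twin_series)"
      using forest_series_deriv by (metis cfps_add cfps_deriv cfps_mult)
    show "ereal (norm x) < fps_conv_radius (cfps tree_series + cfps twin_series)"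
      by (rule less_le_trans[OF _ fps_conv_radius_add]) (use r in simp)
  qed (rule r)
  then show ?thesis using r by (simp add: eval_fps_add forest_series_def)
qed

lemma yv_eq:
  assumes "norm x < rho"
  shows "yv x = x * exp (yv x + qv x)"
proof -
  have "cfps tree_series = fps_X * cfps forest_series"
    using tree_series_eq_X_Z by (metis cfps_X cfps_mult)
  moreover have "ereal (norm x) < fps_conv_radius (cfps forest_series)"
    using assms cZ_radius by (rule conv_radius_lt_rho)
  ultimately have "yv x = x * eval_fps (cfps forest_series) x" by (simp add: eval_fps_mult)
  then show ?thesis using eval_Z[OF assms] by simp
qed

lemma norm_yv_le:
  assumes "norm x \<le> rho"
  shows "norm (yv x) \<le> 1"
proof -
  have "norm (yv x) \<le> (\<Sum>n. norm (fps_nth (cfps tree_series) n) * rho ^ n)"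
    using summable_Y_rho assms by (intro norm_eval_fps_le) (simp_all add: tree_series_nth_nonneg)
  then show ?thesis using suminf_Y_rho_le by (simp add: tree_series_nth_nonneg)
qed

definition exp_twin_series :: "real fps" where "exp_twin_series = fexp twin_series"

lemma exp_twin_series_nth_nonneg: "0 \<le> fps_nth exp_twin_series n"
  unfolding exp_twin_series_def by (rule fexp_nth_nonneg) (rule twin_series_nth_nonneg)

lemma exp_twin_series_nth_0 [simp]: "fps_nth exp_twin_series 0 = 1"
  by (simp add: exp_twin_series_def)

lemma summable_W: 
  assumes "0 \<le> r" "r < 1/2"
  shows "summable (\<lambda>n. fps_nth exp_twin_series n * r ^ n)"
proof (rule bounded_imp_summable)
  fix N
  have "(\<Sum>n\<le>N. fps_nth exp_twin_series n * r ^ n) \<le> exp (\<Sum>n\<le>N. fps_nth twin_series n * r ^ n)"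
    unfolding exp_twin_series_def using assms by (intro sum_fexp_le twin_series_nth_nonneg)
  also have "\<dots> \<le> exp (\<Sum>n. fps_nth twin_series n * r ^ n)"
    using assms by (simp, intro sum_le_suminf summable_Q) (auto simp: twin_series_nth_nonneg)
  finally show "(\<Sum>n\<le>N. fps_nth exp_twin_series n * r ^ n) \<le> exp (\<Sum>n. fps_nth twin_series n * r ^ n)" .
qed (use assms exp_twin_series_nth_nonneg in auto)

lemma exp_twin_series_conv_radius: "fps_conv_radius exp_twin_series \<ge> ereal (1/2)"
  by (rule fps_conv_radius_geI) (use summable_W in \<open>simp add: exp_twin_series_nth_nonneg\<close>)

lemma eval_W:
  assumes "norm x < 1/2"
  shows "eval_fps (cfps exp_twin_series) x = exp (qv x)"
proof -
  have "eval_fps (cfps exp_twin_series) x = fps_nth (cfps exp_twin_series) 0 * exp (qv x - fps_nth (cfps twin_series) 0)"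
  proof (rule eval_fps_exp_ODE)
    show "fps_deriv (cfps exp_twin_series) = cfps exp_twin_series * fps_deriv (cfps twin_series)"
      using fexp_deriv[of twin_series] by (metis exp_twin_series_def twin_series_nth_0 cfps_deriv cfps_mult)
    show "ereal (norm x) < fps_conv_radius (cfps exp_twin_series)" "ereal (norm x) < fps_conv_radius (cfps twin_series)"
      unfolding fps_conv_radius_cfps
      by (rule less_conv_radius[OF assms exp_twin_series_conv_radius] less_conv_radius[OF assms twin_series_conv_radius])+
  qed
  then show ?thesis by simp
qed

text \<open>\<open>step_wt n\<close> is the coefficient of \<open>z\<^bsup>n+1\<^esup>\<close> (note the shift) in \<open>\<rho>z exp (1 + q(\<rho>z))\<close>. By the choice of
  \<open>\<rho>\<close> the weights add up to 1.\<close>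
definition step_wt :: "nat \<Rightarrow> real" where "step_wt n = exp 1 * fps_nth exp_twin_series n * rho ^ Suc n"

lemma step_wt_nonneg: "0 \<le> step_wt n"
  using rho_pos by (simp add: step_wt_def exp_twin_series_nth_nonneg)

lemma step_wt_0_pos: "0 < step_wt 0"
  using rho_pos by (simp add: step_wt_def)

text \<open>11/10 times 2/5 is 0.44 < 1/2: because q is analytic beyond \<open>rho\<close>, the
  weights decay exponentially and have all moments.\<close>

lemma summable_wt: "summable (\<lambda>n. step_wt n * (11/10) ^ n)"
proof -
  have "summable (\<lambda>n. (exp 1 * rho) * (fps_nth exp_twin_series n * (11/10 * rho) ^ n))"
    using rho_pos rho_le by (intro summable_mult summable_W) auto
  moreover have "(exp 1 * rho) * (fps_nth exp_twin_series n * (11/10 * rho) ^ n) = step_wt n * (11/10) ^ n" for n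
    by (simp only: step_wt_def power_mult_distrib power_Suc mult_ac)
  ultimately show ?thesis by (simp only:)
qed

text \<open>The \<psi> of the overview with its argument rescaled by \<open>rho\<close>: the
  generating function of a probability distribution on the positive integers.\<close>

definition psi :: "complex \<Rightarrow> complex" where
  "psi z = (\<Sum>n. of_real (step_wt n) * z ^ Suc n)"

lemma summable_wt_moment: "summable (\<lambda>n. step_wt n * real (Suc n) ^ p)"
proof -
  obtain K where K: "0 < K" "\<And>n. real n ^ p * (10/11) ^ n \<le> K"
    using power_times_geometric_bounded[of "10/11" p] by auto
  have "summable (\<lambda>n. (K * 11/10) * (step_wt n * (11/10) ^ n))"
    by (intro summable_mult summable_wt)
  then show ?thesis
  proof (rule summable_comparison_test')
    fix n
    have "real (Suc n) ^ p = (real (Suc n) ^ p * (10/11) ^ Suc n) * (11/10) ^ Suc n"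
      by (simp only: mult.assoc power_mult_distrib[symmetric]) simp
    also have "\<dots> \<le> K * (11/10) ^ Suc n" by (intro mult_right_mono K) simp
    finally have "step_wt n * real (Suc n) ^ p \<le> step_wt n * (K * (11/10) ^ Suc n)"
      by (intro mult_left_mono step_wt_nonneg)
    then show "norm (step_wt n * real (Suc n) ^ p) \<le> (K * 11/10) * (step_wt n * (11/10) ^ n)"
      using step_wt_nonneg[of n] by (simp add: mult_ac)
  qed
qed

lemma summable_wt': "summable step_wt"
  using summable_wt_moment[of 0] by simp

lemma psi_eq:
  assumes "norm z \<le> 1"
  shows "psi z = of_real rho * z * exp (1 + qv (of_real rho * z))"
    and "summable (\<lambda>n. of_real (step_wt n) * z ^ Suc n)"
proof -
  have r: "norm (of_real rho * z) < 1/2"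
  proof -
    have "rho * norm z \<le> rho * 1" using assms rho_pos by (intro mult_left_mono) auto
    then have "rho * norm z < 1/2" using rho_le by linarith
    then show ?thesis using rho_pos by (simp add: norm_mult)
  qed
  then have "(\<lambda>n. fps_nth (cfps exp_twin_series) n * (of_real rho * z) ^ n) sums exp (qv (of_real rho * z))"
    unfolding eval_W[OF r, symmetric]
    by (intro sums_eval_fps) (simp only: fps_conv_radius_cfps less_conv_radius[OF r exp_twin_series_conv_radius])
  then have "(\<lambda>n. (exp 1 * of_real rho * z) * (fps_nth (cfps exp_twin_series) n * (of_real rho * z) ^ n)) sums ((exp 1 * of_real rho * z) * exp (qv (of_real rho * z)))"
    by (rule sums_mult)
  moreover have "(exp 1 * of_real rho * z) * (fps_nth (cfps exp_twin_series) n * (of_real rho * z) ^ n) = of_real (step_wt n) * z ^ Suc n" for n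
    by (simp add: step_wt_def power_mult_distrib mult_ac flip: exp_of_real)
  ultimately have "(\<lambda>n. of_real (step_wt n) * z ^ Suc n) sums ((exp 1 * of_real rho * z) * exp (qv (of_real rho * z)))"
    by (simp only:)
  then show "psi z = of_real rho * z * exp (1 + qv (of_real rho * z))" "summable (\<lambda>n. of_real (step_wt n) * z ^ Suc n)"
    unfolding psi_def by (auto simp: sums_iff exp_add mult_ac)
qed

lemma qv_of_real: "0 \<le> r \<Longrightarrow> r < 1/2 \<Longrightarrow> qv (of_real r) = of_real (eval_fps twin_series r)"
  unfolding eval_fps_def using suminf_of_real[OF summable_Q[of r], where ?'a = complex] by simp

lemma suminf_wt: "(\<Sum>n. step_wt n) = 1"
proof -
  have "psi 1 = of_real (rho * exp (1 + eval_fps twin_series rho))"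
  proof -
    have "qv (of_real rho) = of_real (eval_fps twin_series rho)" using rho_pos rho_le by (intro qv_of_real) auto
    then show ?thesis using psi_eq(1)[of 1] by (simp add: exp_add flip: exp_of_real)
  qed
  also have "\<dots> = 1" by (simp add: rho_eq)
  finally have "complex_of_real (\<Sum>n. step_wt n) = 1"
    using suminf_of_real[OF summable_wt', where ?'a = complex] by (simp add: psi_def)
  then show ?thesis using of_real_eq_1_iff by blast
qed

lemma norm_psi_le:
  assumes "norm z \<le> 1"
  shows "norm (psi z) \<le> 1"
proof -
  have le: "norm (of_real (step_wt n) * z ^ Suc n) \<le> step_wt n" for n
    using assms step_wt_nonneg[of n] mult_left_mono[of "norm z ^ Suc n" 1 "step_wt n"] power_le_one[of "norm z" "Suc n"]
    by (simp add: norm_mult norm_power del: power_Suc)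
  have sm: "summable (\<lambda>n. norm (of_real (step_wt n) * z ^ Suc n))"
    by (rule summable_comparison_test'[OF summable_wt']) (use le in simp)
  then have "norm (psi z) \<le> (\<Sum>n. norm (of_real (step_wt n) * z ^ Suc n))"
    unfolding psi_def by (rule summable_norm)
  also have "\<dots> \<le> 1" unfolding suminf_wt[symmetric] by (intro suminf_le le sm summable_wt')
  finally show ?thesis .
qed

lemma norm_one_minus_power_le:
  fixes z :: complex
  assumes "norm z \<le> 1"
  shows "norm (1 - z ^ n) \<le> real n * norm (1 - z)"
  using norm_power_diff[of 1 z n] assms by simp

lemma norm_one_minus_power_linear_le:
  fixes z :: complex
  assumes "norm z \<le> 1"
  shows "norm (1 - z ^ n - of_nat n * (1 - z)) \<le> real n ^ 2 * norm (1 - z) ^ 2"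
proof -
  have "1 - z ^ n - of_nat n * (1 - z) = (1 - z) * (\<Sum>i<n. z ^ i - 1)"
    by (simp add: one_diff_power_eq algebra_simps sum_subtractf)
  also have "norm \<dots> \<le> norm (1 - z) * (\<Sum>i<n. real n * norm (1 - z))"
    unfolding norm_mult
  proof (intro mult_left_mono sum_norm_le)
    fix i assume "i \<in> {..<n}"
    have "norm (z ^ i - 1) \<le> real i * norm (1 - z)"
      using norm_one_minus_power_le[OF assms, of i] by (simp add: norm_minus_commute)
    also have "\<dots> \<le> real n * norm (1 - z)" using \<open>i \<in> {..<n}\<close> by (intro mult_right_mono) auto
    finally show "norm (z ^ i - 1) \<le> real n * norm (1 - z)" .
  qed simp
  finally show ?thesis by (simp add: power2_eq_square mult_ac)
qed

lemma norm_sq_le_Re: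
  fixes z :: complex
  assumes "norm z \<le> 1"
  shows "norm (1 - z) ^ 2 \<le> 2 * Re (1 - z)"
proof -
  have "norm z ^ 2 \<le> 1" using assms by (simp add: power_le_one)
  then show ?thesis by (simp add: cmod_power2) (simp add: power2_eq_square algebra_simps)
qed

text \<open>Near 1 the linear term dominates, its slope being the mean, which is at least 1. Away
  from 1 the positive weight of the exponent 1 rules out periodicity and keeps the real part of 1 -
  \<psi> away from 0.\<close>

lemma one_minus_psi_ge: "\<exists>c>0. \<forall>z. norm z \<le> 1 \<longrightarrow> c * norm (1 - z) \<le> norm (1 - psi z)"
proof -
  define \<mu> where "\<mu> = (\<Sum>n. step_wt n * real (Suc n))"
  define K where "K = (\<Sum>n. step_wt n * real (Suc n) ^ 2)"
  have sm1: "summable (\<lambda>n. step_wt n * real (Suc n))" using summable_wt_moment[of 1] by simp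
  have sm2: "summable (\<lambda>n. step_wt n * real (Suc n) ^ 2)" by (rule summable_wt_moment)
  have \<mu>1: "1 \<le> \<mu>"
    unfolding \<mu>_def suminf_wt[symmetric]
    by (intro suminf_le sm1 summable_wt') (use step_wt_nonneg mult_left_mono[of 1 "real (Suc n)" "step_wt n" for n] in auto)
  have K1: "1 \<le> K"
  proof -
    have "step_wt n \<le> step_wt n * real (Suc n) ^ 2" for n
      using step_wt_nonneg[of n] mult_left_mono[of 1 "real (Suc n) ^ 2" "step_wt n"] one_le_power[of "real (Suc n)" 2] by simp
    then show ?thesis unfolding K_def suminf_wt[symmetric]
      by (intro suminf_le sm2 summable_wt')
  qed
  have one: "1 - psi z = (\<Sum>n. of_real (step_wt n) * (1 - z ^ Suc n))" if "norm z \<le> 1" for z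
  proof -
    have "(\<lambda>n. of_real (step_wt n) - of_real (step_wt n) * z ^ Suc n) sums (of_real (\<Sum>n. step_wt n) - psi z)"
      unfolding psi_def by (intro sums_diff sums_of_real summable_sums summable_wt' psi_eq(2) that)
    then show ?thesis by (simp add: suminf_wt sums_iff algebra_simps)
  qed
  have smz: "summable (\<lambda>n. of_real (step_wt n) * (1 - z ^ Suc n))" if "norm z \<le> 1" for z :: complex
  proof -
    have "summable (\<lambda>n. complex_of_real (step_wt n) - of_real (step_wt n) * z ^ Suc n)"
      by (intro summable_diff summable_of_real summable_wt' psi_eq(2) that)
    then show ?thesis by (simp add: algebra_simps)
  qed
  \<comment> \<open>For |1 - z| \<le> \<eta> the quadratic remainder K |1 - z|^2 is at most half of
    |1 - z|.\<close>
  define \<eta> where "\<eta> = 1 / (2 * K)"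
  have \<eta>: "0 < \<eta>" using K1 by (simp add: \<eta>_def)
  \<comment> \<open>1/2 serves the disc around 1. Outside it, Re (1 - z) \<ge> \<eta>^2/2 while |1 -
    z| \<le> 2, which gives the second entry.\<close>
  define c where "c = min (1/2) (step_wt 0 * \<eta> ^ 2 / 4)"
  have "0 < c" using \<eta> step_wt_0_pos by (simp add: c_def)
  moreover have "c * norm (1 - z) \<le> norm (1 - psi z)" if z: "norm z \<le> 1" for z
  proof (cases "norm (1 - z) \<le> \<eta>")
    case True
    have eq: "1 - psi z - of_real \<mu> * (1 - z) = (\<Sum>n. of_real (step_wt n) * (1 - z ^ Suc n - of_nat (Suc n) * (1 - z)))"
    proof -
      have "(\<lambda>n. of_real (step_wt n) * (1 - z ^ Suc n) - of_real (step_wt n * real (Suc n)) * (1 - z)) sums (1 - psi z - of_real \<mu> * (1 - z))"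
        unfolding one[OF z] \<mu>_def
        by (intro sums_diff sums_mult2 sums_of_real summable_sums smz z sm1)
      then show ?thesis by (simp add: sums_iff algebra_simps)
    qed
    have le: "norm (of_real (step_wt n) * (1 - z ^ Suc n - of_nat (Suc n) * (1 - z))) \<le> (step_wt n * real (Suc n) ^ 2) * norm (1 - z) ^ 2" for n
      using mult_left_mono[OF norm_one_minus_power_linear_le[OF z, of "Suc n"], of "step_wt n"] step_wt_nonneg[of n]
      by (simp add: norm_mult mult_ac del: power_Suc of_nat_Suc)
    have sm: "summable (\<lambda>n. (step_wt n * real (Suc n) ^ 2) * norm (1 - z) ^ 2)" by (intro summable_mult2 sm2)
    have sn: "summable (\<lambda>n. norm (of_real (step_wt n) * (1 - z ^ Suc n - of_nat (Suc n) * (1 - z))))"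
      by (rule summable_comparison_test'[OF sm]) (use le in simp)
    have "norm (1 - psi z - of_real \<mu> * (1 - z)) \<le> (\<Sum>n. norm (of_real (step_wt n) * (1 - z ^ Suc n - of_nat (Suc n) * (1 - z))))"
      unfolding eq by (rule summable_norm[OF sn])
    also have "\<dots> \<le> (\<Sum>n. (step_wt n * real (Suc n) ^ 2) * norm (1 - z) ^ 2)"
      by (intro suminf_le le sn sm)
    also have "\<dots> = K * norm (1 - z) ^ 2" unfolding K_def by (rule suminf_mult2[symmetric, OF sm2])
    also have "\<dots> \<le> K * (\<eta> * norm (1 - z))"
      using True K1 by (auto simp: power2_eq_square intro!: mult_left_mono mult_right_mono)
    also have "\<dots> = norm (1 - z) / 2" using K1 by (simp add: \<eta>_def)
    finally have a: "norm (1 - psi z - of_real \<mu> * (1 - z)) \<le> norm (1 - z) / 2" .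
    have "norm (1 - z) \<le> \<mu> * norm (1 - z)" using \<mu>1 mult_right_mono[of 1 \<mu> "norm (1 - z)"] by simp
    also have "\<dots> = norm (of_real \<mu> * (1 - z))" using \<mu>1 by (simp add: norm_mult)
    also have "\<dots> \<le> norm (1 - psi z) + norm (1 - psi z - of_real \<mu> * (1 - z))"
      using norm_triangle_ineq4[of "1 - psi z" "1 - psi z - of_real \<mu> * (1 - z)"] by simp
    finally have "norm (1 - z) / 2 \<le> norm (1 - psi z)" using a by simp
    moreover have "c * norm (1 - z) \<le> 1/2 * norm (1 - z)" by (intro mult_right_mono) (auto simp: c_def)
    ultimately show ?thesis by simp
  next
    case False
    have "\<eta> ^ 2 \<le> norm (1 - z) ^ 2" using False \<eta> by (intro power_mono) auto
    then have re: "\<eta> ^ 2 / 2 \<le> Re (1 - z)" using norm_sq_le_Re[OF z] by simp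
    have "step_wt 0 * Re (1 - z ^ Suc 0) \<le> (\<Sum>n. step_wt n * Re (1 - z ^ Suc n))"
    proof -
      have nn: "0 \<le> step_wt n * Re (1 - z ^ Suc n)" for n
      proof -
        have "norm (z ^ Suc n) \<le> 1" using z by (simp add: norm_power power_le_one del: power_Suc)
        then have "Re (z ^ Suc n) \<le> 1" using complex_Re_le_cmod order.trans by blast
        then show ?thesis using step_wt_nonneg[of n] by (simp del: power_Suc)
      qed
      have "summable (\<lambda>n. step_wt n * Re (1 - z ^ Suc n))"
        using summable_Re[OF smz[OF z]] by (simp del: power_Suc)
      from sum_le_suminf[OF this, of "{0}"] nn show ?thesis by simp
    qed
    also have "\<dots> = Re (1 - psi z)"
      unfolding one[OF z] using Re_suminf[OF smz[OF z]] by (simp del: power_Suc)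
    also have "\<dots> \<le> norm (1 - psi z)" by (rule complex_Re_le_cmod)
    finally have "step_wt 0 * Re (1 - z) \<le> norm (1 - psi z)" by simp
    moreover have "step_wt 0 * (\<eta> ^ 2 / 2) \<le> step_wt 0 * Re (1 - z)" using re step_wt_0_pos by (intro mult_left_mono) auto
    moreover have "c * norm (1 - z) \<le> (step_wt 0 * \<eta> ^ 2 / 4) * 2"
    proof (rule mult_mono)
      show "norm (1 - z) \<le> 2" using norm_triangle_ineq4[of 1 z] z by simp
    qed (use \<eta> step_wt_0_pos in \<open>auto simp: c_def\<close>)
    ultimately show ?thesis by simp
  qed
  ultimately show ?thesis by blast
qed

text \<open>Follows from the lower bound 1 + t + t^2/2 for exp t, because (1 - t + t^2/2)(1 + t +
  t^2/2) = 1 + t^4/4.\<close>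

lemma exp_minus_le_quadratic:
  fixes t :: real
  assumes "0 \<le> t"
  shows "exp (- t) \<le> 1 - t + t ^ 2 / 2"
proof -
  have e: "1 + t + t ^ 2 / 2 \<le> exp t" using assms exp_lower_Taylor_quadratic by blast
  have p: "0 \<le> 1 - t + t ^ 2 / 2" using zero_le_power2[of "1 - t"] by (simp add: power2_diff)
  have "1 \<le> (1 - t + t ^ 2 / 2) * (1 + t + t ^ 2 / 2)"
    using zero_le_power[of "t^2" 2] by (simp add: algebra_simps power2_eq_square)
  also have "\<dots> \<le> (1 - t + t ^ 2 / 2) * exp t" by (intro mult_left_mono e p)
  finally show ?thesis by (simp add: exp_minus field_simps)
qed

section \<open>The distance of y from 1\<close>

definition gap :: "complex \<Rightarrow> real" where "gap x = norm (1 - yv x)"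

lemma yv_psi:
  assumes "norm x < rho"
  shows "yv x * exp (1 - yv x) = psi (x / of_real rho)"
proof -
  have "norm (x / of_real rho) \<le> 1" using assms rho_pos by (simp add: norm_divide)
  then have "psi (x / of_real rho) = x * exp (1 + qv x)"
    using rho_pos by (simp add: psi_eq)
  also have "\<dots> = x * exp (yv x + qv x) * exp (1 - yv x)"
    by (simp add: mult.assoc add.commute flip: exp_add)
  also have "\<dots> = yv x * exp (1 - yv x)" using yv_eq[OF assms] by simp
  finally show ?thesis by simp
qed

text \<open>Since \<open>\<bar>y\<bar> exp (1 - Re y) = \<bar>\<psi>\<bar> \<le> 1\<close>, the point \<open>y\<close> lies in the Stolz angle
  \<open>\<bar>Im y\<bar> \<le> 1 - Re y\<close> of the unit disc.\<close>
lemma yv_stolz: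
  assumes "norm x < rho"
  shows "norm (yv x) \<le> exp (- Re (1 - yv x))" "gap x \<le> 2 * Re (1 - yv x)"
proof -
  define a where "a = Re (1 - yv x)"
  define b where "b = Im (1 - yv x)"
  have "norm (x / of_real rho) \<le> 1" using assms rho_pos by (simp add: norm_divide)
  then have "norm (yv x * exp (1 - yv x)) \<le> 1"
    unfolding yv_psi[OF assms] by (rule norm_psi_le)
  then have "norm (yv x) * exp a \<le> 1" by (simp add: norm_mult a_def)
  then show *: "norm (yv x) \<le> exp (- Re (1 - yv x))"
    by (simp add: a_def exp_diff exp_minus field_simps)
  have a0: "0 \<le> a"
    using norm_yv_le[of x] assms complex_Re_le_cmod[of "yv x"] by (simp add: a_def)
  have "(1 - a) ^ 2 + b ^ 2 = norm (yv x) ^ 2" by (simp add: a_def b_def cmod_power2)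
  also have "\<dots> \<le> exp (- a) ^ 2" using * by (intro power_mono) (auto simp: a_def)
  also have "\<dots> = exp (- (2 * a))" by (simp flip: exp_of_nat_mult)
  also have "\<dots> \<le> 1 - 2 * a + (2 * a) ^ 2 / 2" using a0 by (intro exp_minus_le_quadratic) auto
  finally have "b ^ 2 \<le> a ^ 2" by (simp add: power2_eq_square algebra_simps)
  moreover have "gap x ^ 2 = a ^ 2 + b ^ 2" by (simp add: gap_def cmod_power2 a_def b_def)
  ultimately have "gap x ^ 2 \<le> (2 * a) ^ 2"
    by (simp add: power_mult_distrib) (use zero_le_power2[of a] in linarith)
  then show "gap x \<le> 2 * Re (1 - yv x)"
    using a0 unfolding a_def by (intro power2_le_imp_le[OF \<open>gap x ^ 2 \<le> (2 * a) ^ 2\<close>[unfolded a_def]]) auto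
qed

lemma gap_nonneg: "0 \<le> gap x"
  by (simp add: gap_def)

lemma gap_le_2:
  assumes "norm x < rho"
  shows "gap x \<le> 2"
  unfolding gap_def using norm_triangle_ineq4[of 1 "yv x"] norm_yv_le[of x] assms by simp

lemma norm_yv_le_exp:
  assumes "norm x < rho"
  shows "norm (yv x) \<le> exp (- gap x / 2)"
proof -
  have "exp (- Re (1 - yv x)) \<le> exp (- gap x / 2)" using yv_stolz(2)[OF assms] by simp
  with yv_stolz(1)[OF assms] show ?thesis by (rule order.trans)
qed

text \<open>The terms linear in u cancel. With u = 1 - y this is the vanishing derivative of y exp
  (1 - y) at y = 1, the source of the square-root singularity.\<close>

lemma one_minus_exp_quadratic:
  fixes u :: complex
  assumes "norm u \<le> 2"
  shows "norm (1 - (1 - u) * exp u) \<le> 2 * exp 2 * norm u ^ 2"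
proof -
  have 1: "norm (exp u - 1) \<le> exp \<bar>Re u\<bar> * norm u"
    using Taylor_exp[of u 0] by simp
  have 2: "norm (exp u - (1 + u)) \<le> exp \<bar>Re u\<bar> * norm u ^ 2"
    using Taylor_exp[of u 1] by (simp add: numeral_2_eq_2)
  have e: "exp \<bar>Re u\<bar> \<le> exp 2" using abs_Re_le_cmod[of u] assms by simp
  have "1 - (1 - u) * exp u = u * (exp u - 1) - (exp u - (1 + u))" by (simp add: algebra_simps)
  also have "norm \<dots> \<le> norm (u * (exp u - 1)) + norm (exp u - (1 + u))" by (rule norm_triangle_ineq4)
  also have "\<dots> \<le> norm u * (exp \<bar>Re u\<bar> * norm u) + exp \<bar>Re u\<bar> * norm u ^ 2"
    unfolding norm_mult by (intro add_mono mult_left_mono 1 2) simp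
  also have "\<dots> = 2 * exp \<bar>Re u\<bar> * norm u ^ 2" by (simp add: power2_eq_square)
  also have "\<dots> \<le> 2 * exp 2 * norm u ^ 2" by (intro mult_right_mono) (use e in auto)
  finally show ?thesis .
qed

text \<open>1 - \<psi> is at most of order (1 - y)^2 and at least of order 1 - x/\<open>rho\<close>.
  Together these give one side of the square-root law for 1 - y, uniformly in the disc.\<close>

lemma gap_sq_ge: "\<exists>c>0. \<forall>x. norm x < rho \<longrightarrow> c * norm (1 - x / of_real rho) \<le> gap x ^ 2"
proof -
  obtain c where c: "0 < c" "\<And>z. norm z \<le> 1 \<Longrightarrow> c * norm (1 - z) \<le> norm (1 - psi z)"
    using one_minus_psi_ge by blast
  have "c / (2 * exp 2) * norm (1 - x / of_real rho) \<le> gap x ^ 2" if x: "norm x < rho" for x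
  proof -
    have "c * norm (1 - x / of_real rho) \<le> norm (1 - psi (x / of_real rho))"
      using x rho_pos by (intro c) (simp add: norm_divide)
    also have "\<dots> = norm (1 - (1 - (1 - yv x)) * exp (1 - yv x))"
      by (simp add: yv_psi[OF x, symmetric])
    also have "\<dots> \<le> 2 * exp 2 * norm (1 - yv x) ^ 2"
      using gap_le_2[OF x] by (intro one_minus_exp_quadratic) (simp add: gap_def)
    finally show ?thesis by (simp add: gap_def field_simps)
  qed
  then show ?thesis using c(1) by (intro exI[of _ "c / (2 * exp 2)"]) auto
qed

lemma gap_pos:
  assumes "norm x < rho"
  shows "0 < gap x"
proof -
  obtain c where c: "0 < c" "c * norm (1 - x / of_real rho) \<le> gap x ^ 2"
    using gap_sq_ge assms by blast
  have "x / of_real rho \<noteq> 1" using assms rho_pos by auto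
  then have "0 < c * norm (1 - x / of_real rho)" using c(1) by simp
  then have "gap x \<noteq> 0" using c(2) by auto
  then show ?thesis using gap_nonneg[of x] by simp
qed

definition dyv :: "complex \<Rightarrow> complex" where "dyv x = eval_fps (fps_deriv (cfps tree_series)) x"

text \<open>Differentiating y = x exp (y + q) gives (1 - y) y' = y/x + y q', and the right-hand side
  is bounded on the disc.\<close>

lemma dyv_bound: "\<exists>C>0. \<forall>x. norm x < rho \<longrightarrow> norm (dyv x) * gap x \<le> C"
proof -
  let ?q' = "fps_deriv (cfps twin_series)"
  have rq: "ereal (1/2) \<le> fps_conv_radius ?q'"
    using order.trans[OF twin_series_conv_radius, of "fps_conv_radius ?q'"] fps_conv_radius_deriv[of "cfps twin_series"]
    by (simp add: fps_conv_radius_cfps)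
  have sq: "summable (\<lambda>n. norm (fps_nth ?q' n) * rho ^ n)"
  proof -
    have "summable (\<lambda>n. norm (fps_nth ?q' n * of_real rho ^ n))"
      using rho_pos rho_le by (intro norm_summable_fps less_conv_radius[OF _ rq]) auto
    then show ?thesis using rho_pos by (simp add: norm_mult norm_power)
  qed
  define C where "C = 1 + exp (1 + (\<Sum>n. norm (fps_nth (cfps twin_series) n) * rho ^ n)) + (\<Sum>n. norm (fps_nth ?q' n) * rho ^ n)"
  have sQ: "summable (\<lambda>n. norm (fps_nth (cfps twin_series) n) * rho ^ n)"
    using summable_Q[of rho] rho_pos rho_le by (simp add: twin_series_nth_nonneg)
  have C0: "0 < C" unfolding C_def
    using suminf_nonneg[OF sq] rho_pos by (intro add_pos_nonneg) (auto simp: add_pos_pos)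
  have "norm (dyv x) * gap x \<le> C" if x: "norm x < rho" for x
  proof -
    have r: "ereal (norm x) < fps_conv_radius (cfps tree_series)" "ereal (norm x) < fps_conv_radius (cfps twin_series)"
     "ereal (norm x) < fps_conv_radius (cfps forest_series)"
      using x conv_radius_lt_rho cY_radius cQ_radius cZ_radius by auto
    have r': "ereal (norm x) < fps_conv_radius (fps_deriv (cfps tree_series))" "ereal (norm x) < fps_conv_radius ?q'"
      by (rule less_le_trans[OF _ fps_conv_radius_deriv], rule r)+
    have "fps_deriv tree_series = forest_series + tree_series * (fps_deriv tree_series + fps_deriv twin_series)"
    proof -
      have "fps_deriv tree_series = forest_series + fps_X * fps_deriv forest_series" by (subst tree_series_eq_X_Z) simp
      also have "fps_X * fps_deriv forest_series = (fps_X * forest_series) * (fps_deriv tree_series + fps_deriv twin_series)"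
        by (simp add: forest_series_deriv mult.assoc)
      finally show ?thesis by (simp only: tree_series_eq_X_Z[symmetric])
    qed
    then have "fps_deriv (cfps tree_series) = cfps forest_series + cfps tree_series * (fps_deriv (cfps tree_series) + ?q')"
      by (metis cfps_add cfps_deriv cfps_mult)
    then have "dyv x = eval_fps (cfps forest_series + cfps tree_series * (fps_deriv (cfps tree_series) + ?q')) x"
      unfolding dyv_def by (rule arg_cong[where f = "\<lambda>f. eval_fps f x"])
    also have "\<dots> = eval_fps (cfps forest_series) x + yv x * (dyv x + eval_fps ?q' x)"
    proof -
      have r3: "ereal (norm x) < fps_conv_radius (fps_deriv (cfps tree_series) + ?q')"
        by (rule less_le_trans[OF _ fps_conv_radius_add]) (use r' in simp)
      have r4: "ereal (norm x) < fps_conv_radius (cfps tree_series * (fps_deriv (cfps tree_series) + ?q'))"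
        by (rule less_le_trans[OF _ fps_conv_radius_mult]) (use r r3 in simp)
      show ?thesis using r r' r3 r4 by (simp add: eval_fps_add eval_fps_mult dyv_def)
    qed
    finally have "dyv x * (1 - yv x) = eval_fps (cfps forest_series) x + yv x * eval_fps ?q' x"
      by (simp add: algebra_simps)
    then have "norm (dyv x) * gap x = norm (eval_fps (cfps forest_series) x + yv x * eval_fps ?q' x)"
      by (metis gap_def norm_mult)
    also have "\<dots> \<le> norm (eval_fps (cfps forest_series) x) + norm (yv x) * norm (eval_fps ?q' x)"
      using norm_triangle_ineq[of "eval_fps (cfps forest_series) x" "yv x * eval_fps ?q' x"] by (simp add: norm_mult)
    also have "\<dots> \<le> exp (1 + (\<Sum>n. norm (fps_nth (cfps twin_series) n) * rho ^ n)) + 1 * (\<Sum>n. norm (fps_nth ?q' n) * rho ^ n)"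
    proof (intro add_mono mult_mono)
      have "Re (yv x) \<le> 1" using norm_yv_le[of x] x complex_Re_le_cmod[of "yv x"] by simp
      moreover have "Re (qv x) \<le> (\<Sum>n. norm (fps_nth (cfps twin_series) n) * rho ^ n)"
        using norm_eval_fps_le[OF sQ, of x] x complex_Re_le_cmod[of "qv x"] by simp
      ultimately show "norm (eval_fps (cfps forest_series) x) \<le> exp (1 + (\<Sum>n. norm (fps_nth (cfps twin_series) n) * rho ^ n))"
        unfolding eval_Z[OF x] by simp
      show "norm (yv x) \<le> 1" using norm_yv_le[of x] x by simp
      show "norm (eval_fps ?q' x) \<le> (\<Sum>n. norm (fps_nth ?q' n) * rho ^ n)"
        using x by (intro norm_eval_fps_le sq) simp
    qed auto
    also have "\<dots> \<le> C" by (simp add: C_def)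
    finally show ?thesis .
  qed
  then show ?thesis using C0 by blast
qed

section \<open>Moment recursions in a normed ring\<close>

text \<open>\<open>K1\<close> to \<open>K4\<close> belong to the moments of one level,
  \<open>M1\<close> to \<open>M4\<close> to those of a level difference. Each is the constant that
  its recursion step produces; what matters is that they depend on \<open>C\<close> alone, not on
  the point x, on r or on h.\<close>

definition K1 :: "real \<Rightarrow> real" where "K1 C = C * (C + 12 * C ^ 2)"
definition K2 :: "real \<Rightarrow> real" where "K2 C = C * (C + 2 * (K1 C * (K1 C + C)) + 12 * C ^ 2)"
definition K3 :: "real \<Rightarrow> real" where
  "K3 C = C * (C + 2 * (2 * (K1 C * (K2 C + C)) + K2 C * (K1 C + C)) + 12 * C ^ 2)"
definition K4 :: "real \<Rightarrow> real" where
  "K4 C = C * (C + 2 * (3 * (K1 C * (K3 C + C)) + 3 * (K2 C * (K2 C + C)) + K3 C * (K1 C + C)) + 12 * C ^ 2)"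

definition M1 :: "real \<Rightarrow> real" where "M1 C = 12 * C ^ 2"
definition M2 :: "real \<Rightarrow> real" where
  "M2 C = C * (C + 2 * K1 C + 2 * K2 C + 80 * M1 C ^ 2 + 12 * (C ^ 2 + 2 * M1 C ^ 2))"
definition M3 :: "real \<Rightarrow> real" where
  "M3 C = C * (C + 3 * K1 C + 6 * K2 C + 4 * K3 C + 120 * (M1 C * (M2 C + C)) + 12 * (C ^ 2 + 3 * (M1 C * (M2 C + C))))"
definition M4 :: "real \<Rightarrow> real" where
  "M4 C = C * (2 * C + 8 * K1 C + 24 * K2 C + 32 * K3 C + 88 * K4 C
     + 40 * (6 * (M1 C * (M3 C + C)) + 3 * (M2 C * (M2 C + C)) + 2 * (M3 C * M1 C)) + 24 * C ^ 2)"

lemma constants_nonneg: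
  assumes "1 \<le> C"
  shows "0 \<le> K1 C" "0 \<le> K2 C" "0 \<le> K3 C" "0 \<le> K4 C" "0 \<le> M1 C" "0 \<le> M2 C" "0 \<le> M3 C" "0 \<le> M4 C"
proof -
  show k1: "0 \<le> K1 C" using assms by (simp add: K1_def)
  then show k2: "0 \<le> K2 C" using assms by (simp add: K2_def)
  then show k3: "0 \<le> K3 C" using assms k1 by (simp add: K3_def)
  then show k4: "0 \<le> K4 C" using assms k1 k2 by (simp add: K4_def)
  show m1: "0 \<le> M1 C" using assms by (simp add: M1_def)
  then show m2: "0 \<le> M2 C" using assms k1 k2 by (simp add: M2_def)
  then show m3: "0 \<le> M3 C" using assms k1 k2 k3 m1 by (simp add: M3_def)
  then show m4: "0 \<le> M4 C" using assms k1 k2 k3 k4 m1 m2 by (simp add: M4_def)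
qed

text \<open>The recursions are solved from a submultiplicative norm and two bounds on powers of y.
  In the intended instance, dual numbers, the norm of y need not be at most 1, so decay is assumed
  for all powers and not derived from the first.\<close>

locale gap_norm =
  fixes N :: "'a::comm_ring_1 \<Rightarrow> real" and y :: 'a and \<delta> C :: real
  assumes N_nonneg: "0 \<le> N a" and N_0 [simp]: "N 0 = 0"
    and N_add: "N (a + b) \<le> N a + N b" and N_minus [simp]: "N (- a) = N a"
    and N_mult: "N (a * b) \<le> N a * N b"
    and \<delta>: "0 < \<delta>" "\<delta> \<le> 2" and C: "1 \<le> C"
    and N_y_power: "N (y ^ k) \<le> C * (1 - \<delta> / 20) ^ k"
    and N_y_power_diff: "N (y ^ k - y ^ (k + h)) \<le> C * (1 - \<delta> / 20) ^ k * min 1 (real h * \<delta>)"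
begin

definition \<theta> :: real where "\<theta> = 1 - \<delta> / 20"
text \<open>The decay rate of the twin terms. It is (9/10)^2, and \<theta> \<ge> 9/10, so q/\<theta>
  \<le> 9/10 uniformly in \<delta>.\<close>

definition q :: real where "q = 81 / 100"

lemma theta: "9/10 \<le> \<theta>" "\<theta> < 1" "0 < \<theta>" "1 / \<theta> \<le> 2" "q \<le> \<theta>"
  using \<delta> by (auto simp: \<theta>_def q_def field_simps)

lemma q_ge0: "0 \<le> q" "q \<le> 1" by (simp_all add: q_def)

lemma N_sum: "N (\<Sum>i\<in>I. f i) \<le> (\<Sum>i\<in>I. N (f i))"
proof (induction I rule: infinite_finite_induct)
  case (insert x F)
  then show ?case using N_add[of "f x" "sum f F"] by simp
qed auto

lemma N_diff: "N (a - b) \<le> N a + N b"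
  using N_add[of a "- b"] by simp

lemma N_of_nat_mult: "N (of_nat n * a) \<le> real n * N a"
proof (induction n)
  case (Suc n)
  have "N (of_nat (Suc n) * a) \<le> N a + N (of_nat n * a)"
    using N_add[of a "of_nat n * a"] by (simp add: algebra_simps)
  then show ?case using Suc by (simp add: algebra_simps)
qed simp

lemma N_numeral_mult: "N (numeral n * a) \<le> numeral n * N a"
  using N_of_nat_mult[of "numeral n" a] by simp

lemma Ny: "N (y ^ k) \<le> C * \<theta> ^ k"
  using N_y_power by (simp add: \<theta>_def)

lemma Ny1: "N y \<le> C"
proof -
  have "C * \<theta> \<le> C * 1" using C theta by (intro mult_left_mono) auto
  then show ?thesis using Ny[of 1] by simp
qed

lemma sum_theta_le: "(\<Sum>j<r. \<theta> ^ j) \<le> real r" "(\<Sum>j<r. \<theta> ^ j) \<le> 20 / \<delta>" "0 \<le> (\<Sum>j<r. \<theta> ^ j)"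
proof -
  have "(\<Sum>j<r. \<theta> ^ j) \<le> (\<Sum>j<r. 1)" using theta by (intro sum_mono power_le_one) auto
  then show "(\<Sum>j<r. \<theta> ^ j) \<le> real r" by simp
  have "\<theta> \<noteq> 1" using theta by auto
  then have "(\<Sum>j<r. \<theta> ^ j) = (1 - \<theta> ^ r) / (1 - \<theta>)" by (simp add: sum_gp_strict)
  also have "\<dots> \<le> 1 / (1 - \<theta>)" using theta by (intro divide_right_mono) auto
  also have "\<dots> = 20 / \<delta>" by (simp add: \<theta>_def)
  finally show "(\<Sum>j<r. \<theta> ^ j) \<le> 20 / \<delta>" .
  show "0 \<le> (\<Sum>j<r. \<theta> ^ j)" using theta by (intro sum_nonneg) auto
qed

text \<open>After factoring out \<theta>^r a geometric series of ratio at most 9/10 remains, of sum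
  at most 10.\<close>

lemma sum_q_le: "(\<Sum>j<r. \<theta> ^ (r - j) * q ^ j) \<le> 10 * \<theta> ^ r"
proof -
  have "(\<Sum>j<r. \<theta> ^ (r - j) * q ^ j) \<le> (\<Sum>j<r. \<theta> ^ r * (9/10) ^ j)"
  proof (rule sum_mono)
    fix j assume j: "j \<in> {..<r}"
    have "q ^ j \<le> (\<theta> * (9/10)) ^ j" using theta q_ge0 by (intro power_mono) (auto simp: q_def)
    then have "\<theta> ^ (r - j) * q ^ j \<le> \<theta> ^ (r - j) * (\<theta> * (9/10)) ^ j"
      using theta by (intro mult_left_mono) auto
    also have "\<dots> = \<theta> ^ r * (9/10) ^ j"
      using j by (simp only: power_mult_distrib mult.assoc[symmetric] power_add[symmetric]) simp
    finally show "\<theta> ^ (r - j) * q ^ j \<le> \<theta> ^ r * (9/10) ^ j" .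
  qed
  also have "\<dots> = \<theta> ^ r * (\<Sum>j<r. (9/10) ^ j)" by (simp add: sum_distrib_left)
  also have "\<dots> \<le> \<theta> ^ r * 10"
  proof (rule mult_left_mono)
    have "(\<Sum>j<r. (9/10::real) ^ j) = (1 - (9/10) ^ r) / (1 - 9/10)" by (subst sum_gp_strict) simp
    also have "\<dots> \<le> 10" by simp
    finally show "(\<Sum>j<r. (9/10::real) ^ j) \<le> 10" .
  qed (use theta in simp)
  finally show ?thesis by simp
qed

lemma duhamel:
  assumes "\<And>r. G (Suc r) = y * G r + F r"
  shows "G r = y ^ r * G 0 + (\<Sum>j<r. y ^ (r - Suc j) * F j)"
proof (induction r)
  case (Suc r)
  have "y * (\<Sum>j<r. y ^ (r - Suc j) * F j) = (\<Sum>j<r. y ^ (Suc r - Suc j) * F j)"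
    unfolding sum_distrib_left
    by (intro sum.cong refl) (simp add: Suc_diff_Suc mult.assoc[symmetric] power_Suc[symmetric] del: power_Suc)
  then show ?case by (simp add: assms Suc algebra_simps)
qed simp

text \<open>A source of size \<theta>^(2j) contributes \<theta>^r times the sum of the \<theta>^j,
  so it costs a factor r or 1/\<delta>; a source of size q^j costs only a constant. The exponent r -
  Suc j loses 1/\<theta> \<le> 10/9, and 2 and 12 round up 10/9 and 100/9.\<close>

lemma duhamel_bound:
  assumes rec: "\<And>r. G (Suc r) = y * G r + F r" and G0: "N (G 0) \<le> I"
    and F: "\<And>j. j < r \<Longrightarrow> N (F j) \<le> f * (\<theta> ^ j * \<theta> ^ j) + g * q ^ j" and f: "0 \<le> f" "0 \<le> g"
  shows "N (G r) \<le> C * \<theta> ^ r * (I + 2 * f * (\<Sum>j<r. \<theta> ^ j) + 12 * g)"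
proof -
  have "N (G r) \<le> N (y ^ r * G 0) + (\<Sum>j<r. N (y ^ (r - Suc j) * F j))"
    by (subst duhamel[where G = G and F = F, OF rec, of r]) (rule order.trans[OF N_add], rule add_left_mono, rule N_sum)
  also have "\<dots> \<le> C * \<theta> ^ r * I + (\<Sum>j<r. C * (10/9 * \<theta> ^ (r - j)) * (f * (\<theta> ^ j * \<theta> ^ j) + g * q ^ j))"
  proof (intro add_mono sum_mono)
    show "N (y ^ r * G 0) \<le> C * \<theta> ^ r * I"
      using C theta by (intro order.trans[OF N_mult] mult_mono Ny G0 N_nonneg) auto
    fix j assume j: "j \<in> {..<r}"
    have "\<theta> ^ (r - j) = \<theta> * \<theta> ^ (r - Suc j)" using j by (simp add: Suc_diff_Suc power_Suc[symmetric] del: power_Suc)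
    then have "\<theta> ^ (r - Suc j) = 1 / \<theta> * \<theta> ^ (r - j)" using theta by simp
    also have "\<dots> \<le> 10/9 * \<theta> ^ (r - j)"
      using theta(1,3) by (intro mult_right_mono) (auto simp: field_simps)
    finally have "N (y ^ (r - Suc j)) \<le> C * (10/9 * \<theta> ^ (r - j))"
      using C by (intro order.trans[OF Ny] mult_left_mono) auto
    then show "N (y ^ (r - Suc j) * F j) \<le> C * (10/9 * \<theta> ^ (r - j)) * (f * (\<theta> ^ j * \<theta> ^ j) + g * q ^ j)"
      using j C theta by (intro order.trans[OF N_mult] mult_mono F N_nonneg) auto
  qed
  also have "(\<Sum>j<r. C * (10/9 * \<theta> ^ (r - j)) * (f * (\<theta> ^ j * \<theta> ^ j) + g * q ^ j)) =
    C * (10/9) * f * (\<Sum>j<r. \<theta> ^ (r - j) * (\<theta> ^ j * \<theta> ^ j)) + C * (10/9) * g * (\<Sum>j<r. \<theta> ^ (r - j) * q ^ j)"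
    unfolding sum_distrib_left sum.distrib[symmetric]
    by (intro sum.cong refl) (simp only: ring_distribs mult_ac)
  also have "(\<Sum>j<r. \<theta> ^ (r - j) * (\<theta> ^ j * \<theta> ^ j)) = \<theta> ^ r * (\<Sum>j<r. \<theta> ^ j)"
    unfolding sum_distrib_left
    by (intro sum.cong refl) (simp add: mult.assoc[symmetric] power_add[symmetric])
  also have "C * (10/9) * g * (\<Sum>j<r. \<theta> ^ (r - j) * q ^ j) \<le> C * (10/9) * g * (10 * \<theta> ^ r)"
    using C f by (intro mult_left_mono sum_q_le) auto
  also have "C * \<theta> ^ r * I + (C * (10/9) * f * (\<theta> ^ r * (\<Sum>j<r. \<theta> ^ j)) + C * (10/9) * g * (10 * \<theta> ^ r)) =
     C * \<theta> ^ r * (I + 10/9 * (f * (\<Sum>j<r. \<theta> ^ j)) + 100/9 * g)"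
    by (simp add: algebra_simps)
  also have "\<dots> \<le> C * \<theta> ^ r * (I + 2 * f * (\<Sum>j<r. \<theta> ^ j) + 12 * g)"
  proof (rule mult_left_mono)
    have "0 \<le> f * (\<Sum>j<r. \<theta> ^ j)" using f sum_theta_le(3) by auto
    then show "I + 10/9 * (f * (\<Sum>j<r. \<theta> ^ j)) + 100/9 * g \<le> I + 2 * f * (\<Sum>j<r. \<theta> ^ j) + 12 * g" using f by auto
  qed (use C theta in auto)
  finally show ?thesis by simp
qed

text \<open>The first index is the power, the second the level; \<open>E\<close> collects the twin
  terms. \<open>A (k - l)\<close> stands at level \<open>Suc r\<close>, being a moment of the tree
  from which copies were detached, while a detached subtree is seen one level lower.\<close>

definition moment_system :: "(nat \<Rightarrow> nat \<Rightarrow> 'a) \<Rightarrow> (nat \<Rightarrow> nat \<Rightarrow> 'a) \<Rightarrow> bool" where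
  "moment_system A E \<longleftrightarrow> (\<forall>r. A 0 r = y) \<and>
     (\<forall>k r. k \<le> 3 \<longrightarrow> A (Suc k) (Suc r) =
        (\<Sum>l\<le>k. of_nat (k choose l) * (A (k - l) (Suc r) * (A (Suc l) r + E (Suc l) r)))) \<and>
     (\<forall>k r. 1 \<le> k \<longrightarrow> k \<le> 4 \<longrightarrow> N (E k r) \<le> C * q ^ r)"

text \<open>The summand l = k contains \<open>A 0 = y\<close> and becomes the linear part; all other
  summands are products of lower moments and act as a source.\<close>

lemma moment_system_rec:
  assumes "moment_system A E"
  shows "A 1 (Suc r) = y * A 1 r + y * E 1 r"
    "A 2 (Suc r) = y * A 2 r + (y * E 2 r + A 1 (Suc r) * (A 1 r + E 1 r))"
    "A 3 (Suc r) = y * A 3 r + (y * E 3 r + 2 * (A 1 (Suc r) * (A 2 r + E 2 r)) + A 2 (Suc r) * (A 1 r + E 1 r))"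
    "A 4 (Suc r) = y * A 4 r + (y * E 4 r + 3 * (A 1 (Suc r) * (A 3 r + E 3 r)) + 3 * (A 2 (Suc r) * (A 2 r + E 2 r)) + A 3 (Suc r) * (A 1 r + E 1 r))"
proof -
  have A0: "A 0 r = y" and rec: "\<And>k r. k \<le> 3 \<Longrightarrow> A (Suc k) (Suc r) =
        (\<Sum>l\<le>k. of_nat (k choose l) * (A (k - l) (Suc r) * (A (Suc l) r + E (Suc l) r)))" for r
    using assms by (auto simp: moment_system_def)
  show "A 1 (Suc r) = y * A 1 r + y * E 1 r"
    using rec[of 0 r] by (simp add: A0 algebra_simps)
  show "A 2 (Suc r) = y * A 2 r + (y * E 2 r + A 1 (Suc r) * (A 1 r + E 1 r))"
    using rec[of 1 r] by (simp add: A0 numeral_2_eq_2) (simp add: algebra_simps)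
  show "A 3 (Suc r) = y * A 3 r + (y * E 3 r + 2 * (A 1 (Suc r) * (A 2 r + E 2 r)) + A 2 (Suc r) * (A 1 r + E 1 r))"
    using rec[of 2 r] by (simp add: A0 numeral_3_eq_3 numeral_2_eq_2 choose_two) (simp add: algebra_simps)
  show "A 4 (Suc r) = y * A 4 r + (y * E 4 r + 3 * (A 1 (Suc r) * (A 3 r + E 3 r)) + 3 * (A 2 (Suc r) * (A 2 r + E 2 r)) + A 3 (Suc r) * (A 1 r + E 1 r))"
    using rec[of 3 r] by (simp add: A0 eval_nat_numeral) (simp add: algebra_simps)
qed

lemma moment_system_E:
  assumes "moment_system A E" "1 \<le> k" "k \<le> 4"
  shows "N (E k r) \<le> C * q ^ r" "N (E k r) \<le> C * \<theta> ^ r" "N (y * E k r) \<le> C ^ 2 * q ^ r"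
proof -
  show *: "N (E k r) \<le> C * q ^ r" using assms by (auto simp: moment_system_def)
  also have "\<dots> \<le> C * \<theta> ^ r" using C theta q_ge0 by (intro mult_left_mono power_mono) auto
  finally show "N (E k r) \<le> C * \<theta> ^ r" .
  have "N (y * E k r) \<le> C * (C * q ^ r)"
    using C by (intro order.trans[OF N_mult] mult_mono Ny1 * N_nonneg) auto
  then show "N (y * E k r) \<le> C ^ 2 * q ^ r" by (simp add: power2_eq_square)
qed

lemma N_mult_le: "N a \<le> u \<Longrightarrow> N b \<le> v \<Longrightarrow> N (a * b) \<le> u * v"
  using N_mult[of a b] mult_mono[of "N a" u "N b" v] N_nonneg[of a] N_nonneg[of b] by linarith

lemma N_add_le: "N a \<le> u \<Longrightarrow> N b \<le> v \<Longrightarrow> N (a + b) \<le> u + v"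
  using N_add[of a b] by linarith

lemma N_diff_le: "N a \<le> u \<Longrightarrow> N b \<le> v \<Longrightarrow> N (a - b) \<le> u + v"
  using N_diff[of a b] by linarith

lemma N_numeral_mult_le: "N a \<le> u \<Longrightarrow> N (numeral n * a) \<le> numeral n * u"
  by (rule order.trans[OF N_numeral_mult]) (simp add: mult_left_mono)

lemma theta_power: "0 < \<theta> ^ r" "\<theta> ^ r \<le> 1" "\<theta> ^ Suc r \<le> \<theta> ^ r" "0 \<le> q ^ r" "q ^ r \<le> \<theta> ^ r" "q ^ r \<le> 1" "q ^ Suc r \<le> q ^ r"
proof -
  show "0 < \<theta> ^ r" "0 \<le> q ^ r" "q ^ r \<le> 1" "\<theta> ^ r \<le> 1"
    using theta q_ge0 by (auto intro: power_le_one)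
  show "\<theta> ^ Suc r \<le> \<theta> ^ r" "q ^ Suc r \<le> q ^ r"
    using theta q_ge0 by (auto intro!: power_decreasing simp del: power_Suc)
  show "q ^ r \<le> \<theta> ^ r" using theta q_ge0 by (intro power_mono)
qed

section \<open>Moments of a single level\<close>

context
  fixes L E :: "nat \<Rightarrow> nat \<Rightarrow> 'a"
  assumes sys: "moment_system L E" and L0: "\<And>k. L k 0 = y"
begin

text \<open>The effective number of levels: at most 1 + r and at most 22/\<delta>. The k-th moment
  of one level will be of order s^(k-1), one factor for each summation of a source.\<close>

definition s :: "nat \<Rightarrow> real" where "s r = 1 + (\<Sum>j<r. \<theta> ^ j)"

lemma s_ge: "1 \<le> s r" "0 \<le> s r" "s r \<le> 1 + real r" "s r \<le> 22 / \<delta>"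
proof -
  show "1 \<le> s r" "0 \<le> s r" "s r \<le> 1 + real r"
    using sum_theta_le[of r] by (auto simp: s_def)
  have "1 \<le> 2 / \<delta>" using \<delta> by simp
  then show "s r \<le> 22 / \<delta>" using sum_theta_le(2)[of r] by (simp add: s_def add_divide_distrib[symmetric])
qed

lemma s_mono: "i \<le> j \<Longrightarrow> s i \<le> s j"
  unfolding s_def using theta by (intro add_left_mono sum_mono2) auto

lemmas sE = moment_system_E[OF sys]
lemmas srec = moment_system_rec[OF sys]

lemma L_step:
  assumes rec: "\<And>r. L k (Suc r) = y * L k r + F r"
    and F: "\<And>j. j < r \<Longrightarrow> N (F j) \<le> C ^ 2 * q ^ j + f * s r ^ p * (\<theta> ^ j * \<theta> ^ j)"
    and f: "0 \<le> f"
  shows "N (L k r) \<le> C * (C + 2 * f + 12 * C ^ 2) * s r ^ Suc p * \<theta> ^ r"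
proof -
  have sp: "1 \<le> s r ^ p" using s_ge by simp
  have "N (L k r) \<le> C * \<theta> ^ r * (C + 2 * (f * s r ^ p) * (\<Sum>j<r. \<theta> ^ j) + 12 * C ^ 2)"
  proof (rule duhamel_bound[where G = "L k" and F = F])
    show "L k (Suc r) = y * L k r + F r" for r by (rule rec)
    show "N (L k 0) \<le> C" by (simp add: L0 Ny1)
    show "N (F j) \<le> f * s r ^ p * (\<theta> ^ j * \<theta> ^ j) + C\<^sup>2 * q ^ j" if "j < r" for j
      using F[OF that] by simp
  qed (use f sp in auto)
  also have "\<dots> \<le> C * \<theta> ^ r * ((C + 2 * f + 12 * C ^ 2) * s r ^ Suc p)"
  proof (rule mult_left_mono)
    have s1: "1 \<le> s r ^ Suc p" using s_ge by (intro one_le_power)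
    have "f * s r ^ p * (\<Sum>j<r. \<theta> ^ j) \<le> f * s r ^ p * s r"
      using f sp by (intro mult_left_mono) (auto simp: s_def)
    moreover have "C * 1 \<le> C * s r ^ Suc p" "C ^ 2 * 1 \<le> C ^ 2 * s r ^ Suc p"
      using C s1 by (auto intro!: mult_left_mono simp del: power_Suc)
    ultimately show "C + 2 * (f * s r ^ p) * (\<Sum>j<r. \<theta> ^ j) + 12 * C ^ 2 \<le> (C + 2 * f + 12 * C ^ 2) * s r ^ Suc p"
      by (simp add: algebra_simps)
  qed (use C theta_power(1)[of r] in auto)
  finally show ?thesis by (simp add: mult_ac)
qed

lemma L_B:
  assumes "N (L k r) \<le> K * s r ^ p * \<theta> ^ r" "1 \<le> k" "k \<le> 4"
  shows "N (L k r + E k r) \<le> (K + C) * s r ^ p * \<theta> ^ r"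
proof -
  have "N (E k r) \<le> C * s r ^ p * \<theta> ^ r"
  proof -
    have "C * 1 * \<theta> ^ r \<le> C * s r ^ p * \<theta> ^ r"
      using C theta_power(1)[of r] by (intro mult_right_mono mult_left_mono one_le_power s_ge) auto
    then show ?thesis using sE(2)[OF assms(2,3), of r] by simp
  qed
  from N_add_le[OF assms(1) this] show ?thesis by (simp add: algebra_simps)
qed

lemma L_prod:
  assumes A: "\<And>r. N (L k r) \<le> K * s r ^ p * \<theta> ^ r" and B: "\<And>r. N (L l r) \<le> K' * s r ^ p' * \<theta> ^ r"
    and l: "1 \<le> l" "l \<le> 4" and K: "0 \<le> K" "0 \<le> K'" and j: "j < r"
  shows "N (L k (Suc j) * (L l j + E l j)) \<le> K * (K' + C) * s r ^ (p + p') * (\<theta> ^ j * \<theta> ^ j)"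
proof -
  have "N (L k (Suc j)) \<le> K * s r ^ p * \<theta> ^ j"
    using K s_ge theta_power j s_mono[of "Suc j" r] theta(3)
    by (intro order.trans[OF A] mult_mono power_mono mult_nonneg_nonneg zero_le_power) (auto simp del: power_Suc intro: less_imp_le)
  moreover have "N (L l j + E l j) \<le> (K' + C) * s r ^ p' * \<theta> ^ j"
    using K C s_ge theta_power j s_mono[of j r] theta(3)
    by (intro order.trans[OF L_B[OF B l]] mult_mono power_mono mult_nonneg_nonneg zero_le_power) (auto intro: less_imp_le)
  ultimately have "N (L k (Suc j) * (L l j + E l j)) \<le> (K * s r ^ p * \<theta> ^ j) * ((K' + C) * s r ^ p' * \<theta> ^ j)"
    by (rule N_mult_le)
  then show ?thesis by (simp add: power_add mult_ac)
qed

lemmas kn = constants_nonneg[OF C]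

lemma L1: "N (L 1 r) \<le> K1 C * s r ^ 0 * \<theta> ^ r"
proof -
  have "N (L 1 r) \<le> C * \<theta> ^ r * (C + 2 * 0 * (\<Sum>j<r. \<theta> ^ j) + 12 * C ^ 2)"
  proof (rule duhamel_bound[where G = "L 1"])
    show "L 1 (Suc r) = y * L 1 r + y * E 1 r" for r by (rule srec)
    show "N (L 1 0) \<le> C" by (simp only: L0 Ny1)
    show "N (y * E 1 j) \<le> 0 * (\<theta> ^ j * \<theta> ^ j) + C\<^sup>2 * q ^ j" for j using sE(3)[of 1 j] by simp
  qed auto
  then show ?thesis by (simp add: K1_def mult_ac)
qed

lemma L2: "N (L 2 r) \<le> K2 C * s r ^ 1 * \<theta> ^ r"
proof -
  have "N (L 2 r) \<le> C * (C + 2 * (K1 C * (K1 C + C)) + 12 * C ^ 2) * s r ^ Suc 0 * \<theta> ^ r"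
  proof (rule L_step[where k = 2, OF srec(2)])
    fix j assume j: "j < r"
    show "N (y * E 2 j + L 1 (Suc j) * (L 1 j + E 1 j)) \<le> C ^ 2 * q ^ j + K1 C * (K1 C + C) * s r ^ 0 * (\<theta> ^ j * \<theta> ^ j)"
      using L_prod[OF L1 L1 _ _ kn(1) kn(1) j] by (intro N_add_le sE(3)) auto
  qed (use kn C in auto)
  then show ?thesis by (simp add: K2_def)
qed

lemma L3: "N (L 3 r) \<le> K3 C * s r ^ 2 * \<theta> ^ r"
proof -
  have "N (L 3 r) \<le> C * (C + 2 * (2 * (K1 C * (K2 C + C)) + K2 C * (K1 C + C)) + 12 * C ^ 2) * s r ^ Suc 1 * \<theta> ^ r"
  proof (rule L_step[where k = 3, OF srec(3)])
    fix j assume j: "j < r"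
    have "N (y * E 3 j + 2 * (L 1 (Suc j) * (L 2 j + E 2 j)) + L 2 (Suc j) * (L 1 j + E 1 j))
      \<le> C ^ 2 * q ^ j + 2 * (K1 C * (K2 C + C) * s r ^ (0 + 1) * (\<theta> ^ j * \<theta> ^ j)) + K2 C * (K1 C + C) * s r ^ (1 + 0) * (\<theta> ^ j * \<theta> ^ j)"
      using kn by (intro N_add_le N_numeral_mult_le sE(3) L_prod[OF L1 L2] L_prod[OF L2 L1] j) auto
    then show "N (y * E 3 j + 2 * (L 1 (Suc j) * (L 2 j + E 2 j)) + L 2 (Suc j) * (L 1 j + E 1 j))
      \<le> C ^ 2 * q ^ j + (2 * (K1 C * (K2 C + C)) + K2 C * (K1 C + C)) * s r ^ 1 * (\<theta> ^ j * \<theta> ^ j)"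
      by (simp add: algebra_simps)
  qed (use kn C in auto)
  then show ?thesis by (simp add: K3_def numeral_2_eq_2)
qed

lemma L4: "N (L 4 r) \<le> K4 C * s r ^ 3 * \<theta> ^ r"
proof -
  have "N (L 4 r) \<le> C * (C + 2 * (3 * (K1 C * (K3 C + C)) + 3 * (K2 C * (K2 C + C)) + K3 C * (K1 C + C)) + 12 * C ^ 2) * s r ^ Suc 2 * \<theta> ^ r"
  proof (rule L_step[where k = 4, OF srec(4)])
    fix j assume j: "j < r"
    have "N (y * E 4 j + 3 * (L 1 (Suc j) * (L 3 j + E 3 j)) + 3 * (L 2 (Suc j) * (L 2 j + E 2 j)) + L 3 (Suc j) * (L 1 j + E 1 j))
      \<le> C ^ 2 * q ^ j + 3 * (K1 C * (K3 C + C) * s r ^ (0 + 2) * (\<theta> ^ j * \<theta> ^ j)) + 3 * (K2 C * (K2 C + C) * s r ^ (1 + 1) * (\<theta> ^ j * \<theta> ^ j))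
         + K3 C * (K1 C + C) * s r ^ (2 + 0) * (\<theta> ^ j * \<theta> ^ j)"
      using kn by (intro N_add_le N_numeral_mult_le sE(3) L_prod[OF L1 L3] L_prod[OF L2 L2] L_prod[OF L3 L1] j) auto
    then show "N (y * E 4 j + 3 * (L 1 (Suc j) * (L 3 j + E 3 j)) + 3 * (L 2 (Suc j) * (L 2 j + E 2 j)) + L 3 (Suc j) * (L 1 j + E 1 j))
      \<le> C ^ 2 * q ^ j + (3 * (K1 C * (K3 C + C)) + 3 * (K2 C * (K2 C + C)) + K3 C * (K1 C + C)) * s r ^ 2 * (\<theta> ^ j * \<theta> ^ j)"
      by (simp add: algebra_simps power2_eq_square)
  qed (use kn C in auto)
  then show ?thesis by (simp add: K4_def numeral_3_eq_3 numeral_2_eq_2)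
qed

section \<open>Moments of the difference of two levels\<close>

context
  fixes A EA :: "nat \<Rightarrow> nat \<Rightarrow> 'a" and h :: nat
  assumes sysA: "moment_system A EA" and h: "1 \<le> h"
    and A1_eq: "\<And>r. A 1 r = L 1 r - L 1 (r + h)"
    and A2_0: "A 2 0 = y - 2 * L 1 h + L 2 h"
    and A3_0: "A 3 0 = y - 3 * L 1 h + 3 * L 2 h - L 3 h"
    and A4_0: "A 4 0 = y - 4 * L 1 h + 6 * L 2 h - 4 * L 3 h + L 4 h"
begin

text \<open>The size of 1 - y^h, which is the gain of a difference over a single level. Through
  \<mu>/\<delta> \<le> h it turns a sum over 1/\<delta> levels into h.\<close>

definition \<mu> :: real where "\<mu> = min 1 (real h * \<delta>)"

lemma mu: "0 \<le> \<mu>" "\<mu> \<le> 1" "\<mu> \<le> real h * \<delta>" "\<mu> / \<delta> \<le> real h"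
  using \<delta> by (auto simp: \<mu>_def field_simps)

lemma Ny_diff: "N (y ^ k - y ^ (k + h)) \<le> C * \<theta> ^ k * \<mu>"
  using N_y_power_diff[of k h] by (simp add: \<theta>_def \<mu>_def)

text \<open>Unrolled, the first moment is y^(r+1) - y^(r+1+h) plus twin terms. Those created below
  level r occur with differences of powers of y and share the factor \<mu>; those created from r to
  r + h - 1 do not, but sum to O(q^r), where 6 exceeds 1/(1 - q) = 100/19.\<close>

lemma A1: "N (A 1 r) \<le> 11 * C ^ 2 * (\<mu> * \<theta> ^ r + q ^ r)"
proof -
  have L1_eq: "L 1 r = y ^ Suc r + (\<Sum>j<r. y ^ (r - j) * E 1 j)" for r
  proof -
    have "L 1 r = y ^ r * L 1 0 + (\<Sum>j<r. y ^ (r - Suc j) * (y * E 1 j))"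
      by (rule duhamel[where G = "L 1"]) (rule srec)
    also have "(\<Sum>j<r. y ^ (r - Suc j) * (y * E 1 j)) = (\<Sum>j<r. y ^ (r - j) * E 1 j)"
      by (intro sum.cong refl) (simp add: Suc_diff_Suc mult.assoc[symmetric] power_Suc2[symmetric] del: power_Suc)
    finally show ?thesis by (simp add: L0 mult.commute)
  qed
  have split: "(\<Sum>j<r + h. y ^ (r + h - j) * E 1 j) = (\<Sum>j<r. y ^ (r - j + h) * E 1 j) + (\<Sum>j\<in>{r..<r + h}. y ^ (r + h - j) * E 1 j)"
  proof -
    have "(\<Sum>j<r + h. y ^ (r + h - j) * E 1 j) = (\<Sum>j<r. y ^ (r + h - j) * E 1 j) + (\<Sum>j\<in>{r..<r + h}. y ^ (r + h - j) * E 1 j)"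
      unfolding lessThan_atLeast0 by (rule sum.atLeastLessThan_concat[symmetric]) auto
    then show ?thesis by simp
  qed
  have "A 1 r = (y ^ Suc r - y ^ (Suc r + h)) + (\<Sum>j<r. (y ^ (r - j) - y ^ (r - j + h)) * E 1 j) - (\<Sum>j\<in>{r..<r + h}. y ^ (r + h - j) * E 1 j)"
    unfolding A1_eq L1_eq split by (simp add: sum_subtractf left_diff_distrib)
  also have "N \<dots> \<le> C * \<theta> ^ r * \<mu> + 10 * (C ^ 2 * \<mu> * \<theta> ^ r) + 6 * (C ^ 2 * q ^ r)"
  proof (intro N_diff_le N_add_le)
    have "C * \<theta> ^ Suc r * \<mu> \<le> C * \<theta> ^ r * \<mu>"
      using C mu theta_power(3)[of r] by (intro mult_right_mono mult_left_mono) auto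
    then show "N (y ^ Suc r - y ^ (Suc r + h)) \<le> C * \<theta> ^ r * \<mu>"
      using Ny_diff[of "Suc r"] by linarith
    have "N (\<Sum>j<r. (y ^ (r - j) - y ^ (r - j + h)) * E 1 j) \<le> (\<Sum>j<r. (C * \<theta> ^ (r - j) * \<mu>) * (C * q ^ j))"
      by (intro order.trans[OF N_sum] sum_mono N_mult_le Ny_diff sE) auto
    also have "\<dots> = C ^ 2 * \<mu> * (\<Sum>j<r. \<theta> ^ (r - j) * q ^ j)"
      by (simp add: sum_distrib_left power2_eq_square mult_ac)
    also have "\<dots> \<le> C ^ 2 * \<mu> * (10 * \<theta> ^ r)"
      using mu by (intro mult_left_mono sum_q_le) auto
    finally show "N (\<Sum>j<r. (y ^ (r - j) - y ^ (r - j + h)) * E 1 j) \<le> 10 * (C ^ 2 * \<mu> * \<theta> ^ r)" by simp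
    have "N (\<Sum>j\<in>{r..<r + h}. y ^ (r + h - j) * E 1 j) \<le> (\<Sum>j\<in>{r..<r + h}. C * (C * q ^ j))"
    proof (intro order.trans[OF N_sum] sum_mono N_mult_le sE)
      fix j
      have "C * \<theta> ^ (r + h - j) \<le> C * 1" using C theta_power(2) by (intro mult_left_mono) auto
      then show "N (y ^ (r + h - j)) \<le> C" using Ny[of "r + h - j"] by simp
    qed auto
    also have "\<dots> = C ^ 2 * (\<Sum>j\<in>{r..<r + h}. q ^ j)"
      by (simp add: sum_distrib_left power2_eq_square mult_ac)
    also have "(\<Sum>j\<in>{r..<r + h}. q ^ j) = q ^ r * (\<Sum>j<h. q ^ j)"
      using sum.shift_bounds_nat_ivl[of "\<lambda>j. q ^ j" 0 r h]
      by (simp add: add.commute lessThan_atLeast0 power_add sum_distrib_left mult.commute)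
    also have "C ^ 2 * (q ^ r * (\<Sum>j<h. q ^ j)) \<le> C ^ 2 * (q ^ r * 6)"
    proof (intro mult_left_mono)
      have "(\<Sum>j<h. q ^ j) = (1 - q ^ h) / (1 - q)" by (subst sum_gp_strict) (simp add: q_def)
      also have "\<dots> \<le> 1 / (1 - q)" using theta_power(4)[of h] by (intro divide_right_mono) (auto simp: q_def)
      also have "\<dots> \<le> 6" by (simp add: q_def)
      finally show "(\<Sum>j<h. q ^ j) \<le> 6" .
    qed (use theta_power(4) in auto)
    finally show "N (\<Sum>j\<in>{r..<r + h}. y ^ (r + h - j) * E 1 j) \<le> 6 * (C ^ 2 * q ^ r)"
      by (simp add: mult_ac)
  qed
  also have "\<dots> \<le> 11 * C ^ 2 * (\<mu> * \<theta> ^ r + q ^ r)"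
  proof -
    have "C \<le> C ^ 2" using C by (simp add: power2_eq_square)
    then have "C * (\<theta> ^ r * \<mu>) \<le> C ^ 2 * (\<theta> ^ r * \<mu>)"
      using mu theta_power(1)[of r] by (intro mult_right_mono) auto
    moreover have "0 \<le> C ^ 2 * q ^ r" using theta_power(4)[of r] by auto
    ultimately show ?thesis by (simp add: algebra_simps)
  qed
  finally show ?thesis .
qed

lemmas aE = moment_system_E[OF sysA]
lemmas arec = moment_system_rec[OF sysA]

lemma A1_M: "N (A 1 r) \<le> M1 C * (\<mu> * \<theta> ^ r + q ^ r)"
  and B1_M: "N (A 1 r + EA 1 r) \<le> M1 C * (\<mu> * \<theta> ^ r + q ^ r)"
  and A1_Suc: "N (A 1 (Suc r)) \<le> M1 C * (\<mu> * \<theta> ^ r + q ^ r)"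
proof -
  have *: "0 \<le> \<mu> * \<theta> ^ r" using mu theta_power(1)[of r] by simp
  have "11 * C ^ 2 * (\<mu> * \<theta> ^ r + q ^ r) \<le> M1 C * (\<mu> * \<theta> ^ r + q ^ r)" for r
    using mu theta_power(1)[of r] theta_power(4)[of r] by (intro mult_right_mono) (auto simp: M1_def)
  then show A1_M: "N (A 1 r) \<le> M1 C * (\<mu> * \<theta> ^ r + q ^ r)" for r
    using A1[of r] order.trans by blast
  have "C * q ^ r \<le> C ^ 2 * q ^ r" using C theta_power(4)[of r] by (intro mult_right_mono) (auto simp: power2_eq_square)
  then have "N (A 1 r + EA 1 r) \<le> 11 * C ^ 2 * (\<mu> * \<theta> ^ r + q ^ r) + C ^ 2 * q ^ r"
    using N_add_le[OF A1 aE(1), of 1 r r] by simp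
  also have "\<dots> \<le> M1 C * (\<mu> * \<theta> ^ r + q ^ r)"
    using mult_left_mono[OF *, of "C ^ 2"] by (simp add: M1_def algebra_simps)
  finally show "N (A 1 r + EA 1 r) \<le> M1 C * (\<mu> * \<theta> ^ r + q ^ r)" .
  have "M1 C * (\<mu> * \<theta> ^ Suc r + q ^ Suc r) \<le> M1 C * (\<mu> * \<theta> ^ r + q ^ r)"
    using kn(5) mu theta_power[of r] by (intro mult_left_mono add_mono) auto
  then show "N (A 1 (Suc r)) \<le> M1 C * (\<mu> * \<theta> ^ r + q ^ r)"
    using A1_M[of "Suc r"] by linarith
qed

lemma h_real: "1 \<le> real h" "real h \<le> real h ^ 2" "1 \<le> real h ^ 2"
proof -
  show h1: "1 \<le> real h" using h by simp
  then show "real h \<le> real h ^ 2" by (simp add: power2_eq_square)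
  show "1 \<le> real h ^ 2" using h1 by (rule one_le_power)
qed

text \<open>These moments make up the initial values of the difference moments. The second and third
  use s \<le> 2h only; in the fourth one of the three factors s is bounded by 22/\<delta>, which
  gives h^2/\<delta> instead of h^3 (88 = 4 * 22).\<close>

lemma L_h: "N (L 1 h) \<le> K1 C" "N (L 2 h) \<le> 2 * K2 C * real h" "N (L 3 h) \<le> 4 * K3 C * real h ^ 2"
  "N (L 4 h) \<le> 88 * K4 C * (real h ^ 2 / \<delta>)"
proof -
  have t: "K * \<theta> ^ h \<le> K" if "0 \<le> K" for K
    using that theta_power(2)[of h] mult_left_mono[of "\<theta> ^ h" 1 K] by simp
  have s2: "s h \<le> 2 * real h" "0 \<le> s h" using s_ge[of h] h_real by auto
  then have s4: "s h ^ 2 \<le> 4 * real h ^ 2" using power_mono[of "s h" "2 * real h" 2] by (simp add: power_mult_distrib)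
  show "N (L 1 h) \<le> K1 C" using L1[of h] t[OF kn(1)] by simp
  have "N (L 2 h) \<le> K2 C * s h ^ 1" using L2[of h] t[of "K2 C * s h ^ 1"] kn s2 by simp
  also have "\<dots> \<le> K2 C * (2 * real h)" using kn s2 by (intro mult_left_mono) auto
  finally show "N (L 2 h) \<le> 2 * K2 C * real h" by simp
  have "N (L 3 h) \<le> K3 C * s h ^ 2" using L3[of h] t[of "K3 C * s h ^ 2"] kn s2 by simp
  also have "\<dots> \<le> K3 C * (4 * real h ^ 2)" using kn s4 by (intro mult_left_mono) auto
  finally show "N (L 3 h) \<le> 4 * K3 C * real h ^ 2" by simp
  have "N (L 4 h) \<le> K4 C * s h ^ 3" using L4[of h] t[of "K4 C * s h ^ 3"] kn s2 by simp
  also have "\<dots> \<le> K4 C * (4 * real h ^ 2 * (22 / \<delta>))"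
    unfolding power3_eq_cube power2_eq_square[symmetric]
    using kn s4 s2 s_ge(4)[of h] by (intro mult_left_mono mult_mono) auto
  finally show "N (L 4 h) \<le> 88 * K4 C * (real h ^ 2 / \<delta>)" by (simp add: mult_ac)
qed

lemma theta_mu_q: 
  assumes "0 \<le> v"
  shows "(\<mu> * \<theta> ^ r + q ^ r) * (v * \<theta> ^ r) \<le> v * \<mu> * (\<theta> ^ r * \<theta> ^ r) + v * q ^ r"
proof -
  have "q ^ r * \<theta> ^ r \<le> q ^ r * 1" using theta_power by (intro mult_left_mono) auto
  then have "v * (q ^ r * \<theta> ^ r) \<le> v * q ^ r" using assms by (intro mult_left_mono) auto
  then show ?thesis by (simp add: algebra_simps)
qed

text \<open>The initial value is O(h). The source is a product of two first moments, at most a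
  multiple of \<mu> \<theta>^(2j) + q^j after one of the two factors \<mu> is bounded by 1; its
  summation costs \<mu>/\<delta> \<le> h.\<close>

lemma A2: "N (A 2 r) \<le> M2 C * real h * \<theta> ^ r"
proof -
  have I: "N (A 2 0) \<le> (C + 2 * K1 C + 2 * K2 C) * real h"
  proof -
    have "N (A 2 0) \<le> C + 2 * K1 C + 2 * K2 C * real h"
      unfolding A2_0 by (intro N_add_le N_diff_le N_numeral_mult_le L_h Ny1)
    also have "\<dots> \<le> (C + 2 * K1 C + 2 * K2 C) * real h"
      using C kn h_real mult_left_mono[of 1 "real h" "C + 2 * K1 C"] by (simp add: algebra_simps)
    finally show ?thesis .
  qed
  have "N (A 2 r) \<le> C * \<theta> ^ r * ((C + 2 * K1 C + 2 * K2 C) * real h + 2 * (2 * M1 C ^ 2 * \<mu>) * (\<Sum>j<r. \<theta> ^ j) + 12 * (C ^ 2 + 2 * M1 C ^ 2))"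
  proof (rule duhamel_bound[where G = "A 2", OF arec(2) I])
    fix j
    have "N (y * EA 2 j + A 1 (Suc j) * (A 1 j + EA 1 j)) \<le> C ^ 2 * q ^ j + (M1 C * (\<mu> * \<theta> ^ j + q ^ j)) * (M1 C * (\<mu> * \<theta> ^ j + q ^ j))"
      by (intro N_add_le N_mult_le aE A1_Suc B1_M) auto
    also have "(M1 C * (\<mu> * \<theta> ^ j + q ^ j)) * (M1 C * (\<mu> * \<theta> ^ j + q ^ j)) = M1 C ^ 2 * (\<mu> * \<theta> ^ j + q ^ j) ^ 2"
      by (simp add: power2_eq_square mult_ac)
    also have "\<dots> \<le> M1 C ^ 2 * (2 * \<mu> * (\<theta> ^ j * \<theta> ^ j) + 2 * q ^ j)"
    proof (rule mult_left_mono)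
      have 1: "q ^ j * q ^ j \<le> q ^ j" using theta_power[of j] mult_left_mono[of "q ^ j" 1 "q ^ j"] by simp
      have 2: "\<mu> * \<mu> * (\<theta> ^ j * \<theta> ^ j) \<le> \<mu> * (\<theta> ^ j * \<theta> ^ j)"
        using mu theta_power(1)[of j] mult_left_mono[of \<mu> 1 \<mu>] by (intro mult_right_mono) auto
      have "(\<mu> * \<theta> ^ j + q ^ j) ^ 2 \<le> 2 * (\<mu> * \<theta> ^ j) ^ 2 + 2 * (q ^ j) ^ 2"
        using zero_le_power2[of "\<mu> * \<theta> ^ j - q ^ j"] by (simp add: power2_eq_square algebra_simps)
      also have "\<dots> = 2 * (\<mu> * \<mu> * (\<theta> ^ j * \<theta> ^ j)) + 2 * (q ^ j * q ^ j)" by (simp add: power2_eq_square mult_ac)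
      also have "\<dots> \<le> 2 * \<mu> * (\<theta> ^ j * \<theta> ^ j) + 2 * q ^ j" using 1 2 by linarith
      finally show "(\<mu> * \<theta> ^ j + q ^ j) ^ 2 \<le> 2 * \<mu> * (\<theta> ^ j * \<theta> ^ j) + 2 * q ^ j" .
    qed simp
    finally show "N (y * EA 2 j + A 1 (Suc j) * (A 1 j + EA 1 j)) \<le> 2 * M1 C ^ 2 * \<mu> * (\<theta> ^ j * \<theta> ^ j) + (C ^ 2 + 2 * M1 C ^ 2) * q ^ j"
      by (simp add: algebra_simps)
  qed (use mu in auto)
  also have "\<dots> \<le> C * \<theta> ^ r * (((C + 2 * K1 C + 2 * K2 C) + 80 * M1 C ^ 2 + 12 * (C ^ 2 + 2 * M1 C ^ 2)) * real h)"
  proof (rule mult_left_mono)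
    have "\<mu> * (\<Sum>j<r. \<theta> ^ j) \<le> \<mu> * (20 / \<delta>)" using mu by (intro mult_left_mono sum_theta_le) auto
    also have "\<dots> = 20 * (\<mu> / \<delta>)" by simp
    also have "\<dots> \<le> 20 * real h" using mu(4) by (intro mult_left_mono) auto
    finally have "4 * M1 C ^ 2 * (\<mu> * (\<Sum>j<r. \<theta> ^ j)) \<le> 4 * M1 C ^ 2 * (20 * real h)" by (intro mult_left_mono) auto
    moreover have "12 * (C ^ 2 + 2 * M1 C ^ 2) * 1 \<le> 12 * (C ^ 2 + 2 * M1 C ^ 2) * real h"
      using h_real by (intro mult_left_mono) auto
    ultimately show "(C + 2 * K1 C + 2 * K2 C) * real h + 2 * (2 * M1 C ^ 2 * \<mu>) * (\<Sum>j<r. \<theta> ^ j) + 12 * (C ^ 2 + 2 * M1 C ^ 2) \<le>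
      ((C + 2 * K1 C + 2 * K2 C) + 80 * M1 C ^ 2 + 12 * (C ^ 2 + 2 * M1 C ^ 2)) * real h"
      by (simp add: algebra_simps)
  qed (use C theta_power(1)[of r] in auto)
  finally show ?thesis by (simp add: M2_def mult_ac)
qed

lemma A_Suc:
  assumes "\<And>r. N (A k r) \<le> K * v * \<theta> ^ r" "0 \<le> K" "0 \<le> v"
  shows "N (A k (Suc r)) \<le> K * v * \<theta> ^ r"
  using assms(1)[of "Suc r"] mult_left_mono[OF theta_power(3)[of r], of "K * v"] assms(2,3) by simp

lemma A_B:
  assumes "\<And>r. N (A k r) \<le> K * v * \<theta> ^ r" "1 \<le> k" "k \<le> 4" "1 \<le> v"
  shows "N (A k r + EA k r) \<le> (K + C) * v * \<theta> ^ r"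
proof -
  have "C * \<theta> ^ r * 1 \<le> C * \<theta> ^ r * v" using C theta_power(1)[of r] assms(4) by (intro mult_left_mono) auto
  then have "N (EA k r) \<le> C * v * \<theta> ^ r" using aE(2)[OF assms(2,3), of r] by (simp add: mult_ac)
  from N_add_le[OF assms(1) this] show ?thesis by (simp add: algebra_simps)
qed

lemmas A2_Suc = A_Suc[OF A2 kn(6)] and B2 = A_B[OF A2]

text \<open>Every product in the source pairs a first moment, which brings \<mu>, with a second
  moment, which brings h; summation gives h \<mu>/\<delta> \<le> h^2.\<close>

lemma A3: "N (A 3 r) \<le> M3 C * real h ^ 2 * \<theta> ^ r"
proof -
  have I: "N (A 3 0) \<le> (C + 3 * K1 C + 6 * K2 C + 4 * K3 C) * real h ^ 2"
  proof -
    have "N (A 3 0) \<le> C + 3 * K1 C + 3 * (2 * K2 C * real h) + 4 * K3 C * real h ^ 2"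
      unfolding A3_0 by (intro N_add_le N_diff_le N_numeral_mult_le L_h Ny1)
    also have "\<dots> \<le> (C + 3 * K1 C + 6 * K2 C + 4 * K3 C) * real h ^ 2"
      using C kn h_real mult_left_mono[of 1 "real h ^ 2" "C + 3 * K1 C"] mult_left_mono[of "real h" "real h ^ 2" "K2 C"]
      by (simp add: algebra_simps)
    finally show ?thesis .
  qed
  let ?P = "M1 C * (M2 C + C)"
  have P: "0 \<le> ?P" using kn C by simp
  have "N (A 3 r) \<le> C * \<theta> ^ r * ((C + 3 * K1 C + 6 * K2 C + 4 * K3 C) * real h ^ 2 + 2 * (3 * ?P * real h * \<mu>) * (\<Sum>j<r. \<theta> ^ j) + 12 * (C ^ 2 + 3 * ?P * real h))"
  proof (rule duhamel_bound[where G = "A 3", OF arec(3) I])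
    fix j
    have "N (y * EA 3 j + 2 * (A 1 (Suc j) * (A 2 j + EA 2 j)) + A 2 (Suc j) * (A 1 j + EA 1 j)) \<le>
      C ^ 2 * q ^ j + 2 * ((M1 C * (\<mu> * \<theta> ^ j + q ^ j)) * ((M2 C + C) * real h * \<theta> ^ j)) + ((M2 C + C) * real h * \<theta> ^ j) * (M1 C * (\<mu> * \<theta> ^ j + q ^ j))"
    proof (intro aE N_add_le N_numeral_mult_le N_mult_le A1_Suc B1_M B2)
      have "M2 C * real h * \<theta> ^ j \<le> (M2 C + C) * real h * \<theta> ^ j"
        using C theta_power(1)[of j] by (intro mult_right_mono) auto
      then show "N (A 2 (Suc j)) \<le> (M2 C + C) * real h * \<theta> ^ j" using A2_Suc[of j] by simp
    qed (use h_real in auto)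
    also have "\<dots> = C ^ 2 * q ^ j + 3 * ?P * ((\<mu> * \<theta> ^ j + q ^ j) * (real h * \<theta> ^ j))"
      by (simp add: algebra_simps)
    also have "\<dots> \<le> C ^ 2 * q ^ j + 3 * ?P * (real h * \<mu> * (\<theta> ^ j * \<theta> ^ j) + real h * q ^ j)"
      using P by (intro add_left_mono mult_left_mono theta_mu_q) auto
    finally show "N (y * EA 3 j + 2 * (A 1 (Suc j) * (A 2 j + EA 2 j)) + A 2 (Suc j) * (A 1 j + EA 1 j)) \<le>
      3 * ?P * real h * \<mu> * (\<theta> ^ j * \<theta> ^ j) + (C ^ 2 + 3 * ?P * real h) * q ^ j"
      by (simp add: algebra_simps)
  qed (use mu kn C P in auto)
  also have "\<dots> \<le> C * \<theta> ^ r * (((C + 3 * K1 C + 6 * K2 C + 4 * K3 C) + 120 * ?P + 12 * (C ^ 2 + 3 * ?P)) * real h ^ 2)"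
  proof (rule mult_left_mono)
    have "\<mu> * (\<Sum>j<r. \<theta> ^ j) \<le> \<mu> * (20 / \<delta>)" using mu by (intro mult_left_mono sum_theta_le) auto
    also have "\<dots> = 20 * (\<mu> / \<delta>)" by simp
    also have "\<dots> \<le> 20 * real h" using mu(4) by (intro mult_left_mono) auto
    finally have "6 * ?P * real h * (\<mu> * (\<Sum>j<r. \<theta> ^ j)) \<le> 6 * ?P * real h * (20 * real h)" using P by (intro mult_left_mono) auto
    then have 1: "2 * (3 * ?P * real h * \<mu>) * (\<Sum>j<r. \<theta> ^ j) \<le> 120 * ?P * real h ^ 2"
      by (simp add: power2_eq_square algebra_simps)
    have 2: "C ^ 2 * 1 \<le> C ^ 2 * real h ^ 2" "?P * real h \<le> ?P * real h ^ 2"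
      by (rule mult_left_mono[OF h_real(3)], simp) (rule mult_left_mono[OF h_real(2) P])
    have "(C + 3 * K1 C + 6 * K2 C + 4 * K3 C) * real h ^ 2 + 2 * (3 * ?P * real h * \<mu>) * (\<Sum>j<r. \<theta> ^ j) + 12 * (C ^ 2 + 3 * ?P * real h) \<le>
      (C + 3 * K1 C + 6 * K2 C + 4 * K3 C) * real h ^ 2 + 120 * ?P * real h ^ 2 + 12 * (C ^ 2 * real h ^ 2 + 3 * (?P * real h ^ 2))"
    proof (intro add_mono mult_left_mono order_refl 1)
      show "3 * ?P * real h \<le> 3 * (?P * real h ^ 2)"
        unfolding mult.assoc[of 3] using mult_left_mono[OF 2(2), of 3] by simp
    qed (use 2(1) C kn in auto)
    then show "(C + 3 * K1 C + 6 * K2 C + 4 * K3 C) * real h ^ 2 + 2 * (3 * ?P * real h * \<mu>) * (\<Sum>j<r. \<theta> ^ j) + 12 * (C ^ 2 + 3 * ?P * real h) \<le>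
      ((C + 3 * K1 C + 6 * K2 C + 4 * K3 C) + 120 * ?P + 12 * (C ^ 2 + 3 * ?P)) * real h ^ 2"
      by (simp add: algebra_simps)
  qed (use C theta_power(1)[of r] in auto)
  finally show ?thesis by (simp add: M3_def mult_ac)
qed

lemmas A3_Suc = A_Suc[OF A3 kn(7)] and B3 = A_B[OF A3]

text \<open>First times third and second times second moment are both O(h^2), and the sum over the
  levels costs the full 1/\<delta>.\<close>

lemma A4: "N (A 4 r) \<le> M4 C * (real h ^ 2 / \<delta>)"
proof -
  let ?H = "real h ^ 2 / \<delta>"
  have H: "real h ^ 2 \<le> 2 * ?H" "1 \<le> 2 * ?H" "real h \<le> 2 * ?H"
  proof -
    have "real h ^ 2 * 1 \<le> real h ^ 2 * (2 / \<delta>)" using \<delta> by (intro mult_left_mono) auto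
    then show "real h ^ 2 \<le> 2 * ?H" by (simp add: mult.commute)
    then show "1 \<le> 2 * ?H" "real h \<le> 2 * ?H" using h_real by linarith+
  qed
  let ?I = "2 * C + 8 * K1 C + 24 * K2 C + 32 * K3 C + 88 * K4 C"
  have I: "N (A 4 0) \<le> ?I * ?H"
  proof -
    have "N (A 4 0) \<le> C + 4 * K1 C + 6 * (2 * K2 C * real h) + 4 * (4 * K3 C * real h ^ 2) + 88 * K4 C * ?H"
      unfolding A4_0 by (intro N_add_le N_diff_le N_numeral_mult_le L_h Ny1)
    also have "\<dots> = (C + 4 * K1 C) * 1 + 12 * K2 C * real h + 16 * K3 C * real h ^ 2 + 88 * K4 C * ?H" by simp
    also have "\<dots> \<le> (C + 4 * K1 C) * (2 * ?H) + 12 * K2 C * (2 * ?H) + 16 * K3 C * (2 * ?H) + 88 * K4 C * ?H"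
      using C kn H by (intro add_mono mult_left_mono) auto
    also have "\<dots> = ?I * ?H" by (simp add: algebra_simps add_divide_distrib)
    finally show ?thesis .
  qed
  let ?f = "6 * (M1 C * (M3 C + C)) + 3 * (M2 C * (M2 C + C)) + 2 * (M3 C * M1 C)"
  have f: "0 \<le> ?f" using kn C by simp
  \<comment> \<open>The gain \<mu> is given up here by \<mu> \<le> 1: the product of two second
    moments has no such factor, so 1/\<delta> remains in any case. Since q \<le> \<theta>, the part
    q^j joins the main term as well.\<close>
  have mq: "M1 C * (\<mu> * \<theta> ^ j + q ^ j) \<le> M1 C * (2 * \<theta> ^ j)" for j
  proof (rule mult_left_mono[OF _ kn(5)])
    have "\<mu> * \<theta> ^ j \<le> 1 * \<theta> ^ j" using mu theta_power(1)[of j] by (intro mult_right_mono) auto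
    then show "\<mu> * \<theta> ^ j + q ^ j \<le> 2 * \<theta> ^ j" using theta_power(5)[of j] by simp
  qed
  have "N (A 4 r) \<le> C * \<theta> ^ r * (?I * ?H + 2 * (?f * real h ^ 2) * (\<Sum>j<r. \<theta> ^ j) + 12 * C ^ 2)"
  proof (rule duhamel_bound[where G = "A 4", OF arec(4) I])
    fix j
    have "N (y * EA 4 j + 3 * (A 1 (Suc j) * (A 3 j + EA 3 j)) + 3 * (A 2 (Suc j) * (A 2 j + EA 2 j)) + A 3 (Suc j) * (A 1 j + EA 1 j)) \<le>
      C ^ 2 * q ^ j + 3 * ((M1 C * (2 * \<theta> ^ j)) * ((M3 C + C) * real h ^ 2 * \<theta> ^ j)) + 3 * ((M2 C * real h * \<theta> ^ j) * ((M2 C + C) * real h * \<theta> ^ j))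
        + (M3 C * real h ^ 2 * \<theta> ^ j) * (M1 C * (2 * \<theta> ^ j))"
      using h_real
      by (intro aE N_add_le N_numeral_mult_le N_mult_le A2_Suc A3_Suc B2 B3 order.trans[OF A1_Suc mq] order.trans[OF B1_M mq]) auto
    then show "N (y * EA 4 j + 3 * (A 1 (Suc j) * (A 3 j + EA 3 j)) + 3 * (A 2 (Suc j) * (A 2 j + EA 2 j)) + A 3 (Suc j) * (A 1 j + EA 1 j)) \<le>
      ?f * real h ^ 2 * (\<theta> ^ j * \<theta> ^ j) + C ^ 2 * q ^ j"
      by (simp add: algebra_simps power2_eq_square)
  qed (use f C in auto)
  also have "\<dots> \<le> C * 1 * (?I * ?H + 40 * ?f * ?H + 24 * C ^ 2 * ?H)"
  proof (rule mult_mono)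
    show "C * \<theta> ^ r \<le> C * 1" using C theta_power(2)[of r] by (intro mult_left_mono) auto
    have "?f * real h ^ 2 * (\<Sum>j<r. \<theta> ^ j) \<le> ?f * real h ^ 2 * (20 / \<delta>)"
      using f by (intro mult_left_mono sum_theta_le) auto
    moreover have "2 * (f * H) * S \<le> 40 * f * (H / d)" if "f * H * S \<le> f * H * (20 / d)" for f H S d :: real
      using that by simp
    ultimately have 1: "2 * (?f * real h ^ 2) * (\<Sum>j<r. \<theta> ^ j) \<le> 40 * ?f * ?H" by blast
    have "12 * C ^ 2 * 1 \<le> 12 * C ^ 2 * (2 * ?H)" using H by (intro mult_left_mono) auto
    then have 2: "12 * C ^ 2 \<le> 24 * C ^ 2 * ?H" by simp
    show "?I * ?H + 2 * (?f * real h ^ 2) * (\<Sum>j<r. \<theta> ^ j) + 12 * C ^ 2 \<le> ?I * ?H + 40 * ?f * ?H + 24 * C ^ 2 * ?H"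
      by (intro add_mono order_refl 1 2)
    have "0 \<le> ?I" "0 \<le> ?H" using C kn H by auto
    then show "0 \<le> ?I * ?H + 2 * (?f * real h ^ 2) * (\<Sum>j<r. \<theta> ^ j) + 12 * C ^ 2"
      using f sum_theta_le(3)[of r] C kn by (intro add_nonneg_nonneg mult_nonneg_nonneg) auto
  qed (use C in auto)
  also have "\<dots> = M4 C * ?H" by (simp only: M4_def ring_distribs mult_ac) 
  finally show ?thesis .
qed

end

end

end

section \<open>Dual numbers\<close>

datatype dual = Dual (dval: complex) (dder: complex)

instantiation dual :: comm_ring_1
begin
definition "0 = Dual 0 0"
definition "1 = Dual 1 0"
definition "a + b = Dual (dval a + dval b) (dder a + dder b)"
definition "a - b = Dual (dval a - dval b) (dder a - dder b)"
definition "- a = Dual (- dval a) (- dder a)"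
definition "a * b = Dual (dval a * dval b) (dder a * dval b + dval a * dder b)"
instance
  by standard (auto simp: zero_dual_def one_dual_def plus_dual_def minus_dual_def uminus_dual_def times_dual_def
      algebra_simps intro: dual.expand)
end

lemma dual_sel [simp]:
  "dval 0 = 0" "dder 0 = 0" "dval 1 = 1" "dder 1 = 0"
  "dval (a + b) = dval a + dval b" "dder (a + b) = dder a + dder b"
  "dval (a - b) = dval a - dval b" "dder (a - b) = dder a - dder b"
  "dval (- a) = - dval a" "dder (- a) = - dder a"
  "dval (a * b) = dval a * dval b" "dder (a * b) = dder a * dval b + dval a * dder b"
  by (simp_all add: zero_dual_def one_dual_def plus_dual_def minus_dual_def uminus_dual_def times_dual_def)

lemma dual_power: "dval (a ^ k) = dval a ^ k" "dder (a ^ k) = of_nat k * dval a ^ (k - 1) * dder a"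
proof (induction k)
  case (Suc k)
  { case 1 then show ?case using Suc by simp }
  { case 2 then show ?case using Suc by (cases k) (simp_all add: algebra_simps) }
qed simp_all

definition dnorm :: "dual \<Rightarrow> real" where "dnorm a = norm (dval a) + norm (dder a)"

lemma dnorm_mult: "dnorm (a * b) \<le> dnorm a * dnorm b"
proof -
  have "norm (dder a * dval b + dval a * dder b) \<le> norm (dder a) * norm (dval b) + norm (dval a) * norm (dder b)"
    using norm_triangle_ineq[of "dder a * dval b" "dval a * dder b"] by (simp add: norm_mult)
  moreover have "0 \<le> norm (dder a) * norm (dder b)" by simp
  ultimately have "norm (dder a * dval b + dval a * dder b) \<le>
      norm (dder a) * norm (dder b) + (norm (dder a) * norm (dval b) + norm (dval a) * norm (dder b))"
    by linarith
  then show ?thesis by (simp add: dnorm_def norm_mult algebra_simps)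
qed

text \<open>Evaluation of a power series and its derivative at \<open>x\<close>, the derivative being rescaled by
  its expected order of magnitude \<open>\<delta>\<^sup>-\<^sup>2\<close>, \<open>\<delta> = gap x\<close>. Dual numbers make this a ring homomorphism.\<close>
definition ev :: "complex \<Rightarrow> complex fps \<Rightarrow> dual" where
  "ev x f = Dual (eval_fps f x) (of_real (gap x ^ 2) * eval_fps (fps_deriv f) x)"

definition conv_rho :: "complex fps \<Rightarrow> bool" where
  "conv_rho f \<longleftrightarrow> fps_conv_radius f \<ge> ereal rho"

lemma conv_rho_add: "conv_rho f \<Longrightarrow> conv_rho g \<Longrightarrow> conv_rho (f + g)"
  unfolding conv_rho_def by (rule order.trans[OF _ fps_conv_radius_add]) simp

lemma conv_rho_mult: "conv_rho f \<Longrightarrow> conv_rho g \<Longrightarrow> conv_rho (f * g)"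
  unfolding conv_rho_def by (rule order.trans[OF _ fps_conv_radius_mult]) simp

lemma conv_rho_of_nat: "conv_rho (of_nat n)"
  by (simp add: conv_rho_def flip: fps_of_nat)

lemma conv_rho_0: "conv_rho 0"
  by (simp add: conv_rho_def)

lemma conv_rho_sum: "(\<And>i. i \<in> I \<Longrightarrow> conv_rho (f i)) \<Longrightarrow> conv_rho (\<Sum>i\<in>I. f i)"
  by (induction I rule: infinite_finite_induct) (auto intro: conv_rho_0 conv_rho_add)

context
  fixes x :: complex assumes x: "norm x < rho"
begin

lemma conv_rho_less: "conv_rho f \<Longrightarrow> ereal (norm x) < fps_conv_radius f"
  unfolding conv_rho_def using x by (rule less_conv_radius)

lemma conv_rho_less_deriv: "conv_rho f \<Longrightarrow> ereal (norm x) < fps_conv_radius (fps_deriv f)"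
  by (rule less_le_trans[OF conv_rho_less fps_conv_radius_deriv])

lemma ev_add: "conv_rho f \<Longrightarrow> conv_rho g \<Longrightarrow> ev x (f + g) = ev x f + ev x g"
  by (intro dual.expand) (simp add: ev_def eval_fps_add conv_rho_less conv_rho_less_deriv algebra_simps)

lemma ev_diff: "conv_rho f \<Longrightarrow> conv_rho g \<Longrightarrow> ev x (f - g) = ev x f - ev x g"
  by (intro dual.expand) (simp add: ev_def eval_fps_diff conv_rho_less conv_rho_less_deriv algebra_simps)

lemma ev_mult:
  assumes "conv_rho f" "conv_rho g"
  shows "ev x (f * g) = ev x f * ev x g"
proof -
  have "ereal (norm x) < fps_conv_radius (f * fps_deriv g)" "ereal (norm x) < fps_conv_radius (fps_deriv f * g)"
    by (rule less_le_trans[OF _ fps_conv_radius_mult]; use assms in \<open>simp add: conv_rho_less conv_rho_less_deriv\<close>)+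
  then show ?thesis
    using assms by (intro dual.expand) (simp add: ev_def eval_fps_add eval_fps_mult conv_rho_less conv_rho_less_deriv algebra_simps)
qed

lemma ev_0: "ev x 0 = 0"
  by (intro dual.expand) (simp add: ev_def)

lemma ev_1: "ev x 1 = 1"
  by (intro dual.expand) (simp add: ev_def)

lemma ev_of_nat: "ev x (of_nat n) = of_nat n"
proof (induction n)
  case (Suc n)
  have "conv_rho 1" using conv_rho_of_nat[of 1] by simp
  then show ?case using Suc ev_add[of 1 "of_nat n"] by (simp add: conv_rho_of_nat ev_1)
qed (simp add: ev_0)

lemma ev_sum: "(\<And>i. i \<in> I \<Longrightarrow> conv_rho (f i)) \<Longrightarrow> ev x (\<Sum>i\<in>I. f i) = (\<Sum>i\<in>I. ev x (f i))"
  by (induction I rule: infinite_finite_induct) (auto simp: ev_0 ev_add conv_rho_sum)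

end

text \<open>The rescaled derivative of y^k is \<delta>^2 k y' y^(k-1), of order k \<delta> |y|^(k-1)
  because \<delta> y' is bounded. The factor k \<delta> is paid for by weakening exp (-k\<delta>/2)
  to exp (-k\<delta>/10), which (1 - \<delta>/20)^k still dominates.\<close>

lemma gap_norm_dual: "\<exists>C0\<ge>1. \<forall>C\<ge>C0. \<forall>x. norm x < rho \<longrightarrow> gap_norm dnorm (ev x (cfps tree_series)) (gap x) C"
proof -
  obtain C1 where C1: "0 < C1" "\<And>x. norm x < rho \<Longrightarrow> norm (dyv x) * gap x \<le> C1"
    using dyv_bound by blast
  define Ca where "Ca = 1 + C1 * (exp 1 * (5/2))"
  define Cb where "Cb = 2 + C1 * (1 + exp 1 * (5/2))"
  define C0 where "C0 = Ca * Cb"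
  have Ca: "1 \<le> Ca" and Cb: "1 \<le> Cb" using C1(1) by (auto simp: Ca_def Cb_def)
  have C0: "1 \<le> C0" "Ca \<le> C0"
    using mult_mono[of 1 Ca 1 Cb] mult_left_mono[of 1 Cb Ca] Ca Cb by (auto simp: C0_def)
  have "gap_norm dnorm (ev x (cfps tree_series)) (gap x) C" if C: "C0 \<le> C" and x: "norm x < rho" for x C
  proof
    let ?d = "gap x" and ?t = "1 - gap x / 20" and ?y = "ev x (cfps tree_series)"
    have d: "0 < ?d" "?d \<le> 2" using gap_pos[OF x] gap_le_2[OF x] by auto
    show "0 \<le> dnorm a" for a by (simp add: dnorm_def)
    show "dnorm 0 = 0" by (simp add: dnorm_def)
    show "dnorm (a + b) \<le> dnorm a + dnorm b" for a b
      using norm_triangle_ineq[of "dval a" "dval b"] norm_triangle_ineq[of "dder a" "dder b"] by (simp add: dnorm_def)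
    show "dnorm (- a) = dnorm a" for a by (simp add: dnorm_def)
    show "dnorm (a * b) \<le> dnorm a * dnorm b" for a b by (rule dnorm_mult)
    show "0 < ?d" "?d \<le> 2" by (rule d)+
    show "1 \<le> C" using C C0 by simp
    have theta: "exp (- (real k * ?d) / 10) \<le> ?t ^ k" for k
    proof -
      have "exp (- (?d / 10)) \<le> 1 - ?d / 10 + (?d / 10) ^ 2 / 2" using d by (intro exp_minus_le_quadratic) auto
      also have "\<dots> \<le> ?t"
      proof -
        have "?d * ?d \<le> 2 * ?d" using d by (intro mult_right_mono) auto
        moreover have "(?d / 10) ^ 2 / 2 = ?d * ?d / 200" by (simp add: power2_eq_square)
        ultimately show ?thesis using d by linarith
      qed
      finally have "exp (- (?d / 10)) ^ k \<le> ?t ^ k" by (intro power_mono) auto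
      then show ?thesis by (simp flip: exp_of_nat_mult add: mult_ac)
    qed
    have t: "0 \<le> ?t ^ k" for k using d by auto
    have yk: "norm (yv x) ^ k \<le> exp (- (real k * ?d) / 2)" for k
    proof -
      have "norm (yv x) ^ k \<le> exp (- ?d / 2) ^ k" by (intro power_mono norm_yv_le_exp x) auto
      then show ?thesis by (simp flip: exp_of_nat_mult add: mult_ac)
    qed
    have dy: "?d * norm (dyv x) \<le> C1" using C1(2)[OF x] by (simp add: mult.commute)
    have inf_y: "norm (dder (?y ^ k)) = ?d * (?d * norm (dyv x)) * real k * norm (yv x) ^ (k - 1)" for k
      using d by (simp add: dual_power ev_def dyv_def norm_mult norm_power power2_eq_square mult_ac)
    have inf_le: "norm (dder (?y ^ k)) \<le> C1 * (exp 1 * (5/2)) * ?t ^ k" for k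
    proof (cases "k = 0")
      case False
      have "norm (dder (?y ^ k)) \<le> ?d * C1 * real k * exp (- (real (k - 1) * ?d) / 2)"
        unfolding inf_y using d C1(1) by (intro mult_mono dy yk) auto
      \<comment> \<open>The rate 1/2 is split as 2/5 + 1/10: the part 2/5 absorbs k \<delta> through
        t exp (-t) \<le> 1, at the price 5/2, and exp (\<delta>/2) \<le> e corrects the exponent k -
        1.\<close>
      also have "\<dots> = C1 * (exp (?d / 2) * ((real k * ?d) * exp (- (real k * ?d) * (2/5)))) * exp (- (real k * ?d) / 10)"
        using False by (simp add: of_nat_diff algebra_simps flip: exp_add) (simp add: field_simps)
      also have "\<dots> \<le> C1 * (exp 1 * (5/2)) * ?t ^ k"
      proof (intro mult_mono theta)
        show "exp (?d / 2) \<le> exp 1" using d by simp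
        have "t * exp (- t) \<le> 1" for t :: real
        proof -
          have "t \<le> exp t" using exp_ge_add_one_self[of t] by linarith
          then show ?thesis by (simp add: exp_minus field_simps)
        qed
        from this[of "real k * ?d * (2/5)"]
        show "(real k * ?d) * exp (- (real k * ?d) * (2/5)) \<le> 5/2" by simp
      qed (use C1 d in auto)
      finally show ?thesis .
    qed (use C1(1) in \<open>simp add: inf_y\<close>)
    have Ny: "dnorm (?y ^ k) \<le> Ca * ?t ^ k" for k
    proof -
      have "norm (dval (?y ^ k)) \<le> exp (- (real k * ?d) / 2)" using yk by (simp add: dual_power ev_def norm_power)
      also have "\<dots> \<le> exp (- (real k * ?d) / 10)" using d by simp
      also note theta
      finally show ?thesis using inf_le[of k] by (simp add: dnorm_def Ca_def algebra_simps)
    qed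
    show "dnorm (?y ^ k) \<le> C * ?t ^ k" for k
      using Ny[of k] mult_right_mono[of Ca C "?t ^ k"] C0 C t[of k] by simp
    show "dnorm (?y ^ k - ?y ^ (k + h)) \<le> C * ?t ^ k * min 1 (real h * ?d)" for k h
    proof -
      have "dnorm (1 - ?y ^ h) = norm (1 - yv x ^ h) + norm (dder (?y ^ h))"
        by (simp add: dnorm_def dual_power(1)) (simp add: ev_def)
      also have "\<dots> \<le> Cb * min 1 (real h * ?d)"
      proof (cases "real h * ?d \<le> 1")
        case True
        have "norm (1 - yv x ^ h) \<le> real h * ?d"
          using norm_one_minus_power_le[of "yv x" h] norm_yv_le[of x] x by (simp add: gap_def)
        moreover have "norm (dder (?y ^ h)) \<le> ?d * C1 * real h * 1"
          unfolding inf_y using d C1(1) norm_yv_le[of x] x by (intro mult_mono dy power_le_one) auto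
        moreover have "0 \<le> real h * ?d" "0 \<le> C1 * (real h * ?d)" using d C1(1) by auto
        ultimately have "norm (1 - yv x ^ h) + norm (dder (?y ^ h)) \<le> (2 + C1) * (real h * ?d)"
          by (simp add: algebra_simps)
        also have "\<dots> \<le> Cb * (real h * ?d)" using C1(1) d by (intro mult_right_mono) (auto simp: Cb_def)
        finally show ?thesis using True by simp
      next
        case False
        have "norm (1 - yv x ^ h) \<le> 1 + norm (yv x) ^ h" using norm_triangle_ineq4[of 1 "yv x ^ h"] by (simp add: norm_power)
        also have "\<dots> \<le> 2" using norm_yv_le[of x] x by (simp add: power_le_one)
        finally have "norm (1 - yv x ^ h) \<le> 2" .
        moreover have "C1 * (exp 1 * (5/2)) * ?t ^ h \<le> C1 * (exp 1 * (5/2)) * 1"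
          using C1(1) d by (intro mult_left_mono power_le_one) auto
        ultimately have "norm (1 - yv x ^ h) + norm (dder (?y ^ h)) \<le> Cb"
          using inf_le[of h] C1(1) unfolding Cb_def distrib_left mult_1_right by linarith
        then show ?thesis using False by simp
      qed
      finally have "dnorm (1 - ?y ^ h) \<le> Cb * min 1 (real h * ?d)" .
      moreover have "?y ^ k - ?y ^ (k + h) = ?y ^ k * (1 - ?y ^ h)" by (simp add: power_add algebra_simps)
      ultimately have "dnorm (?y ^ k - ?y ^ (k + h)) \<le> (Ca * ?t ^ k) * (Cb * min 1 (real h * ?d))"
        using Ca t[of k] dnorm_mult[of "?y ^ k" "1 - ?y ^ h"]
          mult_mono[OF Ny[of k], of "dnorm (1 - ?y ^ h)" "Cb * min 1 (real h * ?d)"]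
        by (auto simp: dnorm_def)
      also have "\<dots> = C0 * (?t ^ k * min 1 (real h * ?d))" by (simp add: C0_def mult_ac)
      also have "\<dots> \<le> C * (?t ^ k * min 1 (real h * ?d))"
        using C d t[of k] by (intro mult_right_mono mult_nonneg_nonneg) auto
      finally show ?thesis by (simp add: mult_ac)
    qed
  qed
  then show ?thesis using C0(1) by blast
qed

text \<open>For |x| < \<open>rho\<close> \<le> 2/5 the m-th term, even after differentiation, is at
  most of order m^9 (4/5)^m. Writing 4/5 = (16/17)(17/20), the first factor absorbs the polynomial
  and (17/20)^m is left; as m \<ge> 2r and (17/20)^2 = 0.7225 \<le> 0.81, the stated rate follows.
  The 4 in \<open>B\<close> bounds the square of the gap.\<close>

lemma twin_ev_bound:
  "\<exists>C>0. \<forall>x f r. norm x < rho \<longrightarrow> (\<forall>m. norm (fps_nth f m) \<le> real m ^ 8 * 2 ^ m) \<longrightarrow>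
     (\<forall>m<2*r. fps_nth f m = 0) \<longrightarrow> dnorm (ev x f) \<le> C * (81/100) ^ r"
proof -
  obtain K where K: "0 < K" "\<And>n. real n ^ 9 * (16/17) ^ n \<le> K"
    using power_times_geometric_bounded[of "16/17" 9] by auto
  define B where "B = (1 + 4 / rho) * K"
  have B: "0 < B" using K rho_pos by (simp add: B_def add_pos_pos)
  have "dnorm (ev x f) \<le> (B * (20/3)) * (81/100) ^ r"
    if x: "norm x < rho" and f: "\<And>m. norm (fps_nth f m) \<le> real m ^ 8 * 2 ^ m" and z: "\<And>m. m < 2 * r \<Longrightarrow> fps_nth f m = 0" for x f r
  proof -
    let ?b = "\<lambda>m. if m < 2 * r then 0 else (17/20::real) ^ m"
    have key: "real m * norm (fps_nth f m) * rho ^ m \<le> K * ?b m" for m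
    proof (cases "m < 2 * r")
      case False
      have "real m * norm (fps_nth f m) * rho ^ m \<le> real m * (real m ^ 8 * 2 ^ m) * (2/5) ^ m"
        using f rho_le rho_pos by (intro mult_mono power_mono) auto
      also have "\<dots> = real m ^ 9 * (2 * (2/5)) ^ m"
        by (simp only: power_mult_distrib) (simp add: eval_nat_numeral mult_ac)
      also have "\<dots> = (real m ^ 9 * (16/17) ^ m) * (17/20) ^ m" by (simp add: mult.assoc flip: power_mult_distrib)
      also have "\<dots> \<le> K * (17/20) ^ m" by (intro mult_right_mono K) auto
      finally show ?thesis using False by simp
    qed (simp add: z)
    have f0: "fps_nth f 0 = 0" using f[of 0] by simp
    have key0: "norm (fps_nth f m) * rho ^ m \<le> K * ?b m" for m
    proof (cases "m = 0")
      case False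
      have "1 * (norm (fps_nth f m) * rho ^ m) \<le> real m * (norm (fps_nth f m) * rho ^ m)"
        using False rho_pos by (intro mult_right_mono) auto
      then show ?thesis using key[of m] by (simp add: mult.assoc)
    qed (use f0 K in simp)
    have sg: "summable (\<lambda>m. (17/20::real) ^ m)" by simp
    have sb: "summable ?b"
      by (rule summable_comparison_test'[OF sg, of 0]) auto
    have sumb: "(\<Sum>m. ?b m) \<le> (20/3) * (81/100) ^ r"
    proof -
      have "(\<Sum>m. ?b m) = (\<Sum>m. ?b (m + 2 * r)) + (\<Sum>m<2 * r. ?b m)"
        by (rule suminf_split_initial_segment[OF sb])
      also have "(\<Sum>m<2 * r. ?b m) = 0" by simp
      also have "(\<Sum>m. ?b (m + 2 * r)) = (\<Sum>m. (17/20) ^ (2 * r) * (17/20) ^ m)"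
        by (simp add: power_add mult.commute)
      also have "\<dots> = (17/20) ^ (2 * r) * (\<Sum>m. (17/20) ^ m)" by (rule suminf_mult[OF sg])
      also have "(\<Sum>m. (17/20::real) ^ m) = 20/3" by (subst suminf_geometric) auto
      also have "(17/20::real) ^ (2 * r) = ((17/20) ^ 2) ^ r" by (simp add: power_mult)
      also have "((17/20::real) ^ 2) ^ r \<le> (81/100) ^ r" by (intro power_mono) (auto simp: power2_eq_square)
      finally show ?thesis by simp
    qed
    have s1: "summable (\<lambda>m. norm (fps_nth f m) * rho ^ m)"
      by (rule summable_comparison_test'[OF summable_mult[OF sb, of K], of 0]) (use key0 rho_pos in simp)
    have "norm (eval_fps f x) \<le> (\<Sum>m. norm (fps_nth f m) * rho ^ m)"
      using x by (intro norm_eval_fps_le s1) simp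
    also have "\<dots> \<le> (\<Sum>m. K * ?b m)" by (intro suminf_le key0 s1 summable_mult sb)
    finally have e1: "norm (eval_fps f x) \<le> K * (\<Sum>m. ?b m)" by (simp only: suminf_mult[OF sb])
    have le2: "norm (fps_nth (fps_deriv f) m) * rho ^ m \<le> K / rho * ?b (Suc m)" for m
      using key[of "Suc m"] rho_pos by (simp add: norm_mult field_simps del: of_nat_Suc)
    have sb': "summable (\<lambda>m. ?b (Suc m))" using sb by (subst summable_Suc_iff)
    have s2: "summable (\<lambda>m. norm (fps_nth (fps_deriv f) m) * rho ^ m)"
      by (rule summable_comparison_test'[OF summable_mult[OF sb', of "K / rho"], of 0]) (use le2 rho_pos in simp)
    have "norm (eval_fps (fps_deriv f) x) \<le> (\<Sum>m. norm (fps_nth (fps_deriv f) m) * rho ^ m)"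
      using x by (intro norm_eval_fps_le s2) simp
    also have "\<dots> \<le> (\<Sum>m. K / rho * ?b (Suc m))" by (intro suminf_le le2 s2 summable_mult sb')
    also have "\<dots> = K / rho * (\<Sum>m. ?b (Suc m))" by (rule suminf_mult[OF sb'])
    also have "\<dots> \<le> K / rho * (\<Sum>m. ?b m)"
    proof (rule mult_left_mono)
      have "?b 0 \<ge> 0" by simp
      then show "(\<Sum>m. ?b (Suc m)) \<le> (\<Sum>m. ?b m)"
        using suminf_split_head[OF sb] by linarith
    qed (use K rho_pos in auto)
    finally have e2: "norm (eval_fps (fps_deriv f) x) \<le> K / rho * (\<Sum>m. ?b m)" .
    have "dnorm (ev x f) \<le> K * (\<Sum>m. ?b m) + 4 * (K / rho * (\<Sum>m. ?b m))"
      unfolding dnorm_def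
    proof (intro add_mono)
      show "norm (dval (ev x f)) \<le> K * (\<Sum>m. ?b m)" using e1 by (simp add: ev_def)
      have "gap x ^ 2 \<le> 2 ^ 2" using gap_le_2[OF x] gap_nonneg by (intro power_mono)
      then have "gap x ^ 2 * norm (eval_fps (fps_deriv f) x) \<le> 4 * (K / rho * (\<Sum>m. ?b m))"
        by (intro mult_mono e2) auto
      then show "norm (dder (ev x f)) \<le> 4 * (K / rho * (\<Sum>m. ?b m))"
        by (simp add: ev_def norm_mult norm_power)
    qed
    also have "\<dots> = B * (\<Sum>m. ?b m)" by (simp add: B_def algebra_simps)
    also have "\<dots> \<le> B * ((20/3) * (81/100) ^ r)" using B sumb by (intro mult_left_mono) auto
    finally show ?thesis by simp
  qed
  then show ?thesis using B by (intro exI[of _ "B * (20/3)"]) auto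
qed

section \<open>Level sizes and their moment series\<close>

lemma lev_le_tsize: "lev T k \<le> tsize T"
proof (induction T arbitrary: k)
  case (Node M)
  show ?case
  proof (cases k)
    case (Suc j)
    have "(\<Sum>S\<in>#M. lev S j) \<le> (\<Sum>S\<in>#M. tsize S)"
      by (intro sum_mset_mono) (use Node in auto)
    then show ?thesis by (simp add: Suc image_mset.compositionality o_def)
  qed simp
qed

lemma lev_eq_0: "tsize T \<le> k \<Longrightarrow> lev T k = 0"
proof (induction T arbitrary: k)
  case (Node M)
  show ?case
  proof (cases k)
    case 0
    then show ?thesis using Node.prems by simp
  next
    case (Suc j)
    have "lev S j = 0" if "S \<in># M" for S
    proof (rule Node.IH[OF that])
      have "tsize S \<le> (\<Sum>S\<in>#M. tsize S)" using multi_member_split[OF that] by auto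
      then show "tsize S \<le> j" using Node.prems Suc by simp
    qed
    then show ?thesis by (simp add: Suc image_mset.compositionality o_def)
  qed
qed

definition ldiff :: "nat \<Rightarrow> nat \<Rightarrow> utree \<Rightarrow> complex" where
  "ldiff h r T = of_nat (lev T r) - of_nat (lev T (r + h))"

definition llev :: "nat \<Rightarrow> utree \<Rightarrow> complex" where
  "llev r T = of_nat (lev T r)"

lemma llev_Suc: "llev (Suc r) T = (\<Sum>S\<in>#children T. llev r S)"
  by (simp add: llev_def lev_Suc of_nat_sum_mset image_mset.compositionality o_def)

lemma ldiff_conv: "ldiff h r T = llev r T - llev (r + h) T"
  by (simp add: ldiff_def llev_def)

lemma ldiff_Suc: "ldiff h (Suc r) T = (\<Sum>S\<in>#children T. ldiff h r S)"
proof -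
  have "llev (Suc r) T = (\<Sum>S\<in>#children T. ldiff h r S + llev (r + h) S)"
    by (simp add: llev_Suc ldiff_conv)
  also have "\<dots> = (\<Sum>S\<in>#children T. ldiff h r S) + llev (Suc r + h) T"
    by (simp add: llev_Suc sum_mset.distrib)
  finally show ?thesis by (simp add: ldiff_conv)
qed

lemma norm_ldiff_le: "norm (ldiff h r T) \<le> real (tsize T)" "tsize T \<le> r \<Longrightarrow> ldiff h r T = 0"
  and norm_llev_le: "norm (llev r T) \<le> real (tsize T)" "tsize T \<le> r \<Longrightarrow> llev r T = 0"
proof -
  have "ldiff h r T = of_real (real (lev T r) - real (lev T (r + h)))" by (simp add: ldiff_def)
  then have "norm (ldiff h r T) = \<bar>real (lev T r) - real (lev T (r + h))\<bar>" by (simp only: norm_of_real)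
  then show "norm (ldiff h r T) \<le> real (tsize T)"
    using lev_le_tsize[of T r] lev_le_tsize[of T "r + h"] by simp
  show "ldiff h r T = 0" if "tsize T \<le> r" using that by (simp add: ldiff_def lev_eq_0)
  show "norm (llev r T) \<le> real (tsize T)" using lev_le_tsize[of T r] by (simp add: llev_def)
  show "llev r T = 0" if "tsize T \<le> r" using that by (simp add: llev_def lev_eq_0)
qed

lemma conv_rho_tree_gf:
  assumes "\<And>T. norm (f T) \<le> real (tsize T)"
  shows "conv_rho (tree_gf (\<lambda>T. f T ^ k))"
  unfolding conv_rho_def
proof (rule fps_conv_radius_tree[where K = 1 and p = k])
  fix n
  have "norm (f T ^ k) \<le> real n ^ k" if "T \<in> trees n" for T
    using power_mono[OF assms[of T], of k] that by (simp add: norm_power trees_def)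
  then have "norm (\<Sum>T\<in>trees n. f T ^ k) \<le> (\<Sum>T\<in>trees n. real n ^ k)"
    by (rule sum_norm_le)
  then show "norm (fps_nth (tree_gf (\<lambda>T. f T ^ k)) n) \<le> 1 * real n ^ k * real (card (trees n))"
    by (simp add: tree_gf_def mult.commute)
qed simp

text \<open>The summand is of degree 2l + 1 \<le> 7 in m, and counting the twins adds one more
  power. A subtree with f \<noteq> 0 has more than r vertices, so two copies of it exceed
  2r.\<close>

lemma twin_moment_bounds:
  assumes f: "\<And>T. norm (f T) \<le> real (tsize T)" and z: "\<And>T. tsize T \<le> r \<Longrightarrow> f T = 0" and l: "l \<le> 3"
  shows "norm (fps_nth (twin_gf (\<lambda>S j. of_nat j ^ l * f S ^ Suc l)) m) \<le> real m ^ 8 * 2 ^ m"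
    "m < 2 * r \<Longrightarrow> fps_nth (twin_gf (\<lambda>S j. of_nat j ^ l * f S ^ Suc l)) m = (0::complex)"
proof -
  have "norm (fps_nth (twin_gf (\<lambda>S j. of_nat j ^ l * f S ^ Suc l)) m) \<le> real m ^ 7 * (real m * 2 ^ m)"
  proof (rule twin_gf_nth_le)
    fix S j assume "(S, j) \<in> copies m"
    then have m: "j * tsize S = m" "0 < j" by (auto simp: copies_def)
    then have "j \<le> m" "tsize S \<le> m" "1 \<le> m"
      using tsize_pos[of S] by (auto simp: Suc_leI)
    have "norm (of_nat j ^ l * f S ^ Suc l) = real j ^ l * norm (f S) ^ Suc l" by (simp add: norm_mult norm_power)
    also have "\<dots> \<le> real m ^ l * real m ^ Suc l"
    proof (intro mult_mono power_mono)
      show "norm (f S) \<le> real m" using f[of S] \<open>tsize S \<le> m\<close> by (simp add: order.trans)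
    qed (use \<open>j \<le> m\<close> in auto)
    also have "\<dots> = real m ^ (l + Suc l)" by (simp only: power_add)
    also have "\<dots> \<le> real m ^ 7" using \<open>1 \<le> m\<close> l by (intro power_increasing) auto
    finally show "norm (of_nat j ^ l * f S ^ Suc l) \<le> real m ^ 7" .
  qed simp
  also have "\<dots> = real m ^ 8 * 2 ^ m" by (simp add: eval_nat_numeral)
  finally show "norm (fps_nth (twin_gf (\<lambda>S j. of_nat j ^ l * f S ^ Suc l)) m) \<le> real m ^ 8 * 2 ^ m" .
  assume m: "m < 2 * r"
  have "f S = 0" if "(S, j) \<in> copies m" "2 \<le> j" for S j
  proof (rule z)
    have "2 * tsize S \<le> j * tsize S" using that by (intro mult_right_mono) auto
    moreover have "j * tsize S = m" using that by (simp add: copies_def)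
    ultimately show "tsize S \<le> r" using m by linarith
  qed
  then show "fps_nth (twin_gf (\<lambda>S j. of_nat j ^ l * f S ^ Suc l)) m = (0::complex)"
    by (auto simp: twin_gf_def copies_gf_def intro!: sum.neutral)
qed

lemma conv_rho_twin:
  assumes "\<And>m. norm (fps_nth f m) \<le> real m ^ 8 * 2 ^ m"
  shows "conv_rho f"
proof -
  have "ereal rho \<le> ereal (1/2)" using rho_le by simp
  also have "\<dots> \<le> fps_conv_radius f"
    by (rule fps_conv_radius_twin[where K = 1 and p = 8]) (use assms in simp)
  finally show ?thesis by (simp add: conv_rho_def)
qed

text \<open>The marking identity for powers, evaluated at x. Single copies give the moment one level
  lower, repeated ones the error; its weight j^(k-1) is the j^l of that identity with k = l +
  1.\<close>

lemma moment_system_ev: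
  assumes gn: "gap_norm dnorm (ev x (cfps tree_series)) (gap x) C" and x: "norm x < rho"
    and twinC: "\<And>f r. (\<And>m. norm (fps_nth f m) \<le> real m ^ 8 * 2 ^ m) \<Longrightarrow> (\<And>m. m < 2 * r \<Longrightarrow> fps_nth f m = 0) \<Longrightarrow> dnorm (ev x f) \<le> C * (81/100) ^ r"
    and F: "\<And>r T. norm (F r T) \<le> real (tsize T)" "\<And>r T. tsize T \<le> r \<Longrightarrow> F r T = 0"
    and rec: "\<And>r T. F (Suc r) T = (\<Sum>S\<in>#children T. F r S)"
  shows "gap_norm.moment_system dnorm (ev x (cfps tree_series)) C (\<lambda>k r. ev x (tree_gf (\<lambda>T. F r T ^ k)))
     (\<lambda>k r. ev x (twin_gf (\<lambda>S j. of_nat j ^ (k - 1) * F r S ^ k)))"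
proof -
  interpret gap_norm dnorm "ev x (cfps tree_series)" "gap x" C by (rule gn)
  have twin: "conv_rho (twin_gf (\<lambda>S j. of_nat j ^ l * F r S ^ Suc l))" if "l \<le> 3" for l r
    by (rule conv_rho_twin, rule twin_moment_bounds(1)[where f = "F r" and r = r]) (use F that in auto)
  have tree: "conv_rho (tree_gf (\<lambda>T. F r T ^ k))" for k r by (rule conv_rho_tree_gf) (rule F)
  have "ev x (tree_gf (\<lambda>T. F r T ^ 0)) = ev x (cfps tree_series)" for r
  proof -
    have "tree_gf (\<lambda>T. F r T ^ 0) = cfps tree_series" by (rule fps_ext) (simp add: tree_gf_def tree_series_nth)
    then show ?thesis by simp
  qed
  moreover have "ev x (tree_gf (\<lambda>T. F (Suc r) T ^ Suc k)) =
      (\<Sum>l\<le>k. of_nat (k choose l) * (ev x (tree_gf (\<lambda>T. F (Suc r) T ^ (k - l))) *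
         (ev x (tree_gf (\<lambda>T. F r T ^ Suc l)) + ev x (twin_gf (\<lambda>S j. of_nat j ^ (Suc l - 1) * F r S ^ Suc l)))))" if "k \<le> 3" for k r
  proof -
    have cp: "copies_gf (\<lambda>S j. of_nat j ^ l * F r S ^ Suc l) = tree_gf (\<lambda>T. F r T ^ Suc l) + twin_gf (\<lambda>S j. of_nat j ^ l * F r S ^ Suc l)" for l
      by (subst copies_gf_split) simp
    show ?thesis
      unfolding tree_gf_additive_power[where D = "F (Suc r)" and d = "F r", OF rec] cp
      using that twin
      by (subst ev_sum[OF x])
         (auto simp: ev_mult[OF x] ev_add[OF x] ev_of_nat[OF x] conv_rho_mult conv_rho_add conv_rho_of_nat tree simp del: power_Suc
            intro!: sum.cong)
  qed
  moreover have "dnorm (ev x (twin_gf (\<lambda>S j. of_nat j ^ (k - 1) * F r S ^ k))) \<le> C * q ^ r" if k: "1 \<le> k" "k \<le> 4" for k r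
  proof -
    have k': "k - 1 \<le> 3" "Suc (k - 1) = k" using k by auto
    show ?thesis unfolding q_def
    proof (rule twinC)
      fix m
      have *: "\<And>T. norm (F r T) \<le> real (tsize T)" "\<And>T. tsize T \<le> r \<Longrightarrow> F r T = 0" using F by auto
      note b = twin_moment_bounds[of "F r" r "k - 1", OF *(1) *(2) k'(1), unfolded k'(2)]
      show "norm (fps_nth (twin_gf (\<lambda>S j. of_nat j ^ (k - 1) * F r S ^ k)) m) \<le> real m ^ 8 * 2 ^ m"
        by (rule b)
      show "fps_nth (twin_gf (\<lambda>S j. of_nat j ^ (k - 1) * F r S ^ k)) m = 0" if "m < 2 * r"
        by (rule b(2)) (use that in auto)
    qed
  qed
  ultimately show ?thesis unfolding moment_system_def by blast
qed

lemma tree_gf_add: "tree_gf (\<lambda>T. f T + g T) = tree_gf f + tree_gf g"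
  and tree_gf_diff: "tree_gf (\<lambda>T. f T - g T) = tree_gf f - tree_gf g"
  by (rule fps_ext, simp add: tree_gf_def sum.distrib sum_subtractf)+

lemma tree_gf_of_nat_mult: "tree_gf (\<lambda>T. of_nat c * f T) = of_nat c * tree_gf f"
proof (rule fps_ext)
  fix n
  have "fps_nth (of_nat c * tree_gf f) n = of_nat c * fps_nth (tree_gf f) n"
    by (metis fps_mult_left_const_nth fps_of_nat)
  then show "fps_nth (tree_gf (\<lambda>T. of_nat c * f T)) n = fps_nth (of_nat c * tree_gf f) n"
    by (simp add: tree_gf_def sum_distrib_left)
qed

lemma fourth_moment_ev_bound:
  "\<exists>M\<ge>0. \<forall>x h r. norm x < rho \<longrightarrow> 1 \<le> h \<longrightarrow> dnorm (ev x (tree_gf (\<lambda>T. ldiff h r T ^ 4))) \<le> M * (real h ^ 2 / gap x)"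
proof -
  obtain C0 where C0: "1 \<le> C0" "\<And>C x. C0 \<le> C \<Longrightarrow> norm x < rho \<Longrightarrow> gap_norm dnorm (ev x (cfps tree_series)) (gap x) C"
    using gap_norm_dual by blast
  obtain C1 where C1: "0 < C1" "\<And>x f r. norm x < rho \<Longrightarrow> (\<And>m. norm (fps_nth f m) \<le> real m ^ 8 * 2 ^ m) \<Longrightarrow>
     (\<And>m. m < 2 * r \<Longrightarrow> fps_nth f m = 0) \<Longrightarrow> dnorm (ev x f) \<le> C1 * (81/100) ^ r"
    using twin_ev_bound by blast
  define C where "C = max C0 C1"
  have "dnorm (ev x (tree_gf (\<lambda>T. ldiff h r T ^ 4))) \<le> M4 C * (real h ^ 2 / gap x)" if x: "norm x < rho" and h: "1 \<le> h" for x h r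
  proof -
    have gn: "gap_norm dnorm (ev x (cfps tree_series)) (gap x) C" using x by (intro C0) (auto simp: C_def)
    interpret gap_norm dnorm "ev x (cfps tree_series)" "gap x" C by (rule gn)
    have tw: "dnorm (ev x f) \<le> C * (81/100) ^ r" if "\<And>m. norm (fps_nth f m) \<le> real m ^ 8 * 2 ^ m" "\<And>m. m < 2 * r \<Longrightarrow> fps_nth f m = 0" for f r
    proof -
      have "C1 * (81/100) ^ r \<le> C * (81/100) ^ r" by (intro mult_right_mono) (auto simp: C_def)
      moreover have "dnorm (ev x f) \<le> C1 * (81/100) ^ r" by (rule C1(2)[OF x]) (use that in auto)
      ultimately show ?thesis by linarith
    qed
    let ?L = "\<lambda>k r. ev x (tree_gf (\<lambda>T. llev r T ^ k))" and ?A = "\<lambda>k r. ev x (tree_gf (\<lambda>T. ldiff h r T ^ k))"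
    have cl: "conv_rho (tree_gf (\<lambda>T. llev r T ^ k))" for k r by (rule conv_rho_tree_gf) (rule norm_llev_le)
    have cY: "conv_rho (cfps tree_series)" by (simp add: conv_rho_def cY_radius)
    have Yt: "cfps tree_series = tree_gf (\<lambda>T. 1)" by (rule fps_ext) (simp add: tree_gf_def tree_series_nth)
    have l0: "llev 0 T = 1" for T by (simp add: llev_def)
    \<comment> \<open>Level 0 consists of the root alone, so the moments of the difference at r = 0
      are binomial expansions in the moments of level h.\<close>
    have d0: "ldiff h 0 T = 1 - llev h T" for T by (simp add: ldiff_conv l0)
    have evn: "ev x (of_nat c * f) = of_nat c * ev x f" if "conv_rho f" for c f
      using that by (simp add: ev_mult[OF x] ev_of_nat[OF x] conv_rho_of_nat)
    have cn: "conv_rho (of_nat c * f)" if "conv_rho f" for c f using that by (intro conv_rho_mult conv_rho_of_nat)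
    have cd: "conv_rho (f - g)" if "conv_rho f" "conv_rho g" for f g
      using that unfolding conv_rho_def by (intro order.trans[OF _ fps_conv_radius_diff]) simp
    have 1: "moment_system ?L (\<lambda>k r. ev x (twin_gf (\<lambda>S j. of_nat j ^ (k - 1) * llev r S ^ k)))"
      by (rule moment_system_ev[where F = llev, OF gn x tw norm_llev_le(1) norm_llev_le(2) llev_Suc])
    have 2: "moment_system ?A (\<lambda>k r. ev x (twin_gf (\<lambda>S j. of_nat j ^ (k - 1) * ldiff h r S ^ k)))"
      by (rule moment_system_ev[where F = "ldiff h", OF gn x tw norm_ldiff_le(1) norm_ldiff_le(2) ldiff_Suc])
    show ?thesis
    proof (rule A4[OF 1 _ 2 h])
      show "?L k 0 = ev x (cfps tree_series)" for k by (simp add: l0 Yt)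
      show "?A 1 r = ?L 1 r - ?L 1 (r + h)" for r
        using cl[of r 1] cl[of "r + h" 1] by (simp add: ldiff_conv tree_gf_diff ev_diff[OF x])
      have "tree_gf (\<lambda>T. ldiff h 0 T ^ 2) = cfps tree_series - of_nat 2 * tree_gf (\<lambda>T. llev h T ^ 1) + tree_gf (\<lambda>T. llev h T ^ 2)"
        unfolding Yt tree_gf_of_nat_mult[symmetric] tree_gf_add[symmetric] tree_gf_diff[symmetric]
        by (intro arg_cong[where f = tree_gf] ext) (simp add: d0 power2_eq_square algebra_simps)
      then have "?A 2 0 = ev x (cfps tree_series) - of_nat 2 * ?L 1 h + ?L 2 h"
        by (simp only: ev_add[OF x] ev_diff[OF x] evn cn cd conv_rho_add cl cY)
      then show "?A 2 0 = ev x (cfps tree_series) - 2 * ?L 1 h + ?L 2 h" by simp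
      have "tree_gf (\<lambda>T. ldiff h 0 T ^ 3) = cfps tree_series - of_nat 3 * tree_gf (\<lambda>T. llev h T ^ 1) + of_nat 3 * tree_gf (\<lambda>T. llev h T ^ 2) - tree_gf (\<lambda>T. llev h T ^ 3)"
        unfolding Yt tree_gf_of_nat_mult[symmetric] tree_gf_add[symmetric] tree_gf_diff[symmetric]
        by (intro arg_cong[where f = tree_gf] ext) (simp add: d0 power2_eq_square power3_eq_cube algebra_simps)
      then have "?A 3 0 = ev x (cfps tree_series) - of_nat 3 * ?L 1 h + of_nat 3 * ?L 2 h - ?L 3 h"
        by (simp only: ev_add[OF x] ev_diff[OF x] evn cn cd conv_rho_add cl cY)
      then show "?A 3 0 = ev x (cfps tree_series) - 3 * ?L 1 h + 3 * ?L 2 h - ?L 3 h" by simp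
      have "tree_gf (\<lambda>T. ldiff h 0 T ^ 4) = cfps tree_series - of_nat 4 * tree_gf (\<lambda>T. llev h T ^ 1) + of_nat 6 * tree_gf (\<lambda>T. llev h T ^ 2) - of_nat 4 * tree_gf (\<lambda>T. llev h T ^ 3) + tree_gf (\<lambda>T. llev h T ^ 4)"
        unfolding Yt tree_gf_of_nat_mult[symmetric] tree_gf_add[symmetric] tree_gf_diff[symmetric]
        by (intro arg_cong[where f = tree_gf] ext) (simp add: d0 power4_eq_xxxx power2_eq_square power3_eq_cube algebra_simps)
      then have "?A 4 0 = ev x (cfps tree_series) - of_nat 4 * ?L 1 h + of_nat 6 * ?L 2 h - of_nat 4 * ?L 3 h + ?L 4 h"
        by (simp only: ev_add[OF x] ev_diff[OF x] evn cn cd conv_rho_add cl cY)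
      then show "?A 4 0 = ev x (cfps tree_series) - 4 * ?L 1 h + 6 * ?L 2 h - 4 * ?L 3 h + ?L 4 h" by simp
    qed
  qed
  moreover have "0 \<le> M4 C" using C0 by (intro constants_nonneg) (auto simp: C_def)
  ultimately show ?thesis by blast
qed

section \<open>Coefficient extraction\<close>

lemma sin_ge_third:
  assumes "0 \<le> x" "x \<le> pi / 2"
  shows "x / 3 \<le> sin (x::real)"
proof -
  have x2: "x \<le> 2" using assms(2) pi_less_4 by simp
  have "\<bar>sin x - (\<Sum>m<3. sin_coeff m * x ^ m)\<bar> \<le> inverse (fact 3) * \<bar>x\<bar> ^ 3"
    by (rule Maclaurin_sin_bound)
  then have 1: "\<bar>sin x - x\<bar> \<le> x ^ 3 / 6"
    using assms(1) by (simp add: eval_nat_numeral sin_coeff_def)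
  have "x ^ 3 = x * (x * x)" by (simp add: power3_eq_cube)
  also have "\<dots> \<le> x * (2 * 2)" using assms(1) x2 by (intro mult_left_mono mult_mono) auto
  finally have "x ^ 3 / 6 \<le> 2 * x / 3" by simp
  then show ?thesis using 1 by linarith
qed

text \<open>|1 - s exp (2ia)|^2 = (1 - s)^2 + 4 s (sin a)^2 with a = \<pi> j/n. The radial part
  gives 1/(2n), the angular part a multiple of m/n, where m counts the steps from 1 along the
  shorter arc.\<close>

lemma norm_one_minus_circle_ge:
  fixes n j :: nat
  assumes n: "0 < n" and j: "j < n"
  defines "z \<equiv> of_real (real n / real (Suc n)) * cis (2 * pi * real j / real n)"
  shows "(1 + real (min j (n - j))) / (4 * real n) \<le> norm (1 - z)"
proof -
  define s where "s = real n / real (Suc n)"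
  define m where "m = min j (n - j)"
  have s: "1/2 \<le> s" "s \<le> 1" "1 - s = 1 / real (Suc n)" using n by (auto simp: s_def field_simps)
  have nz: "norm z = s" unfolding z_def s_def[symmetric] norm_mult norm_of_real norm_cis using s by simp
  have "1 / (2 * real n) \<le> 1 / real (Suc n)" using n by (intro divide_left_mono) auto
  then have 1: "1 / (2 * real n) \<le> norm (1 - z)"
    using norm_triangle_ineq2[of 1 z] nz s(3) by simp
  have sin_eq: "sin (pi * real j / real n) = sin (pi * real m / real n)"
  proof (cases "j \<le> n - j")
    case False
    have "pi * real m / real n = pi - pi * real j / real n"
      using False j n by (simp add: m_def of_nat_diff field_simps)
    then show ?thesis by simp
  qed (simp add: m_def)
  have "pi * real m / real n \<le> pi / 2"
  proof -
    have "2 * m \<le> n" by (auto simp: m_def)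
    then have "2 * real m \<le> real n" by linarith
    then have "pi * (2 * real m) \<le> pi * real n" by (intro mult_left_mono) auto
    then show ?thesis using n by (simp add: field_simps)
  qed
  then have "pi * real m / real n / 3 \<le> sin (pi * real m / real n)"
    by (intro sin_ge_third) auto
  moreover have "2 * (real m / real n) / 3 \<le> pi * (real m / real n) / 3"
    using pi_ge_two by (intro divide_right_mono mult_right_mono) auto
  ultimately have sinl: "2 * (real m / real n) / 3 \<le> sin (pi * real j / real n)"
    unfolding sin_eq by simp
  have "norm (1 - z) ^ 2 = (1 - s * cos (2 * pi * real j / real n)) ^ 2 + (s * sin (2 * pi * real j / real n)) ^ 2"
    by (simp add: cmod_power2 z_def s_def)
  also have "\<dots> = 1 - 2 * s * cos (2 * (pi * real j / real n)) + s ^ 2 * ((cos (2 * pi * real j / real n)) ^ 2 + (sin (2 * pi * real j / real n)) ^ 2)"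
  proof -
    have "(1 - s * a) ^ 2 + (s * b) ^ 2 = 1 - 2 * s * a + s ^ 2 * (a ^ 2 + b ^ 2)" for a b :: real
      by (simp add: power2_eq_square algebra_simps)
    then show ?thesis by (simp only: mult.assoc times_divide_eq_right)
  qed
  also have "\<dots> = 1 - 2 * s * cos (2 * (pi * real j / real n)) + s ^ 2"
    by (simp only: sin_cos_squared_add2 mult_1_right)
  also have "\<dots> = (1 - s) ^ 2 + 4 * s * sin (pi * real j / real n) ^ 2"
    unfolding cos_double_sin by (simp add: power2_eq_square algebra_simps)
  finally have sq: "norm (1 - z) ^ 2 = (1 - s) ^ 2 + 4 * s * sin (pi * real j / real n) ^ 2" .
  have "1 * sin (pi * real j / real n) ^ 2 \<le> 4 * s * sin (pi * real j / real n) ^ 2"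
    using s by (intro mult_right_mono) auto
  then have "sin (pi * real j / real n) ^ 2 \<le> norm (1 - z) ^ 2"
    unfolding sq using zero_le_power2[of "1 - s"] by linarith
  then have "sin (pi * real j / real n) \<le> norm (1 - z)"
    by (rule power2_le_imp_le) simp
  then have 2: "2 * (real m / real n) / 3 \<le> norm (1 - z)" using sinl by simp
  have "(1 + real m) / (4 * real n) = (1 / (2 * real n)) / 2 + (real m / real n) / 4"
    using n by (simp add: field_simps)
  also have "\<dots> \<le> norm (1 - z) / 2 + norm (1 - z) / 2"
  proof (rule add_mono)
    have "t / 4 \<le> u / 2" if "0 \<le> t" "2 * t / 3 \<le> u" for t u :: real using that by simp
    from this[OF _ 2] show "(real m / real n) / 4 \<le> norm (1 - z) / 2" by simp
  qed (use 1 in simp)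
  finally show ?thesis by (simp add: m_def)
qed

text \<open>Up to the factor n^(3/2), this bounds \<delta>^(-3) at the i-th point of the circle
  counted from the real axis. It is summable because 3/2 > 1.\<close>

definition three_halves :: "nat \<Rightarrow> real" where "three_halves i = 1 / sqrt (1 + real i) ^ 3"

lemma three_halves_nonneg: "0 \<le> three_halves i"
  by (simp add: three_halves_def)

lemma summable_f32: "summable three_halves"
proof -
  have "summable (\<lambda>n. real (Suc n) powr (-3/2))"
    by (subst summable_Suc_iff[of "\<lambda>n. real n powr (-3/2)"]) (simp add: summable_real_powr_iff)
  moreover have "real (Suc n) powr (-3/2) = three_halves n" for n
  proof -
    have "real (Suc n) powr (-3/2) = inverse (real (Suc n) powr (1/2 * 3))"
      by (simp add: powr_minus[symmetric])
    also have "real (Suc n) powr (1/2 * 3) = (real (Suc n) powr (1/2)) powr 3"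
      by (simp only: powr_powr)
    also have "\<dots> = sqrt (real (Suc n)) ^ 3"
      by (simp add: powr_half_sqrt)
    finally show ?thesis by (simp add: three_halves_def inverse_eq_divide)
  qed
  ultimately show ?thesis by simp
qed

lemma sum_f32_min_le: "(\<Sum>j<n. three_halves (min j (n - j))) \<le> 2 * (\<Sum>i. three_halves i)"
proof -
  have "(\<Sum>j<n. three_halves (min j (n - j))) \<le> (\<Sum>j<n. three_halves j + three_halves (n - j))"
    by (intro sum_mono) (auto simp: min_def three_halves_nonneg)
  also have "\<dots> = (\<Sum>j<n. three_halves j) + (\<Sum>j<n. three_halves (n - j))" by (simp add: sum.distrib)
  also have "(\<Sum>j<n. three_halves (n - j)) = (\<Sum>j\<in>{1..n}. three_halves j)"
    by (rule sum.reindex_bij_witness[where i = "\<lambda>j. n - j" and j = "\<lambda>j. n - j"]) auto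
  also have "(\<Sum>j<n. three_halves j) \<le> (\<Sum>i. three_halves i)"
    by (intro sum_le_suminf summable_f32) (auto simp: three_halves_nonneg)
  also have "(\<Sum>j\<in>{1..n}. three_halves j) \<le> (\<Sum>i. three_halves i)"
    by (intro sum_le_suminf summable_f32) (auto simp: three_halves_nonneg)
  finally show ?thesis by simp
qed

lemma sum_roots_of_unity_nonneg:
  fixes n m :: nat
  assumes "0 < n"
  shows "(\<Sum>j<n. cis (2 * pi * real j / real n) ^ m) = (if n dvd m then of_nat n else 0)"
proof -
  have eq: "(\<Sum>j<n. cis (2 * pi * real j / real n) ^ m) = (\<Sum>j<n. cis (2 * pi * real m / real n) ^ j)"
    unfolding Complex.DeMoivre by (intro sum.cong refl arg_cong[where f = cis]) simp
  have p: "cis (2 * pi * real m / real n) ^ n = 1"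
    unfolding Complex.DeMoivre using assms cis_multiple_2pi[of "real m"] by simp
  have "cis (2 * pi * real m / real n) = 1 \<longleftrightarrow> n dvd m"
  proof
    assume "n dvd m"
    then obtain k where "m = n * k" by blast
    then show "cis (2 * pi * real m / real n) = 1" using assms cis_multiple_2pi[of "real k"] by (simp add: mult.assoc)
  next
    assume "cis (2 * pi * real m / real n) = 1"
    then have "cos (2 * pi * real m / real n) = 1" by (metis cis.simps(1) one_complex.simps(1))
    then obtain k :: int where "2 * pi * real m / real n = real_of_int k * 2 * pi"
      using cos_one_2pi_int by auto
    then have "real m = real_of_int k * real n" using assms by (simp add: field_simps)
    then have "int m = k * int n" by (metis of_int_eq_iff of_int_mult of_int_of_nat_eq)
    then show "n dvd m" by (metis dvd_triv_right int_dvd_int_iff)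
  qed
  then show ?thesis unfolding eq by (subst sum_gp_strict) (simp add: p)
qed

text \<open>Averaging over the \<open>n\<close>-th roots of unity keeps all coefficients whose index is a multiple of
  \<open>n\<close>; as they are nonnegative, this is enough.\<close>
lemma coeff_le_roots_of_unity_average:
  fixes a :: "nat \<Rightarrow> real" and R :: real
  assumes a: "\<And>m. 0 \<le> a m" and R: "0 \<le> R" and n: "0 < n"
    and conv_rho: "\<And>w. norm w = 1 \<Longrightarrow> (\<lambda>m. of_real (a m) * (of_real R * w) ^ m) sums g (of_real R * w)"
  shows "real n * (a n * R ^ n) \<le> (\<Sum>j<n. norm (g (of_real R * cis (2 * pi * real j / real n)) :: complex))"
proof -
  let ?w = "\<lambda>j. cis (2 * pi * real j / real n)"
  have "(\<lambda>m. \<Sum>j<n. of_real (a m) * (of_real R * ?w j) ^ m) sums (\<Sum>j<n. g (of_real R * ?w j))"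
    by (intro sums_sum conv_rho) simp
  moreover have "(\<Sum>j<n. of_real (a m) * (of_real R * ?w j) ^ m) = complex_of_real (if n dvd m then real n * (a m * R ^ m) else 0)" for m
  proof -
    have "(\<Sum>j<n. of_real (a m) * (of_real R * ?w j) ^ m) = of_real (a m * R ^ m) * (\<Sum>j<n. ?w j ^ m)"
      by (simp add: power_mult_distrib sum_distrib_left mult_ac)
    then show ?thesis unfolding sum_roots_of_unity_nonneg[OF n] by simp
  qed
  ultimately have "(\<lambda>m. complex_of_real (if n dvd m then real n * (a m * R ^ m) else 0)) sums (\<Sum>j<n. g (of_real R * ?w j))"
    by simp
  then have sm: "(\<lambda>m. if n dvd m then real n * (a m * R ^ m) else 0) sums Re (\<Sum>j<n. g (of_real R * ?w j))"
    by (drule_tac sums_Re) simp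
  then have "(\<Sum>m\<in>{n}. if n dvd m then real n * (a m * R ^ m) else 0) \<le> Re (\<Sum>j<n. g (of_real R * ?w j))"
    unfolding sums_unique[OF sm] using a R by (intro sum_le_suminf sums_summable[OF sm]) auto
  also have "\<dots> \<le> norm (\<Sum>j<n. g (of_real R * ?w j))" by (rule complex_Re_le_cmod)
  also have "\<dots> \<le> (\<Sum>j<n. norm (g (of_real R * ?w j)))" by (rule norm_sum)
  finally show ?thesis by simp
qed

definition level_diff4 :: "nat \<Rightarrow> nat \<Rightarrow> nat \<Rightarrow> real" where
  "level_diff4 h r n = (\<Sum>T\<in>trees n. (real (lev T r) - real (lev T (r + h))) ^ 4)"

lemma level_diff4_nonneg: "0 \<le> level_diff4 h r n"
  by (auto simp: level_diff4_def intro!: sum_nonneg)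

lemma tree_gf_ldiff_nth: "fps_nth (tree_gf (\<lambda>T. ldiff h r T ^ 4)) n = of_real (level_diff4 h r n)"
  by (simp add: tree_gf_def level_diff4_def ldiff_def)

text \<open>x A'(x) has the nonnegative coefficients m a_m, so the average over roots of unity
  applies to it. Over the n points the values \<delta>^(-3) add up to O(n^(3/2)), so n (n a_n) is
  O(h^2 n^(3/2)) up to the exponential factor.\<close>

lemma level_diff4_upper_bound: "\<exists>M\<ge>0. \<forall>n h r. 1 \<le> n \<longrightarrow> 1 \<le> h \<longrightarrow> level_diff4 h r n * rho ^ n * sqrt (real n) \<le> M * real h ^ 2"
proof -
  obtain M where M: "0 \<le> M" "\<And>x h r. norm x < rho \<Longrightarrow> 1 \<le> h \<Longrightarrow> dnorm (ev x (tree_gf (\<lambda>T. ldiff h r T ^ 4))) \<le> M * (real h ^ 2 / gap x)"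
    using fourth_moment_ev_bound by blast
  obtain c where c: "0 < c" "\<And>x. norm x < rho \<Longrightarrow> c * norm (1 - x / of_real rho) \<le> gap x ^ 2"
    using gap_sq_ge by blast
  define S where "S = (\<Sum>i. three_halves i)"
  have S: "0 \<le> S" unfolding S_def by (intro suminf_nonneg summable_f32 three_halves_nonneg)
  \<comment> \<open>The factor e pays for the radius \<open>rho\<close> n/(n+1) in place of
    \<open>rho\<close>; 4/c comes from \<delta>^2 \<ge> c (1 + i)/(4n), and 2 S from the two half
    circles.\<close>
  define B where "B = exp 1 * (M * (sqrt (4 / c)) ^ 3 * (2 * S))"
  have B: "0 \<le> B" using M(1) c(1) S by (simp add: B_def)
  have "level_diff4 h r n * rho ^ n * sqrt (real n) \<le> B * real h ^ 2" if n: "1 \<le> n" and h: "1 \<le> h" for n h r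
  proof -
    define s where "s = real n / real (Suc n)"
    have s: "0 < s" "s < 1" using n by (auto simp: s_def)
    define A where "A = tree_gf (\<lambda>T. ldiff h r T ^ 4)"
    have An: "fps_nth A m = of_real (level_diff4 h r m)" for m by (simp add: A_def tree_gf_ldiff_nth)
    have cA: "conv_rho A" unfolding A_def by (rule conv_rho_tree_gf) (rule norm_ldiff_le)
    let ?R = "rho * s"
    have R: "0 < ?R" "?R < rho" using s rho_pos by auto
    let ?w = "\<lambda>j. cis (2 * pi * real j / real n)"
    have "real n * (real n * level_diff4 h r n * ?R ^ n) \<le> (\<Sum>j<n. norm (eval_fps (fps_X * fps_deriv A) (of_real ?R * ?w j)))"
    proof (rule coeff_le_roots_of_unity_average[where a = "\<lambda>m. real m * level_diff4 h r m"])
      fix w :: complex assume w: "norm w = 1"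
      have nx: "norm (of_real ?R * w) < rho" using R(2) by (simp only: norm_mult norm_of_real w mult_1_right abs_of_pos[OF R(1)])
      have "ereal (norm (of_real ?R * w)) < fps_conv_radius (fps_X * fps_deriv A)"
        by (rule less_le_trans[OF _ fps_conv_radius_mult]) (use conv_rho_less_deriv[OF nx cA] in simp)
      then have "(\<lambda>m. fps_nth (fps_X * fps_deriv A) m * (of_real ?R * w) ^ m) sums eval_fps (fps_X * fps_deriv A) (of_real ?R * w)"
        by (rule sums_eval_fps)
      moreover have "fps_nth (fps_X * fps_deriv A) m = of_real (real m * level_diff4 h r m)" for m
        by (cases m) (simp_all add: An)
      ultimately show "(\<lambda>m. of_real (real m * level_diff4 h r m) * (of_real ?R * w) ^ m) sums eval_fps (fps_X * fps_deriv A) (of_real ?R * w)"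
        by (simp only:)
    qed (use n R level_diff4_nonneg in auto)
    also have "\<dots> \<le> (\<Sum>j<n. M * real h ^ 2 * ((sqrt (4 / c)) ^ 3 * sqrt (real n) ^ 3 * three_halves (min j (n - j))))"
    proof (rule sum_mono)
      fix j assume j: "j \<in> {..<n}"
      define x where "x = of_real ?R * ?w j"
      have nx: "norm x < rho" using R(2) by (simp only: x_def norm_mult norm_of_real norm_cis mult_1_right abs_of_pos[OF R(1)])
      have g: "0 < gap x" by (rule gap_pos[OF nx])
      have "(1 + real (min j (n - j))) / (4 * real n) \<le> norm (1 - x / of_real rho)"
        using norm_one_minus_circle_ge[of n j] n j rho_pos by (simp add: x_def s_def)
      then have "c * ((1 + real (min j (n - j))) / (4 * real n)) \<le> gap x ^ 2"
        using c(1) by (intro order.trans[OF mult_left_mono c(2)[OF nx]]) auto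
      then have "sqrt (c * ((1 + real (min j (n - j))) / (4 * real n))) \<le> gap x"
        using g by (intro real_le_lsqrt) auto
      then have "sqrt (c / 4) * sqrt (1 + real (min j (n - j))) / sqrt (real n) \<le> gap x"
        by (simp add: real_sqrt_mult[symmetric] real_sqrt_divide[symmetric] mult_ac del: real_sqrt_mult real_sqrt_divide)
      then have "(sqrt (c / 4) * sqrt (1 + real (min j (n - j))) / sqrt (real n)) ^ 3 \<le> gap x ^ 3"
        using c(1) by (intro power_mono) auto
      then have "1 / gap x ^ 3 \<le> 1 / (sqrt (c / 4) * sqrt (1 + real (min j (n - j))) / sqrt (real n)) ^ 3"
        using c(1) n g by (intro divide_left_mono) (auto intro!: mult_pos_pos zero_less_power divide_pos_pos)
      also have "\<dots> = (sqrt (4 / c)) ^ 3 * sqrt (real n) ^ 3 * three_halves (min j (n - j))"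
        using c(1) by (simp add: three_halves_def power_mult_distrib power_divide real_sqrt_divide)
      finally have inv: "1 / gap x ^ 3 \<le> (sqrt (4 / c)) ^ 3 * sqrt (real n) ^ 3 * three_halves (min j (n - j))" .
      have "gap x ^ 2 * norm (eval_fps (fps_deriv A) x) \<le> dnorm (ev x A)"
        by (simp add: dnorm_def ev_def norm_mult norm_power)
      also have "\<dots> \<le> M * (real h ^ 2 / gap x)" unfolding A_def by (rule M(2)[OF nx h])
      \<comment> \<open>The dual norm contains \<delta>^2 |A'| and is O(h^2/\<delta>), hence the
        third power.\<close>
      finally have d: "norm (eval_fps (fps_deriv A) x) \<le> M * real h ^ 2 * (1 / gap x ^ 3)"
        using g by (simp add: field_simps power2_eq_square power3_eq_cube)
      have "norm (eval_fps (fps_X * fps_deriv A) x) = norm x * norm (eval_fps (fps_deriv A) x)"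
        using conv_rho_less_deriv[OF nx cA] by (simp add: eval_fps_mult norm_mult)
      also have "\<dots> \<le> 1 * norm (eval_fps (fps_deriv A) x)"
        using nx rho_le by (intro mult_right_mono) auto
      also have "\<dots> \<le> M * real h ^ 2 * (1 / gap x ^ 3)" using d by simp
      also have "\<dots> \<le> M * real h ^ 2 * ((sqrt (4 / c)) ^ 3 * sqrt (real n) ^ 3 * three_halves (min j (n - j)))"
        using M(1) by (intro mult_left_mono inv) auto
      finally show "norm (eval_fps (fps_X * fps_deriv A) (of_real ?R * ?w j)) \<le> M * real h ^ 2 * ((sqrt (4 / c)) ^ 3 * sqrt (real n) ^ 3 * three_halves (min j (n - j)))"
        by (simp add: x_def)
    qed
    also have "\<dots> = M * real h ^ 2 * ((sqrt (4 / c)) ^ 3 * sqrt (real n) ^ 3) * (\<Sum>j<n. three_halves (min j (n - j)))"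
      unfolding sum_distrib_left by (simp only: mult.assoc)
    also have "\<dots> \<le> M * real h ^ 2 * ((sqrt (4 / c)) ^ 3 * sqrt (real n) ^ 3) * (2 * S)"
      unfolding S_def using M(1) c(1) by (intro mult_left_mono sum_f32_min_le) auto
    finally have main: "real n * (real n * level_diff4 h r n * ?R ^ n) \<le> M * real h ^ 2 * ((sqrt (4 / c)) ^ 3 * sqrt (real n) ^ 3) * (2 * S)" .
    have sn: "1 \<le> exp 1 * s ^ n"
    proof -
      have "1 / s = 1 + 1 / real n" using n by (simp add: s_def field_simps)
      also have "\<dots> \<le> exp (1 / real n)" by (rule exp_ge_add_one_self)
      finally have "(1 / s) ^ n \<le> exp (1 / real n) ^ n" using s by (intro power_mono) auto
      also have "\<dots> = exp 1" using n by (simp flip: exp_of_nat_mult)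
      finally show ?thesis using s by (simp add: power_divide field_simps)
    qed
    have "real n * (real n * level_diff4 h r n * rho ^ n) * 1 \<le> real n * (real n * level_diff4 h r n * rho ^ n) * (exp 1 * s ^ n)"
      using level_diff4_nonneg rho_pos by (intro mult_left_mono sn) auto
    also have "\<dots> = exp 1 * (real n * (real n * level_diff4 h r n * ?R ^ n))" by (simp add: power_mult_distrib mult_ac)
    also have "\<dots> \<le> exp 1 * (M * real h ^ 2 * ((sqrt (4 / c)) ^ 3 * sqrt (real n) ^ 3) * (2 * S))"
      by (intro mult_left_mono main) auto
    also have "\<dots> = sqrt (real n) ^ 3 * (B * real h ^ 2)" by (simp add: B_def mult_ac)
    finally have le: "real n * (real n * level_diff4 h r n * rho ^ n) * 1 \<le> sqrt (real n) ^ 3 * (B * real h ^ 2)" .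
    have "sqrt (real n) ^ 3 * (level_diff4 h r n * rho ^ n * sqrt (real n)) \<le> sqrt (real n) ^ 3 * (B * real h ^ 2)"
    proof -
      have "real n * real n = sqrt (real n) ^ 3 * sqrt (real n)"
        using power_add[of "sqrt (real n)" 3 1] power_mult[of "sqrt (real n)" 2 2] by (simp add: power2_eq_square)
      then have "real n * (real n * level_diff4 h r n * rho ^ n) * 1 = sqrt (real n) ^ 3 * (level_diff4 h r n * rho ^ n * sqrt (real n))"
        by (simp add: mult_ac)
      then show ?thesis using le by (simp only:)
    qed
    then show ?thesis using n by (simp add: mult_le_cancel_left_pos)
  qed
  then show ?thesis using B by blast
qed

section \<open>Lower bound for the number of trees\<close>

text \<open>Abel polynomials divided by factorials: \<open>abel_poly k x\<close> is the coefficient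
  of z^k in exp (x T(z)), where T = z exp T is the tree function. The case 0 avoids the exponent
  -1.\<close>

fun abel_poly :: "nat \<Rightarrow> real \<Rightarrow> real" where
  "abel_poly 0 x = 1"
| "abel_poly (Suc k) x = x * (x + real (Suc k)) ^ k / fact (Suc k)"

lemma abel_poly_deriv: "(abel_poly (Suc k) has_real_derivative abel_poly k (x + 1)) (at x)"
proof (cases k)
  case 0
  have "abel_poly (Suc 0) = (\<lambda>x. x)" by (rule ext) simp
  then show ?thesis by (simp add: 0)
next
  case (Suc i)
  have "((\<lambda>x. x * (x + real (Suc k)) ^ k / fact (Suc k)) has_real_derivative
      ((x + real (Suc k)) ^ k + x * (real k * (x + real (Suc k)) ^ (k - 1))) / fact (Suc k)) (at x)"
    by (auto intro!: derivative_eq_intros)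
  also have "((x + real (Suc k)) ^ k + x * (real k * (x + real (Suc k)) ^ (k - 1))) / fact (Suc k) =
      ((x + real (Suc k)) ^ i * ((x + 1) * real (Suc k))) / (real (Suc k) * fact k)"
    by (simp add: Suc algebra_simps)
  also have "\<dots> = (x + real (Suc k)) ^ i * (x + 1) / fact k"
    by (simp del: of_nat_Suc)
  also have "\<dots> = abel_poly k (x + 1)"
    by (simp add: Suc add_ac mult.commute)
  finally show ?thesis unfolding abel_poly.simps(2)[abs_def] .
qed

text \<open>Induction on k: as functions of x both sides have the same derivative, since
  differentiation lowers the index and shifts the argument by 1, and at x = 0 only the term j = 0
  survives.\<close>

lemma abel_identity: "(\<Sum>j\<le>k. abel_poly j x * abel_poly (k - j) y) = abel_poly k (x + y)"
proof (induction k arbitrary: x)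
  case (Suc k)
  define F where "F = (\<lambda>x. abel_poly (Suc k) y + (\<Sum>j\<le>k. abel_poly (Suc j) x * abel_poly (k - j) y) - abel_poly (Suc k) (x + y))"
  have "(F has_real_derivative 0 + (\<Sum>j\<le>k. abel_poly j (x + 1) * abel_poly (k - j) y) - abel_poly k (x + y + 1)) (at x)" for x
    unfolding F_def
  proof (intro DERIV_diff DERIV_add DERIV_const DERIV_sum DERIV_cmult_right abel_poly_deriv)
    show "((\<lambda>x. abel_poly (Suc k) (x + y)) has_real_derivative abel_poly k (x + y + 1)) (at x)"
      using abel_poly_deriv[of k "x + y"] by (subst DERIV_shift[symmetric])
  qed
  moreover have "0 + (\<Sum>j\<le>k. abel_poly j (x + 1) * abel_poly (k - j) y) - abel_poly k (x + y + 1) = 0" for x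
    using Suc.IH[of "x + 1"] by (simp add: add_ac)
  ultimately have "(F has_real_derivative 0) (at x)" for x by metis
  then have "F x = F 0" for x by (rule DERIV_isconst_all[rule_format])
  moreover have "F 0 = 0" by (simp add: F_def del: abel_poly.simps(2)) (simp add: sum.neutral)
  ultimately have "F x = 0" by simp
  then show ?case
    by (simp add: F_def sum.atMost_Suc_shift del: abel_poly.simps(2) sum.atMost_Suc)
qed simp

lemma fexp_add:
  assumes "fps_nth f 0 = 0" "fps_nth g 0 = 0"
  shows "fexp (f + g) = fexp f * fexp g"
  by (rule fexp_unique[symmetric]) (use assms in \<open>simp_all add: fexp_deriv algebra_simps\<close>)

text \<open>The tree function, with coefficients k^(k-1)/k!, the compositional inverse of z exp
  (-z).\<close>

definition Cayley :: "real fps" where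
  "Cayley = fps_X * Abs_fps (\<lambda>k. abel_poly k 1)"

text \<open>For V = T/z, Abel's identity supplies the coefficients of V^2, and comparing
  coefficients yields 2 V' = 2 V^2 + z (V^2)', that is V' = V (z V)'. With V(0) = 1 this forces V =
  exp (z V).\<close>

lemma Cayley_eq: "Cayley = fps_X * fexp Cayley"
proof -
  define V where "V = Abs_fps (\<lambda>k. abel_poly k 1)"
  have VV: "V * V = Abs_fps (\<lambda>k. abel_poly k 2)"
    by (rule fps_ext) (use abel_identity[of 1 _ 1] in \<open>simp add: V_def fps_mult_nth atLeast0AtMost\<close>)
  have "2 * fps_deriv V = 2 * (V * V) + fps_X * fps_deriv (V * V)"
  proof (rule fps_ext)
    fix k
    have num: "fps_nth (2 * f) n = 2 * fps_nth f n" for f :: "real fps" and n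
      by simp
    have "2 * (real (Suc k) * abel_poly (Suc k) 1) = (2 + real k) * abel_poly k 2"
    proof (cases k)
      case (Suc i)
      have "real (Suc k) * abel_poly (Suc k) 1 = (2 + real k) ^ k / fact k"
      proof -
        have "real (Suc k) * abel_poly (Suc k) 1 = real (Suc k) * (1 + real (Suc k)) ^ k / (real (Suc k) * fact k)" by simp
        also have "\<dots> = (1 + real (Suc k)) ^ k / fact k" by (simp del: of_nat_Suc)
        finally show ?thesis by (simp add: add_ac)
      qed
      moreover have "abel_poly k 2 = 2 * (2 + real k) ^ i / fact k" by (simp add: Suc)
      ultimately show ?thesis using Suc by simp
    qed simp
    then show "fps_nth (2 * fps_deriv V) k = fps_nth (2 * (V * V) + fps_X * fps_deriv (V * V)) k"
      unfolding VV by (cases k) (simp_all add: V_def num algebra_simps del: abel_poly.simps(2))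
  qed
  also have "\<dots> = 2 * (V * fps_deriv (fps_X * V))" by (simp add: algebra_simps)
  finally have "fps_deriv V = V * fps_deriv (fps_X * V)" by simp
  then have "V = fexp (fps_X * V)" by (intro fexp_unique) (simp_all add: V_def)
  then show ?thesis unfolding Cayley_def V_def[symmetric] by simp
qed

text \<open>Stirling's upper bound with constant e, by induction on logarithms. The step is ln (1 +
  1/k) \<ge> 2/(2k + 1).\<close>

lemma fact_le: "1 \<le> k \<Longrightarrow> fact k \<le> exp 1 * sqrt (real k) * (real k / exp 1) ^ k"
proof -
  have *: "ln (fact k) \<le> 1 + (real k + 1/2) * ln (real k) - real k" if "1 \<le> k" for k :: nat
    using that
  proof (induction k rule: nat_induct_at_least)
    case (Suc k)
    have "2 * (real (Suc k) - real k) / (real k + real (Suc k)) \<le> ln (real (Suc k)) - ln (real k)"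
      using Suc.hyps by (intro ln_inverse_approx_ge) auto
    then have "1 \<le> (real k + 1/2) * (ln (real (Suc k)) - ln (real k))"
      by (simp add: field_simps)
    moreover have "ln (fact (Suc k) :: real) = ln (real (Suc k)) + ln (fact k)"
      by (simp add: ln_mult)
    ultimately show ?case using Suc.IH by (simp add: algebra_simps)
  qed simp
  assume "1 \<le> k"
  then have "exp (ln (fact k)) \<le> exp (1 + (real k + 1/2) * ln (real k) - real k)"
    unfolding exp_le_cancel_iff by (rule *)
  also have "\<dots> = exp 1 * exp (ln (real k) / 2) * (exp (ln (real k)) / exp 1) ^ k"
    by (simp add: exp_add exp_diff power_divide algebra_simps flip: exp_of_nat_mult)
  also have "exp (ln (real k) / 2) = sqrt (real k)"
    using \<open>1 \<le> k\<close> by (simp add: powr_half_sqrt[symmetric] powr_def)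
  finally show ?thesis using \<open>1 \<le> k\<close> by simp
qed

lemma Cayley_nth_ge:
  assumes "1 \<le> k"
  shows "exp (real k) / (exp 1 * (real k * sqrt (real k))) \<le> fps_nth Cayley k"
proof -
  obtain i where k: "k = Suc i" using assms by (cases k) auto
  have ap: "abel_poly i 1 = real k ^ i / fact k"
  proof (cases i)
    case (Suc j)
    have "abel_poly i 1 = real k ^ j / fact i" by (simp add: Suc k add_ac)
    also have "\<dots> = (real k * real k ^ j) / (real k * fact i)" using assms by simp
    finally show ?thesis by (simp add: Suc k)
  qed (simp add: k)
  have "exp (real k) / (exp 1 * (real k * sqrt (real k))) * fact k \<le>
      exp (real k) / (exp 1 * (real k * sqrt (real k))) * (exp 1 * sqrt (real k) * (real k / exp 1) ^ k)"
    by (intro mult_left_mono fact_le assms) auto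
  also have "\<dots> = real k ^ i"
  proof -
    have pw: "(real k / exp 1) ^ k = real k * real k ^ i / exp (real k)"
      by (simp add: k power_divide exp_add flip: exp_of_nat_mult)
    have "E / (e * (K * s)) * (e * s * (K * p / E)) = p" if "E \<noteq> 0" "e \<noteq> 0" "K \<noteq> 0" "s \<noteq> 0" for E e K s p :: real
      using that by simp
    then show ?thesis unfolding pw using assms by simp
  qed
  finally have "exp (real k) / (exp 1 * (real k * sqrt (real k))) \<le> real k ^ i / fact k"
    by (simp add: field_simps)
  then show ?thesis by (simp add: Cayley_def k ap)
qed

text \<open>z exp (-z) takes \<open>Cayley\<close> to x and y to x exp q, hence y = T(x exp q). This
  is the form of Lagrange inversion in use: the number of trees becomes a sum over k of a Cayley
  coefficient times a coefficient of a k-th power.\<close>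

lemma tree_series_eq_Cayley: "tree_series = Cayley oo (fps_X * exp_twin_series)"
proof -
  define U :: "real fps" where "U = fps_X * fps_exp (-1)"
  have e: "fexp f * (fps_exp (-1) oo f) = 1" if "fps_nth f 0 = 0" for f
    using that fps_compose_mult_distrib[of f "fps_exp 1" "fps_exp (-1)"] fps_exp_add_mult[of 1 "-1::real"] by simp
  have C0: "fps_nth Cayley 0 = 0" by (simp add: Cayley_def)
  have "U oo Cayley = Cayley * (fps_exp (-1) oo Cayley)"
    by (simp add: U_def fps_compose_mult_distrib C0)
  also have "\<dots> = fps_X * (fexp Cayley * (fps_exp (-1) oo Cayley))"
    using Cayley_eq by (metis mult.assoc)
  finally have UC: "U oo Cayley = fps_X" by (simp add: e C0)
  have U: "fps_nth U 0 = 0" "fps_nth U 1 \<noteq> 0" by (simp_all add: U_def)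
  have iU: "fps_inv U oo U = fps_X" using U by (intro fps_inv)
  have "fps_inv U = fps_inv U oo (U oo Cayley)" by (simp add: UC)
  also have "\<dots> = (fps_inv U oo U) oo Cayley" using U C0 by (intro fps_compose_assoc)
  also have "\<dots> = Cayley" by (simp add: iU C0)
  finally have CU: "Cayley oo U = fps_X" using iU by simp
  have "U oo tree_series = tree_series * (fps_exp (-1) oo tree_series)" by (simp add: U_def fps_compose_mult_distrib)
  also have "\<dots> = (fps_X * fexp (tree_series + twin_series)) * (fps_exp (-1) oo tree_series)" by (subst tree_series_eq) simp
  also have "\<dots> = fps_X * exp_twin_series * (fexp tree_series * (fps_exp (-1) oo tree_series))"
    by (simp add: fexp_add exp_twin_series_def mult_ac)
  finally have UY: "U oo tree_series = fps_X * exp_twin_series" by (simp add: e)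
  have "tree_series = (Cayley oo U) oo tree_series" by (simp add: CU)
  also have "\<dots> = Cayley oo (U oo tree_series)" using U by (intro fps_compose_assoc[symmetric]) auto
  finally show ?thesis by (simp add: UY)
qed

section \<open>The renewal sequence of the step distribution\<close>

definition Omega :: "real fps" where "Omega = fps_X * Abs_fps step_wt"

lemma Omega_nth_nonneg: "0 \<le> fps_nth Omega n"
  by (cases n) (simp_all add: Omega_def step_wt_nonneg)

text \<open>Normalising x exp q to total mass 1 produces the factor exp k, which matches the growth
  exp (k) k^(-3/2) of the Cayley coefficients.\<close>

lemma Omega_power: "fps_nth (Omega ^ k) n = exp (real k) * rho ^ n * fps_nth ((fps_X * exp_twin_series) ^ k) n"
proof (induction k arbitrary: n)
  case (Suc k)
  have O: "fps_nth Omega n = exp 1 * rho ^ n * fps_nth (fps_X * exp_twin_series) n" for n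
    by (cases n) (simp_all add: Omega_def step_wt_def mult_ac)
  have "fps_nth (Omega * Omega ^ k) n = (\<Sum>i=0..n. (exp 1 * rho ^ i * fps_nth (fps_X * exp_twin_series) i) * (exp (real k) * rho ^ (n - i) * fps_nth ((fps_X * exp_twin_series) ^ k) (n - i)))"
    by (simp only: fps_mult_nth O Suc.IH)
  also have "\<dots> = (\<Sum>i=0..n. exp (real (Suc k)) * rho ^ n * (fps_nth (fps_X * exp_twin_series) i * fps_nth ((fps_X * exp_twin_series) ^ k) (n - i)))"
  proof (intro sum.cong refl)
    fix i assume "i \<in> {0..n}"
    then have "rho ^ n = rho ^ i * rho ^ (n - i)" by (simp flip: power_add)
    moreover have "exp (real (Suc k)) = exp 1 * exp (real k)" by (simp add: exp_add)
    ultimately show "(exp 1 * rho ^ i * fps_nth (fps_X * exp_twin_series) i) * (exp (real k) * rho ^ (n - i) * fps_nth ((fps_X * exp_twin_series) ^ k) (n - i)) =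
      exp (real (Suc k)) * rho ^ n * (fps_nth (fps_X * exp_twin_series) i * fps_nth ((fps_X * exp_twin_series) ^ k) (n - i))"
      by (simp only: mult_ac)
  qed
  also have "\<dots> = exp (real (Suc k)) * rho ^ n * fps_nth ((fps_X * exp_twin_series) * (fps_X * exp_twin_series) ^ k) n"
    by (simp only: fps_mult_nth[of "fps_X * exp_twin_series"] sum_distrib_left)
  finally show ?case by (simp only: power_Suc)
qed simp

text \<open>The probability that a random walk with step distribution \<open>Omega\<close> visits n.
  Steps are at least 1, so at most n of them are involved.\<close>

definition renewal :: "nat \<Rightarrow> real" where "renewal n = (\<Sum>k\<le>n. fps_nth (Omega ^ k) n)"

lemma renewal_fps: "Abs_fps renewal * (1 - Omega) = 1"
proof -
  have "Abs_fps renewal = Abs_fps (\<lambda>_. 1) oo Omega"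
    by (rule fps_ext) (simp add: renewal_def fps_compose_nth atLeast0AtMost)
  moreover have "1 - Omega = (1 - fps_X) oo Omega"
    by (simp add: fps_compose_sub_distrib Omega_def)
  moreover have "(Abs_fps (\<lambda>_. 1) oo Omega) * ((1 - fps_X) oo Omega) = (Abs_fps (\<lambda>_. 1) * (1 - fps_X)) oo Omega"
    by (subst fps_compose_mult_distrib) (simp_all add: Omega_def)
  moreover have "Abs_fps (\<lambda>_. 1) * (1 - fps_X) = (1::real fps)"
    by (rule fps_ext) (simp add: algebra_simps fps_X_mult_right_nth)
  ultimately show ?thesis by simp
qed

lemma renewal_nonneg: "0 \<le> renewal n"
  unfolding renewal_def by (intro sum_nonneg fps_power_nth_nonneg Omega_nth_nonneg)

lemma renewal_Suc: "renewal (Suc n) = (\<Sum>i\<le>n. step_wt i * renewal (n - i))"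
proof -
  have "Abs_fps renewal = 1 + fps_X * (Abs_fps step_wt * Abs_fps renewal)"
    using renewal_fps by (simp add: Omega_def algebra_simps)
  from arg_cong[OF this, of "\<lambda>f. fps_nth f (Suc n)"]
  have "renewal (Suc n) = fps_nth (Abs_fps step_wt * Abs_fps renewal) n" by simp
  then show ?thesis by (simp add: fps_mult_nth atLeast0AtMost)
qed

lemma renewal_0: "renewal 0 = 1"
  by (simp add: renewal_def)

lemma renewal_le_1: "renewal n \<le> 1"
proof (induction n rule: less_induct)
  case (less n)
  show ?case
  proof (cases n)
    case (Suc m)
    have "renewal n \<le> (\<Sum>i\<le>m. step_wt i * 1)"
      unfolding Suc renewal_Suc by (intro sum_mono mult_left_mono less step_wt_nonneg) (simp add: Suc)
    also have "\<dots> \<le> (\<Sum>i. step_wt i)" by (simp, intro sum_le_suminf summable_wt') (auto simp: step_wt_nonneg)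
    finally show ?thesis by (simp add: suminf_wt)
  qed (simp add: renewal_0)
qed

text \<open>The probability that a step exceeds j, as \<open>step_wt i\<close> is the weight of the
  step i + 1.\<close>

definition step_tail :: "nat \<Rightarrow> real" where "step_tail j = 1 - (\<Sum>i<j. step_wt i)"

lemma step_tail_eq: "step_tail j = (\<Sum>i. step_wt (i + j))"
  using suminf_split_initial_segment[OF summable_wt', of j] by (simp add: step_tail_def suminf_wt)

lemma step_tail_bounds: "0 \<le> step_tail j" "step_tail j \<le> 1"
  using step_wt_nonneg suminf_nonneg[OF summable_ignore_initial_segment[OF summable_wt', of j]]
  by (auto simp: step_tail_eq) (auto simp: step_tail_def step_tail_eq[symmetric] intro!: sum_nonneg)

lemma step_tail_le_geometric: "\<exists>B>0. \<forall>j. step_tail j \<le> B * (10/11) ^ j"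
proof -
  define B where "B = 1 + (\<Sum>n. step_wt n * (11/10) ^ n)"
  have B: "0 < B" unfolding B_def
    using suminf_nonneg[OF summable_wt] step_wt_nonneg by (intro add_pos_nonneg) auto
  have "step_tail j \<le> B * (10/11) ^ j" for j
  proof -
    have le: "step_wt (i + j) \<le> (10/11) ^ j * (step_wt (i + j) * (11/10) ^ (i + j))" for i
    proof -
      have "(10/11::real) ^ j * (11/10) ^ (i + j) = (11/10) ^ i * ((10/11) ^ j * (11/10) ^ j)" by (simp add: power_add)
      also have "(10/11::real) ^ j * (11/10) ^ j = 1" by (simp flip: power_mult_distrib)
      finally have "1 \<le> (10/11::real) ^ j * (11/10) ^ (i + j)" by simp
      from mult_left_mono[OF this step_wt_nonneg[of "i + j"]] show ?thesis by (simp add: mult_ac)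
    qed
    have sm: "summable (\<lambda>i. step_wt (i + j) * (11/10) ^ (i + j))"
      using summable_ignore_initial_segment[OF summable_wt, of j] by simp
    have "step_tail j \<le> (\<Sum>i. (10/11) ^ j * (step_wt (i + j) * (11/10) ^ (i + j)))"
      unfolding step_tail_eq by (intro suminf_le le summable_mult sm summable_ignore_initial_segment summable_wt')
    also have "\<dots> = (10/11) ^ j * (\<Sum>i. step_wt (i + j) * (11/10) ^ (i + j))" by (rule suminf_mult[OF sm])
    also have "\<dots> \<le> (10/11) ^ j * B"
    proof (rule mult_left_mono)
      have "0 \<le> (\<Sum>i<j. step_wt i * (11/10) ^ i)" using step_wt_nonneg by (intro sum_nonneg) auto
      then show "(\<Sum>i. step_wt (i + j) * (11/10) ^ (i + j)) \<le> B"
        using suminf_split_initial_segment[OF summable_wt, of j] by (simp add: B_def)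
    qed simp
    finally show ?thesis by (simp add: mult.commute)
  qed
  then show ?thesis using B by blast
qed

text \<open>Decomposition by the last visited point n - j not beyond n: the next step must be longer
  than j. In terms of series, the tail series times 1 - x is 1 - \<open>Omega\<close>, the inverse
  of the renewal series.\<close>

lemma renewal_tail: "(\<Sum>j\<le>n. step_tail j * renewal (n - j)) = 1"
proof -
  have t: "Abs_fps step_tail * (1 - fps_X) = 1 - Omega"
  proof (rule fps_ext)
    fix n show "fps_nth (Abs_fps step_tail * (1 - fps_X)) n = fps_nth (1 - Omega) n"
      by (cases n) (simp_all add: algebra_simps fps_X_mult_right_nth step_tail_def Omega_def)
  qed
  have one: "(1 - fps_X) * Abs_fps (\<lambda>_. 1) = (1::real fps)"
    by (rule fps_ext) (simp add: algebra_simps)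
  have "Abs_fps step_tail * Abs_fps renewal = Abs_fps renewal * (Abs_fps step_tail * (1 - fps_X)) * Abs_fps (\<lambda>_. 1)"
    using one by (metis (no_types, lifting) mult.assoc mult.commute mult.right_neutral)
  also have "\<dots> = Abs_fps (\<lambda>_. 1)" by (simp add: t renewal_fps)
  finally have "fps_nth (Abs_fps step_tail * Abs_fps renewal) n = 1" by simp
  then show ?thesis by (simp add: fps_mult_nth atLeast0AtMost)
qed

text \<open>The step distribution charges 1, so \<open>renewal (n - j)\<close> exceeds \<open>renewal n\<close> at most by a factor
  exponential in \<open>j\<close>, while large \<open>j\<close> do not matter in the identity \<open>renewal_tail\<close>.\<close>
lemma renewal_lower_bound: "\<exists>c>0. \<forall>n. c \<le> renewal n"
proof -
  obtain B where B: "0 < B" "\<And>j. step_tail j \<le> B * (10/11) ^ j" using step_tail_le_geometric by blast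
  \<comment> \<open>11 B (10/11)^J is the sum of the geometric bound over all j \<ge> J. Once it is
    below 1/2, the indices j < J carry at least half of the total 1.\<close>
  have "(\<lambda>J. 11 * B * (10/11::real) ^ J) \<longlonglongrightarrow> 11 * B * 0"
    by (intro tendsto_intros LIMSEQ_realpow_zero) auto
  then have "eventually (\<lambda>J. 11 * B * (10/11::real) ^ J < 1/2) sequentially"
    by (intro order_tendstoD) auto
  then obtain J where J: "11 * B * (10/11::real) ^ J < 1/2" by (auto simp: eventually_sequentially)
  let ?w = "step_wt 0"
  have w: "0 < ?w" "?w \<le> 1"
    using step_wt_0_pos step_tail_bounds(1)[of 1] by (auto simp: step_tail_def)
  have step: "?w ^ j * renewal m \<le> renewal (m + j)" for j m
  proof (induction j)
    case (Suc j)
    have "?w ^ Suc j * renewal m \<le> ?w * renewal (m + j)" using Suc w by (simp add: mult.assoc mult_left_mono)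
    also have "\<dots> \<le> renewal (Suc (m + j))" unfolding renewal_Suc
      using member_le_sum[of 0 "{..m + j}" "\<lambda>i. step_wt i * renewal (m + j - i)"] step_wt_nonneg renewal_nonneg by simp
    finally show ?case by simp
  qed simp
  have "?w ^ J / (2 * real (Suc J)) \<le> renewal n" for n
  proof -
    have tm: "step_tail j * renewal (n - j) \<le> (if j < J then renewal n / ?w ^ J else 0) + (if J \<le> j then B * (10/11) ^ j else 0)" if "j \<le> n" for j
    proof (cases "j < J")
      case True
      have "?w ^ J * renewal (n - j) \<le> ?w ^ j * renewal (n - j)"
        using True w renewal_nonneg by (intro mult_right_mono power_decreasing) auto
      also have "\<dots> \<le> renewal n" using step[of j "n - j"] that by simp
      finally have "renewal (n - j) \<le> renewal n / ?w ^ J" using w by (simp add: field_simps)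
      moreover have "step_tail j * renewal (n - j) \<le> 1 * renewal (n - j)" by (intro mult_right_mono step_tail_bounds renewal_nonneg)
      ultimately show ?thesis using True by simp
    next
      case False
      have "step_tail j * renewal (n - j) \<le> step_tail j * 1" by (intro mult_left_mono renewal_le_1 step_tail_bounds)
      then show ?thesis using False B(2)[of j] by simp
    qed
    have "1 \<le> (\<Sum>j\<le>n. (if j < J then renewal n / ?w ^ J else 0) + (if J \<le> j then B * (10/11) ^ j else 0))"
      unfolding renewal_tail[of n, symmetric] by (intro sum_mono tm) simp
    also have "\<dots> = (\<Sum>j\<le>n. if j < J then renewal n / ?w ^ J else 0) + (\<Sum>j\<le>n. if J \<le> j then B * (10/11) ^ j else 0)"
      by (rule sum.distrib)
    also have "(\<Sum>j\<le>n. if j < J then renewal n / ?w ^ J else 0) \<le> real (Suc J) * (renewal n / ?w ^ J)"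
    proof -
      have "(\<Sum>j\<le>n. if j < J then renewal n / ?w ^ J else 0) = (\<Sum>j\<in>{j. j \<le> n \<and> j < J}. renewal n / ?w ^ J)"
        by (subst sum.inter_filter[symmetric]) auto
      also have "\<dots> \<le> (\<Sum>j\<in>{..J}. renewal n / ?w ^ J)"
        using w renewal_nonneg by (intro sum_mono2) auto
      finally show ?thesis by simp
    qed
    also have "(\<Sum>j\<le>n. if J \<le> j then B * (10/11) ^ j else 0) \<le> 11 * B * (10/11) ^ J"
    proof -
      have sg: "summable (\<lambda>j. (10/11::real) ^ j)" by simp
      have "(\<Sum>j\<le>n. if J \<le> j then B * (10/11) ^ j else 0) = (\<Sum>j\<in>{J..n}. B * (10/11) ^ j)"
        by (subst sum.inter_filter[symmetric]) (auto intro!: sum.cong)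
      also have "\<dots> \<le> (\<Sum>j\<in>{J..<J + Suc n}. B * (10/11) ^ j)" using B by (intro sum_mono2) auto
      also have "\<dots> = (\<Sum>j<Suc n. B * (10/11) ^ (j + J))"
        using sum.shift_bounds_nat_ivl[of "\<lambda>j. B * (10/11) ^ j" 0 J "Suc n"] by (simp only: add_0 lessThan_atLeast0 add.commute)
      also have "\<dots> = B * (10/11) ^ J * (\<Sum>j<Suc n. (10/11) ^ j)"
        by (simp only: sum_distrib_left power_add mult_ac)
      also have "\<dots> \<le> B * (10/11) ^ J * (\<Sum>j. (10/11) ^ j)"
        using B by (intro mult_left_mono sum_le_suminf sg) auto
      also have "(\<Sum>j. (10/11::real) ^ j) = 11" by (subst suminf_geometric) auto
      finally show ?thesis by simp
    qed
    finally have "1/2 \<le> real (Suc J) * (renewal n / ?w ^ J)" using J by linarith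
    then show ?thesis using w by (simp add: field_simps)
  qed
  moreover have "0 < ?w ^ J / (2 * real (Suc J))" using w by simp
  ultimately show ?thesis by blast
qed

text \<open>For k \<le> n, Stirling's bound replaces exp k in \<open>renewal n\<close> by at most e
  n^(3/2) times the k-th Cayley coefficient; the sum over k is then the number of trees, while
  \<open>renewal n\<close> stays away from 0.\<close>

lemma card_trees_lower_bound:
  "\<exists>c>0. \<forall>n\<ge>1. c \<le> real (card (trees n)) * rho ^ n * (real n * sqrt (real n))"
proof -
  obtain c where c: "0 < c" "\<And>n. c \<le> renewal n" using renewal_lower_bound by blast
  have "c / exp 1 \<le> real (card (trees n)) * rho ^ n * (real n * sqrt (real n))" if n: "1 \<le> n" for n
  proof -
    have "renewal n = (\<Sum>k\<in>{1..n}. fps_nth (Omega ^ k) n)"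
      unfolding renewal_def using n by (intro sum.mono_neutral_right) (auto simp: not_le)
    also have "\<dots> \<le> (\<Sum>k\<in>{1..n}. exp 1 * (real n * sqrt (real n)) * rho ^ n * (fps_nth Cayley k * fps_nth ((fps_X * exp_twin_series) ^ k) n))"
    proof (rule sum_mono)
      fix k assume k: "k \<in> {1..n}"
      have p: "0 \<le> fps_nth ((fps_X * exp_twin_series) ^ k) n"
      proof (rule fps_power_nth_nonneg)
        fix m show "0 \<le> fps_nth (fps_X * exp_twin_series) m" by (cases m) (simp_all add: exp_twin_series_nth_nonneg)
      qed
      have "exp (real k) \<le> exp 1 * (real k * sqrt (real k)) * fps_nth Cayley k"
        using Cayley_nth_ge[of k] k by (simp add: field_simps)
      also have "\<dots> \<le> exp 1 * (real n * sqrt (real n)) * fps_nth Cayley k"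
      proof (intro mult_right_mono mult_left_mono mult_mono)
        have "0 \<le> exp (real k) / (exp 1 * (real k * sqrt (real k)))" by simp
        also have "\<dots> \<le> fps_nth Cayley k" using k by (intro Cayley_nth_ge) simp
        finally show "0 \<le> fps_nth Cayley k" .
      qed (use k in auto)
      finally have "exp (real k) * (rho ^ n * fps_nth ((fps_X * exp_twin_series) ^ k) n) \<le> (exp 1 * (real n * sqrt (real n)) * fps_nth Cayley k) * (rho ^ n * fps_nth ((fps_X * exp_twin_series) ^ k) n)"
        using p rho_pos by (intro mult_right_mono) auto
      then show "fps_nth (Omega ^ k) n \<le> exp 1 * (real n * sqrt (real n)) * rho ^ n * (fps_nth Cayley k * fps_nth ((fps_X * exp_twin_series) ^ k) n)"
        unfolding Omega_power by (simp add: mult_ac)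
    qed
    also have "\<dots> = exp 1 * (real n * sqrt (real n)) * rho ^ n * (\<Sum>k\<in>{1..n}. fps_nth Cayley k * fps_nth ((fps_X * exp_twin_series) ^ k) n)"
      by (simp only: sum_distrib_left)
    also have "(\<Sum>k\<in>{1..n}. fps_nth Cayley k * fps_nth ((fps_X * exp_twin_series) ^ k) n) = fps_nth (Cayley oo (fps_X * exp_twin_series)) n"
      unfolding fps_compose_nth by (intro sum.mono_neutral_left) (auto simp: Cayley_def not_le)
    also have "\<dots> = real (card (trees n))" by (simp add: tree_series_nth flip: tree_series_eq_Cayley)
    finally show ?thesis using c(2)[of n] by (simp add: field_simps)
  qed
  then show ?thesis using c(1) by (intro exI[of _ "c / exp 1"]) auto
qed

section \<open>Tightness\<close>

lemma fourth_moment_bound: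
  "\<exists>C>0. \<forall>n r h. level_diff4 h r n \<le> C * real h ^ 2 * real n * real (card (trees n))"
proof -
  obtain M where M: "0 \<le> M" "\<And>n h r. 1 \<le> n \<Longrightarrow> 1 \<le> h \<Longrightarrow> level_diff4 h r n * rho ^ n * sqrt (real n) \<le> M * real h ^ 2"
    using level_diff4_upper_bound by blast
  obtain c where c: "0 < c" "\<And>n. 1 \<le> n \<Longrightarrow> c \<le> real (card (trees n)) * rho ^ n * (real n * sqrt (real n))"
    using card_trees_lower_bound by blast
  \<comment> \<open>\<open>M\<close> may be 0; the summand 1 makes the constant positive.\<close>
  have "level_diff4 h r n \<le> (M / c + 1) * real h ^ 2 * real n * real (card (trees n))" for n r h
  proof (cases "n = 0 \<or> h = 0")
    case True
    then have "level_diff4 h r n = 0" by (auto simp: level_diff4_def)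
    then show ?thesis using True by auto
  next
    case False
    then have n: "1 \<le> n" and h: "1 \<le> h" by auto
    let ?u = "rho ^ n * sqrt (real n)"
    have u: "0 < ?u" using n rho_pos by simp
    have "c * (level_diff4 h r n * ?u) \<le> c * (M * real h ^ 2)"
      using M(2)[OF n h, of r] c(1) by (simp add: mult.assoc)
    also have "\<dots> \<le> (real (card (trees n)) * rho ^ n * (real n * sqrt (real n))) * (M * real h ^ 2)"
      using M(1) by (intro mult_right_mono c(2) n) auto
    also have "\<dots> = (M * real h ^ 2 * real n * real (card (trees n))) * ?u" by (simp add: mult_ac)
    finally have "(c * level_diff4 h r n) * ?u \<le> (M * real h ^ 2 * real n * real (card (trees n))) * ?u" by (simp add: mult_ac)
    then have "c * level_diff4 h r n \<le> M * real h ^ 2 * real n * real (card (trees n))"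
      using u by (simp only: mult_le_cancel_right_pos)
    then have "level_diff4 h r n \<le> M / c * (real h ^ 2 * real n * real (card (trees n)))"
      using c(1) by (simp add: field_simps)
    also have "\<dots> \<le> (M / c + 1) * (real h ^ 2 * real n * real (card (trees n)))"
      by (intro mult_right_mono) auto
    finally show ?thesis by (simp add: mult.assoc)
  qed
  then show ?thesis using M(1) c(1) by (intro exI[of _ "M / c + 1"]) (auto intro: add_nonneg_pos)
qed

section \<open>The interpolated process\<close>

lemma Lr_diff:
  assumes "0 \<le> s" "s \<le> t"
  defines "k \<equiv> nat \<lfloor>s\<rfloor>" and "l \<equiv> nat \<lfloor>t\<rfloor>"
  shows "k = l \<Longrightarrow> Lr T t - Lr T s = (t - s) * (real (lev T (k + 1)) - real (lev T k))"
    and "k \<noteq> l \<Longrightarrow> Lr T t - Lr T s = (real k + 1 - s) * (real (lev T (k + 1)) - real (lev T k)) +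
       (real (lev T l) - real (lev T (k + 1))) + (t - real l) * (real (lev T (l + 1)) - real (lev T l))"
    and "k \<noteq> l \<Longrightarrow> k + 1 \<le> l" "real k \<le> s" "s \<le> real k + 1" "real l \<le> t" "t \<le> real l + 1"
proof -
  have k: "real_of_int \<lfloor>s\<rfloor> = real k" and l: "real_of_int \<lfloor>t\<rfloor> = real l"
    using assms by (auto simp: k_def l_def)
  have "k \<le> l" unfolding k_def l_def using assms by (intro nat_mono floor_mono)
  then show "k \<noteq> l \<Longrightarrow> k + 1 \<le> l" by simp
  show "real k \<le> s" "s \<le> real k + 1" "real l \<le> t" "t \<le> real l + 1"
    using k l by (metis of_int_floor_le, metis real_of_int_floor_add_one_ge, metis of_int_floor_le, metis real_of_int_floor_add_one_ge)
  have Ls: "Lr T s = (real k + 1 - s) * real (lev T k) + (s - real k) * real (lev T (k + 1))"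
    and Lt: "Lr T t = (real l + 1 - t) * real (lev T l) + (t - real l) * real (lev T (l + 1))"
    by (simp_all add: Lr_def k l flip: k_def l_def)
  show "k = l \<Longrightarrow> Lr T t - Lr T s = (t - s) * (real (lev T (k + 1)) - real (lev T k))"
    unfolding Ls Lt by (simp add: algebra_simps)
  show "k \<noteq> l \<Longrightarrow> Lr T t - Lr T s = (real k + 1 - s) * (real (lev T (k + 1)) - real (lev T k)) +
       (real (lev T l) - real (lev T (k + 1))) + (t - real l) * (real (lev T (l + 1)) - real (lev T l))"
    unfolding Ls Lt by (simp add: algebra_simps)
qed

lemma power4_add_le: "(x + y) ^ 4 \<le> 8 * (x ^ 4 + y ^ 4)" for x y :: real
proof -
  have sq: "(a + b) ^ 2 \<le> 2 * (a ^ 2 + b ^ 2)" for a b :: real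
    using zero_le_power2[of "a - b"] by (simp add: power2_eq_square algebra_simps)
  have "(x + y) ^ 4 = ((x + y) ^ 2) ^ 2" by simp
  also have "\<dots> \<le> (2 * (x ^ 2 + y ^ 2)) ^ 2" by (intro power_mono sq) auto
  also have "\<dots> = 4 * (x ^ 2 + y ^ 2) ^ 2" by (simp only: power_mult_distrib) simp
  also have "\<dots> \<le> 4 * (2 * ((x ^ 2) ^ 2 + (y ^ 2) ^ 2))" by (intro mult_left_mono sq) auto
  finally show ?thesis by simp
qed

lemma level_diff4_sum: "(\<Sum>T\<in>trees n. (real (lev T (r + h)) - real (lev T r)) ^ 4) = level_diff4 h r n"
  unfolding level_diff4_def by (intro sum.cong refl) (metis even_numeral minus_diff_eq power_minus_even)

text \<open>The interval splits into a fractional piece u, an integral piece v and a fractional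
  piece w. As u, w \<le> 1, their fourth powers are at most their squares, so all three pieces obey
  the same bound, and u^2 + v^2 + w^2 \<le> (t - s)^2. The factor 64 = 8 * 8 comes from separating
  three summands in two steps.\<close>

lemma Lr_fourth_moment:
  assumes C: "0 \<le> C" "\<And>n r h. level_diff4 h r n \<le> C * real h ^ 2 * real n * real (card (trees n))"
    and st: "0 \<le> s" "s \<le> t"
  shows "(\<Sum>T\<in>trees n. (Lr T t - Lr T s) ^ 4) \<le> 64 * C * (t - s) ^ 2 * real n * real (card (trees n))"
proof -
  define k where "k = nat \<lfloor>s\<rfloor>"
  define l where "l = nat \<lfloor>t\<rfloor>"
  note D = Lr_diff[OF st, folded k_def l_def]
  let ?N = "C * real n * real (card (trees n))"
  have N: "0 \<le> ?N" using C by simp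
  have one: "(\<Sum>T\<in>trees n. (u * (real (lev T (r + 1)) - real (lev T r))) ^ 4) \<le> u ^ 2 * ?N" if "0 \<le> u" "u \<le> 1" for u r
  proof -
    have "(\<Sum>T\<in>trees n. (u * (real (lev T (r + 1)) - real (lev T r))) ^ 4) = u ^ 4 * level_diff4 1 r n"
      by (simp only: power_mult_distrib sum_distrib_left[symmetric] level_diff4_sum)
    also have "\<dots> \<le> u ^ 2 * level_diff4 1 r n"
      using that by (intro mult_right_mono power_decreasing level_diff4_nonneg) auto
    also have "\<dots> \<le> u ^ 2 * ?N" using C(2)[of 1 r n] by (intro mult_left_mono) auto
    finally show ?thesis .
  qed
  show ?thesis
  proof (cases "k = l")
    case True
    have "t - s \<le> 1" using D(4-7) True by linarith
    then have "(\<Sum>T\<in>trees n. (Lr T t - Lr T s) ^ 4) \<le> (t - s) ^ 2 * ?N"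
      unfolding D(1)[OF True] using st by (intro one) auto
    also have "\<dots> \<le> 64 * ((t - s) ^ 2 * ?N)" using mult_nonneg_nonneg[OF zero_le_power2[of "t - s"] N] by linarith
    finally show ?thesis by (simp add: mult_ac)
  next
    case False
    define u v w where "u = real k + 1 - s" and "v = real (l - (k + 1))" and "w = t - real l"
    have kl: "k + 1 \<le> l" using D(3) False .
    have uvw: "0 \<le> u" "u \<le> 1" "0 \<le> v" "0 \<le> w" "w \<le> 1" "u + v + w = t - s"
      using D(4-7) kl by (auto simp: u_def v_def w_def of_nat_diff)
    have "(\<Sum>T\<in>trees n. (Lr T t - Lr T s) ^ 4) \<le> (\<Sum>T\<in>trees n. 64 * ((u * (real (lev T (k + 1)) - real (lev T k))) ^ 4
        + (real (lev T l) - real (lev T (k + 1))) ^ 4 + (w * (real (lev T (l + 1)) - real (lev T l))) ^ 4))"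
    proof (rule sum_mono)
      fix T
      let ?a = "u * (real (lev T (k + 1)) - real (lev T k))" and ?b = "real (lev T l) - real (lev T (k + 1))"
        and ?c = "w * (real (lev T (l + 1)) - real (lev T l))"
      have "(Lr T t - Lr T s) ^ 4 = (?a + ?b + ?c) ^ 4" unfolding D(2)[OF False] u_def w_def ..
      also have "\<dots> \<le> 8 * ((?a + ?b) ^ 4 + ?c ^ 4)" by (rule power4_add_le)
      also have "\<dots> \<le> 8 * (8 * (?a ^ 4 + ?b ^ 4) + ?c ^ 4)" by (intro mult_left_mono add_right_mono power4_add_le) simp
      also have "\<dots> \<le> 64 * (?a ^ 4 + ?b ^ 4 + ?c ^ 4)" using zero_le_even_power[of 4 ?c] by (simp only: ring_distribs) simp
      finally show "(Lr T t - Lr T s) ^ 4 \<le> 64 * (?a ^ 4 + ?b ^ 4 + ?c ^ 4)" .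
    qed
    also have "\<dots> = 64 * ((\<Sum>T\<in>trees n. (u * (real (lev T (k + 1)) - real (lev T k))) ^ 4)
        + (\<Sum>T\<in>trees n. (real (lev T l) - real (lev T (k + 1))) ^ 4) + (\<Sum>T\<in>trees n. (w * (real (lev T (l + 1)) - real (lev T l))) ^ 4))"
      by (simp only: sum_distrib_left[symmetric] sum.distrib)
    also have "\<dots> \<le> 64 * (u ^ 2 * ?N + v ^ 2 * ?N + w ^ 2 * ?N)"
    proof (intro mult_left_mono add_mono one uvw)
      have "(\<Sum>T\<in>trees n. (real (lev T l) - real (lev T (k + 1))) ^ 4) = level_diff4 (l - (k + 1)) (k + 1) n"
        using kl by (simp flip: level_diff4_sum)
      also have "\<dots> \<le> v ^ 2 * ?N" using C(2)[of "l - (k + 1)" "k + 1" n] by (simp add: v_def mult_ac)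
      finally show "(\<Sum>T\<in>trees n. (real (lev T l) - real (lev T (k + 1))) ^ 4) \<le> v ^ 2 * ?N" .
    qed simp
    also have "\<dots> = 64 * ((u ^ 2 + v ^ 2 + w ^ 2) * ?N)" by (simp add: algebra_simps)
    also have "\<dots> \<le> 64 * ((u + v + w) ^ 2 * ?N)"
    proof (intro mult_left_mono mult_right_mono N)
      have "0 \<le> u * v" "0 \<le> u * w" "0 \<le> v * w" using uvw by auto
      then show "u ^ 2 + v ^ 2 + w ^ 2 \<le> (u + v + w) ^ 2" by (simp add: power2_eq_square algebra_simps)
    qed simp
    finally show ?thesis by (simp add: uvw mult_ac)
  qed
qed

text \<open>Provides continuity of each single path; the constant grows with the tree, so it says
  nothing about tightness.\<close>

lemma Lr_lipschitz:
  assumes "0 \<le> s" "s \<le> t"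
  shows "\<bar>Lr T t - Lr T s\<bar> \<le> real (tsize T) * (t - s)"
proof -
  define k where "k = nat \<lfloor>s\<rfloor>"
  define l where "l = nat \<lfloor>t\<rfloor>"
  note D = Lr_diff[OF assms, folded k_def l_def]
  have d: "\<bar>real (lev T i) - real (lev T j)\<bar> \<le> real (tsize T)" for i j
    using lev_le_tsize[of T i] lev_le_tsize[of T j] by linarith
  have one: "\<bar>u * (real (lev T i) - real (lev T j))\<bar> \<le> real (tsize T) * u" if "0 \<le> u" for u i j
    using mult_left_mono[OF d[of i j] that] that by (simp add: abs_mult mult.commute)
  show ?thesis
  proof (cases "k = l")
    case True
    then show ?thesis unfolding D(1)[OF True] using assms by (intro one) auto
  next
    case False
    have kl: "k + 1 \<le> l" using D(3) False .
    have "\<bar>real (lev T l) - real (lev T (k + 1))\<bar> \<le> real (tsize T) * (real l - real (k + 1))"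
    proof (cases "l = k + 1")
      case False
      then have "1 \<le> real l - real (k + 1)" using kl by linarith
      then have "real (tsize T) * 1 \<le> real (tsize T) * (real l - real (k + 1))" by (intro mult_left_mono) auto
      then show ?thesis using d[of l "k + 1"] by linarith
    qed simp
    moreover have "\<bar>(real k + 1 - s) * (real (lev T (k + 1)) - real (lev T k))\<bar> \<le> real (tsize T) * (real k + 1 - s)"
      "\<bar>(t - real l) * (real (lev T (l + 1)) - real (lev T l))\<bar> \<le> real (tsize T) * (t - real l)"
      using D(4-7) by (intro one; simp)+
    ultimately have "\<bar>Lr T t - Lr T s\<bar> \<le> real (tsize T) * (real k + 1 - s) + real (tsize T) * (real l - real (k + 1)) + real (tsize T) * (t - real l)"
      unfolding D(2)[OF False] by linarith
    also have "\<dots> = real (tsize T) * (t - s)" by (simp add: algebra_simps)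
    finally show ?thesis .
  qed
qed

lemma continuous_on_lproc: "continuous_on {0..} (lproc n T)"
proof -
  have "\<bar>Lr T a - Lr T b\<bar> \<le> real (tsize T) * \<bar>a - b\<bar>" if "0 \<le> a" "0 \<le> b" for a b
    using Lr_lipschitz[of a b T] Lr_lipschitz[of b a T] that by (cases "a \<le> b") (auto simp: abs_minus_commute)
  then have "(real (tsize T))-lipschitz_on {0..} (Lr T)"
    by (intro lipschitz_onI) (auto simp: dist_real_def)
  then have "continuous_on {0..} (Lr T)" by (rule lipschitz_on_continuous_on)
  then have "continuous_on {0..} (\<lambda>t. Lr T (t * sqrt (real n)))"
    by (rule continuous_on_compose2) (auto intro!: continuous_intros)
  then show ?thesis unfolding lproc_def[abs_def] by (auto intro!: continuous_intros simp: divide_inverse)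
qed

section \<open>Dyadic chaining and a compact class of functions\<close>

lemma dyadic_chaining:
  fixes f :: "real \<Rightarrow> real" and a M :: real and N :: nat
  assumes cont: "continuous_on {0..} f" and a: "0 < a" "a < 1" and M: "0 \<le> M"
    and step: "\<And>m j. j < N * 2 ^ m \<Longrightarrow> \<bar>f (real (Suc j) / 2 ^ m) - f (real j / 2 ^ m)\<bar> \<le> M * a ^ m"
    and st: "0 \<le> s" "s \<le> t" "t \<le> real N" "t - s \<le> 1 / 2 ^ m"
  shows "\<bar>f s - f t\<bar> \<le> M * (1 + 2 / (1 - a)) * a ^ m"
proof -
  define d where "d = (\<lambda>(x::real) (i::nat). nat \<lfloor>x * 2 ^ i\<rfloor>)"
  have d_le: "real (d x i) \<le> x * 2 ^ i" "x * 2 ^ i < real (d x i) + 1" if "0 \<le> x" for x i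
    using that by (auto simp: d_def)
  \<comment> \<open>Telescoping over the roundings of x down to dyadic grids: on passing to the next
    grid the rounding stays or moves to the adjacent grid point, so the increments form a geometric
    series, and continuity reaches x itself.\<close>
  have near: "\<bar>f x - f (real (d x m) / 2 ^ m)\<bar> \<le> M * a ^ m / (1 - a)" if x: "0 \<le> x" "x \<le> real N" for x m
  proof -
    have one: "\<bar>f (real (d x (Suc i)) / 2 ^ Suc i) - f (real (d x i) / 2 ^ i)\<bar> \<le> M * a ^ Suc i" for i
    proof -
      have "2 * real (d x i) < real (d x (Suc i)) + 1" "real (d x (Suc i)) < 2 * real (d x i) + 2"
        using d_le[OF x(1), of i] d_le[OF x(1), of "Suc i"] by (simp_all add: algebra_simps)
      then consider "d x (Suc i) = 2 * d x i" | "d x (Suc i) = Suc (2 * d x i)" by linarith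
      then show ?thesis
      proof cases
        case 1
        then show ?thesis using M a by simp
      next
        case 2
        have "real (d x (Suc i)) \<le> real N * 2 ^ Suc i"
          using x(2) by (intro order.trans[OF d_le(1)[OF x(1)]] mult_right_mono) auto
        then have "real (d x (Suc i)) \<le> real (N * 2 ^ Suc i)" by simp
        then have "d x (Suc i) \<le> N * 2 ^ Suc i" by (simp only: of_nat_le_iff)
        then have "\<bar>f (real (Suc (2 * d x i)) / 2 ^ Suc i) - f (real (2 * d x i) / 2 ^ Suc i)\<bar> \<le> M * a ^ Suc i"
          using 2 by (intro step) simp
        then show ?thesis using 2 by simp
      qed
    qed
    have fin: "\<bar>f (real (d x (m + i)) / 2 ^ (m + i)) - f (real (d x m) / 2 ^ m)\<bar> \<le> M * a ^ m / (1 - a)" for i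
    proof -
      have "\<bar>f (real (d x (m + i)) / 2 ^ (m + i)) - f (real (d x m) / 2 ^ m)\<bar> \<le> (\<Sum>j<i. M * a ^ Suc (m + j))"
      proof (induction i)
        case (Suc i)
        then show ?case using one[of "m + i"] by simp
      qed simp
      also have "\<dots> \<le> (\<Sum>j<i. M * a ^ m * a ^ j)"
        using M a mult_left_mono[of a 1 "a ^ k" for k]
        by (intro sum_mono) (simp add: power_add mult.assoc mult_left_mono mult_left_le_one_le)
      also have "\<dots> = M * a ^ m * ((1 - a ^ i) / (1 - a))"
        using a by (simp add: sum_distrib_left[symmetric] sum_gp_strict)
      also have "\<dots> \<le> M * a ^ m * (1 / (1 - a))"
        using M a by (intro mult_left_mono divide_right_mono) auto
      finally show ?thesis by simp
    qed
    have lim: "(\<lambda>i. real (d x (m + i)) / 2 ^ (m + i)) \<longlonglongrightarrow> x"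
    proof (rule tendsto_sandwich)
      show "\<forall>\<^sub>F i in sequentially. x - (1/2) ^ i \<le> real (d x (m + i)) / 2 ^ (m + i)"
      proof (intro always_eventually allI)
        fix i
        have "x * 2 ^ (m + i) - 1 \<le> real (d x (m + i))" using d_le(2)[OF x(1), of "m + i"] by simp
        then have "(x * 2 ^ (m + i) - 1) / 2 ^ (m + i) \<le> real (d x (m + i)) / 2 ^ (m + i)"
          by (intro divide_right_mono) auto
        then have "x - 1 / 2 ^ (m + i) \<le> real (d x (m + i)) / 2 ^ (m + i)" by (simp add: diff_divide_distrib)
        moreover have "1 / 2 ^ (m + i) \<le> (1/2::real) ^ i" by (simp add: power_divide power_add field_simps)
        ultimately show "x - (1/2) ^ i \<le> real (d x (m + i)) / 2 ^ (m + i)" by linarith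
      qed
      show "\<forall>\<^sub>F i in sequentially. real (d x (m + i)) / 2 ^ (m + i) \<le> x"
        using d_le(1)[OF x(1)] by (intro always_eventually allI) (simp add: field_simps)
      have "(\<lambda>i. x - (1/2::real) ^ i) \<longlonglongrightarrow> x - 0" by (intro tendsto_intros LIMSEQ_realpow_zero) auto
      then show "(\<lambda>i. x - (1/2::real) ^ i) \<longlonglongrightarrow> x" by simp
    qed auto
    have "(\<lambda>i. f (real (d x (m + i)) / 2 ^ (m + i))) \<longlonglongrightarrow> f x"
      by (rule continuous_on_tendsto_compose[OF cont lim]) (use x in auto)
    then have "(\<lambda>i. \<bar>f (real (d x (m + i)) / 2 ^ (m + i)) - f (real (d x m) / 2 ^ m)\<bar>) \<longlonglongrightarrow> \<bar>f x - f (real (d x m) / 2 ^ m)\<bar>"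
      by (intro tendsto_intros)
    then show ?thesis by (rule LIMSEQ_le_const2) (use fin in blast)
  qed
  \<comment> \<open>Since t - s \<le> 2^(-m), the roundings of s and t on the m-th grid coincide or
    are adjacent.\<close>
  have mid: "\<bar>f (real (d s m) / 2 ^ m) - f (real (d t m) / 2 ^ m)\<bar> \<le> M * a ^ m"
  proof -
    have "t * 2 ^ m \<le> s * 2 ^ m + 1" using st(4) by (simp add: field_simps)
    then have "real (d t m) < real (d s m) + 2" using d_le[of s m] d_le[of t m] st by linarith
    moreover have "d s m \<le> d t m" unfolding d_def using st by (intro nat_mono floor_mono mult_right_mono) auto
    ultimately consider "d t m = d s m" | "d t m = Suc (d s m)" by linarith
    then show ?thesis
    proof cases
      case 1 then show ?thesis using M a by simp
    next
      case 2
      have "real (d t m) \<le> real N * 2 ^ m"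
        using st by (intro order.trans[OF d_le(1)] mult_right_mono) auto
      then have "real (d t m) \<le> real (N * 2 ^ m)" by simp
      then have "d t m \<le> N * 2 ^ m" by (simp only: of_nat_le_iff)
      then show ?thesis using step[of "d s m" m] 2 by (simp add: abs_minus_commute)
    qed
  qed
  have "\<bar>f s - f t\<bar> \<le> M * a ^ m / (1 - a) + M * a ^ m + M * a ^ m / (1 - a)"
    using near[of s m] near[of t m] mid st by linarith
  also have "\<dots> = M * (1 + 2 / (1 - a)) * a ^ m" by (simp add: algebra_simps)
  finally show ?thesis .
qed

text \<open>a^m at distance 2^(-m) is a Hoelder condition of exponent log_2 (1/a), with its own
  constant on each [0, N]. Written with weak inequalities, it survives pointwise limits.\<close>

definition modulus_class :: "real \<Rightarrow> (nat \<Rightarrow> real) \<Rightarrow> (real \<Rightarrow> real) set" where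
  "modulus_class a B = {f. \<bar>f 0\<bar> \<le> 1 \<and>
     (\<forall>N m s t. 0 \<le> s \<longrightarrow> s \<le> t \<longrightarrow> t \<le> real N \<longrightarrow> t - s \<le> 1 / 2 ^ m \<longrightarrow> \<bar>f s - f t\<bar> \<le> B N * a ^ m)}"

lemma modulus_class_dist:
  assumes "f \<in> modulus_class a B" "x \<in> {0..real N}" "y \<in> {0..real N}" "\<bar>x - y\<bar> \<le> 1 / 2 ^ m"
  shows "\<bar>f x - f y\<bar> \<le> B N * a ^ m"
proof (cases "x \<le> y")
  case True
  then show ?thesis using assms by (auto simp: modulus_class_def)
next
  case False
  then have "\<bar>f y - f x\<bar> \<le> B N * a ^ m" using assms by (auto simp: modulus_class_def)
  then show ?thesis by (simp add: abs_minus_commute)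
qed

lemma modulus_class_equicont:
  assumes "0 < a" "a < 1" "0 < e"
  shows "\<exists>d>0. \<forall>f\<in>modulus_class a B. \<forall>x\<in>{0..real N}. \<forall>y\<in>{0..real N}. \<bar>x - y\<bar> < d \<longrightarrow> \<bar>f x - f y\<bar> < e"
proof -
  have "(\<lambda>m. B N * a ^ m) \<longlonglongrightarrow> B N * 0" using assms by (intro tendsto_intros LIMSEQ_realpow_zero) auto
  then have "eventually (\<lambda>m. B N * a ^ m < e) sequentially" using assms(3) by (intro order_tendstoD) auto
  then obtain m where m: "B N * a ^ m < e" by (auto simp: eventually_sequentially)
  show ?thesis
  proof (intro exI[of _ "1 / 2 ^ m"] conjI ballI impI)
    fix f x y assume "f \<in> modulus_class a B" "x \<in> {0..real N}" "y \<in> {0..real N}" "\<bar>x - y\<bar> < 1 / 2 ^ m"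
    then have "\<bar>f x - f y\<bar> \<le> B N * a ^ m" by (intro modulus_class_dist) auto
    then show "\<bar>f x - f y\<bar> < e" using m by linarith
  qed simp
qed

lemma modulus_class_continuous:
  assumes "0 < a" "a < 1" "f \<in> modulus_class a B"
  shows "continuous_on {0..} f"
proof (rule continuous_onI)
  fix x e :: real assume x: "x \<in> {0..}" and e: "0 < e"
  define N where "N = nat \<lceil>x + 1\<rceil>"
  have N: "x + 1 \<le> real N" using x by (simp add: N_def)
  obtain d where d: "0 < d" "\<And>x y. x \<in> {0..real N} \<Longrightarrow> y \<in> {0..real N} \<Longrightarrow> \<bar>x - y\<bar> < d \<Longrightarrow> \<bar>f x - f y\<bar> < e"
    using modulus_class_equicont[OF assms(1,2) e, of B N] assms(3) by blast
  show "\<exists>d>0. \<forall>x'\<in>{0..}. dist x' x < d \<longrightarrow> dist (f x') (f x) \<le> e"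
  proof (intro exI[of _ "min d 1"] conjI ballI impI)
    fix x' assume x': "x' \<in> {0..}" "dist x' x < min d 1"
    have "\<bar>f x' - f x\<bar> < e" using x x' N by (intro d) (auto simp: dist_real_def)
    then show "dist (f x') (f x) \<le> e" by (simp add: dist_real_def)
  qed (use d in auto)
qed

text \<open>Walking back to 0 in at most N steps of length at most 1 costs \<open>B N\<close> per
  step, the case m = 0 of the modulus.\<close>

lemma modulus_class_bounded:
  assumes "f \<in> modulus_class a B" "0 \<le> B N" "x \<in> {0..real N}"
  shows "\<bar>f x\<bar> \<le> 1 + real N * B N"
proof -
  have "\<bar>f x\<bar> \<le> 1 + real j * B N" if "j \<le> N" "0 \<le> x" "x \<le> real j" for j x
    using that
  proof (induction j arbitrary: x)
    case 0
    then show ?case using assms(1) by (auto simp: modulus_class_def)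
  next
    case (Suc j)
    define z where "z = max 0 (x - 1)"
    have "\<bar>f z\<bar> \<le> 1 + real j * B N" using Suc.prems by (intro Suc.IH) (auto simp: z_def)
    moreover have "\<bar>f x - f z\<bar> \<le> B N * a ^ 0"
      using Suc.prems by (intro modulus_class_dist[OF assms(1)]) (auto simp: z_def)
    ultimately show ?case by (simp add: algebra_simps)
  qed
  from this[of N x] show ?thesis using assms(3) by auto
qed

lemma compactC_modulus_class:
  assumes a: "0 < a" "a < 1" and B: "\<And>N. 0 \<le> B N"
  shows "compactC (modulus_class a B)"
  unfolding compactC_def
proof (intro conjI ballI allI impI)
  fix f assume "f \<in> modulus_class a B"
  then show "continuous_on {0..} f" using modulus_class_continuous[OF a] by blast
next
  fix s :: "nat \<Rightarrow> real \<Rightarrow> real" assume s: "\<forall>i. s i \<in> modulus_class a B"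
  obtain k :: "nat \<Rightarrow> nat" where k: "strict_mono k" "\<And>i. \<exists>g. uniform_limit {0..real i} (\<lambda>n. s ((id \<circ> k) n)) g sequentially"
  proof (rule subsequence_diagonalization_lemma[where r = id and P = "\<lambda>i r. \<exists>g. uniform_limit {0..real i} (\<lambda>n. s (r n)) g sequentially"])
    fix i :: nat and r :: "nat \<Rightarrow> nat"
    show "\<exists>k. strict_mono k \<and> (\<exists>g. uniform_limit {0..real i} (\<lambda>n. s ((r \<circ> k) n)) g sequentially)"
    proof (rule Arzela_Ascoli[of "{0..real i}" "\<lambda>n. s (r n)" "1 + real i * B i"])
      show "compact {0..real i}" by simp
      show "norm (s (r n) x) \<le> 1 + real i * B i" if "x \<in> {0..real i}" for n x
        using modulus_class_bounded[of "s (r n)" a B i x] B s that by auto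
      show "\<exists>d>0. \<forall>n y. y \<in> {0..real i} \<and> norm (x - y) < d \<longrightarrow> norm (s (r n) x - s (r n) y) < e"
        if "x \<in> {0..real i}" "0 < e" for x e
        using modulus_class_equicont[OF a that(2), of B i] s that(1) by (metis real_norm_def)
    next
      fix g k assume "strict_mono (k :: nat \<Rightarrow> nat)"
        and lim: "\<And>e. 0 < e \<Longrightarrow> \<exists>N. \<forall>n x. N \<le> n \<and> x \<in> {0..real i} \<longrightarrow> norm (s (r (k n)) x - g x) < e"
      moreover have "uniform_limit {0..real i} (\<lambda>n. s ((r \<circ> k) n)) g sequentially"
        unfolding uniform_limit_sequentially_iff dist_norm o_def
      proof (intro allI impI)
        fix e :: real assume "0 < e"
        from lim[OF this] obtain N where "\<And>n x. N \<le> n \<Longrightarrow> x \<in> {0..real i} \<Longrightarrow> norm (s (r (k n)) x - g x) < e"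
          by blast
        then show "\<exists>N. \<forall>n\<ge>N. \<forall>x\<in>{0..real i}. norm (s (r (k n)) x - g x) < e" by blast
      qed
      ultimately show ?thesis by blast
    qed
  next
    fix i N :: nat and r k1 k2 :: "nat \<Rightarrow> nat"
    assume "\<exists>g. uniform_limit {0..real i} (\<lambda>n. s ((r \<circ> k1) n)) g sequentially"
      and sub: "\<And>j. N \<le> j \<Longrightarrow> \<exists>j'\<ge>j. k2 j = k1 j'"
    then obtain g where g: "uniform_limit {0..real i} (\<lambda>n. s (r (k1 n))) g sequentially" by (auto simp: o_def)
    have "uniform_limit {0..real i} (\<lambda>n. s (r (k2 n))) g sequentially"
      unfolding uniform_limit_sequentially_iff
    proof (intro allI impI)
      fix e :: real assume "0 < e"
      then obtain N1 where N1: "\<And>n x. N1 \<le> n \<Longrightarrow> x \<in> {0..real i} \<Longrightarrow> dist (s (r (k1 n)) x) (g x) < e"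
        using g unfolding uniform_limit_sequentially_iff by blast
      have "dist (s (r (k2 n)) x) (g x) < e" if "max N N1 \<le> n" "x \<in> {0..real i}" for n x
        using sub[of n] N1 that by fastforce
      then show "\<exists>N. \<forall>n\<ge>N. \<forall>x\<in>{0..real i}. dist (s (r (k2 n)) x) (g x) < e" by blast
    qed
    then show "\<exists>g. uniform_limit {0..real i} (\<lambda>n. s ((r \<circ> k2) n)) g sequentially" by (auto simp: o_def)
  next
    fix k assume "strict_mono (k :: nat \<Rightarrow> nat)" "\<And>i. \<exists>g. uniform_limit {0..real i} (\<lambda>n. s ((id \<circ> k) n)) g sequentially"
    then show thesis by (rule that)
  qed
  then obtain G where G: "\<And>i. uniform_limit {0..real i} (\<lambda>n. s (k n)) (G i) sequentially"
    by (auto simp: o_def) metis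
  \<comment> \<open>The \<open>G i\<close> are limits of the same sequence, so they agree on common
    domains. Values of \<open>lim\<close> at negative x are arbitrary, but
    \<open>modulus_class\<close> does not see them.\<close>
  define g where "g = (\<lambda>x. lim (\<lambda>n. s (k n) x))"
  have gG: "g x = G i x" if "x \<in> {0..real i}" for x i
    unfolding g_def using tendsto_uniform_limitI[OF G that] by (rule limI)
  have ul: "uniform_limit {0..real i} (\<lambda>n. s (k n)) g sequentially" for i
  proof -
    have "(\<forall>x\<in>{0..real i}. dist (s (k n) x) (g x) < e) \<longleftrightarrow> (\<forall>x\<in>{0..real i}. dist (s (k n) x) (G i x) < e)" for n e
      by (intro ball_cong refl) (simp add: gG[of _ i])
    then show ?thesis using G[of i] unfolding uniform_limit_iff by (simp only:)
  qed
  have tend: "(\<lambda>n. s (k n) x) \<longlonglongrightarrow> g x" if "0 \<le> x" for x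
  proof -
    have "x \<in> {0..real (nat \<lceil>x\<rceil>)}" using that by simp
    then show ?thesis using tendsto_uniform_limitI[OF ul] by blast
  qed
  have "g \<in> modulus_class a B"
    unfolding modulus_class_def
  proof (intro CollectI conjI allI impI)
    have "(\<lambda>n. \<bar>s (k n) 0\<bar>) \<longlonglongrightarrow> \<bar>g 0\<bar>" by (intro tendsto_intros tend) simp
    then show "\<bar>g 0\<bar> \<le> 1" by (rule LIMSEQ_le_const2) (use s in \<open>auto simp: modulus_class_def\<close>)
    fix N m :: nat and x t :: real assume *: "0 \<le> x" "x \<le> t" "t \<le> real N" "t - x \<le> 1 / 2 ^ m"
    have "(\<lambda>n. \<bar>s (k n) x - s (k n) t\<bar>) \<longlonglongrightarrow> \<bar>g x - g t\<bar>" using * by (intro tendsto_intros tend) auto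
    then show "\<bar>g x - g t\<bar> \<le> B N * a ^ m"
      by (rule LIMSEQ_le_const2) (use s * in \<open>auto simp: modulus_class_def\<close>)
  qed
  then show "\<exists>r g. strict_mono r \<and> g \<in> modulus_class a B \<and> (\<forall>k. uniform_limit {0..real k} (\<lambda>i. s (r i)) g sequentially)"
    using k(1) ul by blast
qed

text \<open>A finite union is covered by finitely many of the sets, one chosen for each
  element.\<close>

lemma card_UN_le_suminf:
  fixes B :: "nat \<Rightarrow> 'a set"
  assumes fin: "finite (\<Union>i. B i)" and b: "\<And>i. real (card (B i)) \<le> b i" and sm: "summable b"
  shows "real (card (\<Union>i. B i)) \<le> (\<Sum>i. b i)"
proof -
  have "\<exists>i. x \<in> B i" if "x \<in> (\<Union>i. B i)" for x using that by blast
  then obtain i where i: "\<And>x. x \<in> (\<Union>i. B i) \<Longrightarrow> x \<in> B (i x)" by metis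
  let ?I = "i ` (\<Union>i. B i)"
  have "card (\<Union>i. B i) \<le> card (\<Union>j\<in>?I. B j)"
  proof (rule card_mono)
    show "finite (\<Union>j\<in>?I. B j)" by (rule finite_subset[OF _ fin]) auto
    show "(\<Union>i. B i) \<subseteq> (\<Union>j\<in>?I. B j)" using i by blast
  qed
  also have "\<dots> \<le> (\<Sum>j\<in>?I. card (B j))" using fin by (intro card_UN_le) auto
  finally have "real (card (\<Union>i. B i)) \<le> (\<Sum>j\<in>?I. real (card (B j)))"
    by (simp flip: of_nat_sum)
  also have "\<dots> \<le> (\<Sum>j\<in>?I. b j)" by (intro sum_mono b)
  also have "\<dots> \<le> (\<Sum>i. b i)"
    using fin b by (intro sum_le_suminf sm) (auto intro: order.trans[OF of_nat_0_le_iff])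
  finally show ?thesis .
qed

lemma card_markov4:
  fixes X :: "'a \<Rightarrow> real"
  assumes "finite A" "0 < u" "(\<Sum>T\<in>A. X T ^ 4) \<le> S"
  shows "real (card {T \<in> A. u < \<bar>X T\<bar>}) \<le> S / u ^ 4"
proof -
  have "real (card {T \<in> A. u < \<bar>X T\<bar>}) * u ^ 4 = (\<Sum>T\<in>{T \<in> A. u < \<bar>X T\<bar>}. u ^ 4)" by simp
  also have "\<dots> \<le> (\<Sum>T\<in>{T \<in> A. u < \<bar>X T\<bar>}. X T ^ 4)"
  proof (rule sum_mono)
    fix T assume "T \<in> {T \<in> A. u < \<bar>X T\<bar>}"
    then have "u ^ 4 \<le> \<bar>X T\<bar> ^ 4" using assms(2) by (intro power_mono) auto
    then show "u ^ 4 \<le> X T ^ 4" by simp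
  qed
  also have "\<dots> \<le> (\<Sum>T\<in>A. X T ^ 4)" using assms(1) by (intro sum_mono2) auto
  finally show ?thesis using assms by (simp add: field_simps)
qed

text \<open>The time scale contributes n through the squared length ((t - s) sqrt n)^2, the moment
  bound another n, and the fourth power of the space scale removes n^2.\<close>

lemma lproc_fourth_moment:
  "\<exists>C>0. \<forall>n\<ge>1. \<forall>s t. 0 \<le> s \<longrightarrow> s \<le> t \<longrightarrow>
     (\<Sum>T\<in>trees n. (lproc n T t - lproc n T s) ^ 4) \<le> C * (t - s) ^ 2 * real (card (trees n))"
proof -
  obtain C where C: "0 < C" "\<And>n r h. level_diff4 h r n \<le> C * real h ^ 2 * real n * real (card (trees n))"
    using fourth_moment_bound by blast
  have "(\<Sum>T\<in>trees n. (lproc n T t - lproc n T s) ^ 4) \<le> (64 * C) * (t - s) ^ 2 * real (card (trees n))"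
    if n: "1 \<le> n" and st: "0 \<le> s" "s \<le> t" for n s t
  proof -
    let ?r = "sqrt (real n)"
    have r: "0 < ?r" "?r ^ 2 = real n" using n by auto
    have r4: "?r ^ 4 = real n * real n" using power_mult[of ?r 2 2] r(2) by (simp add: power2_eq_square)
    have "(\<Sum>T\<in>trees n. (lproc n T t - lproc n T s) ^ 4) = (\<Sum>T\<in>trees n. (Lr T (t * ?r) - Lr T (s * ?r)) ^ 4) / (real n * real n)"
      unfolding lproc_def diff_divide_distrib[symmetric] power_divide r4 sum_divide_distrib[symmetric] ..
    also have "\<dots> \<le> (64 * C * (t * ?r - s * ?r) ^ 2 * real n * real (card (trees n))) / (real n * real n)"
      using st r C by (intro divide_right_mono Lr_fourth_moment mult_right_mono) auto
    also have "(t * ?r - s * ?r) ^ 2 = (t - s) ^ 2 * real n"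
      by (simp only: left_diff_distrib[symmetric] power_mult_distrib r(2))
    finally show ?thesis using n by simp
  qed
  then show ?thesis using C(1) by (intro exI[of _ "64 * C"]) auto
qed

lemma lproc_0: "1 \<le> n \<Longrightarrow> \<bar>lproc n T 0\<bar> \<le> 1"
  by (simp add: lproc_def Lr_def)

text \<open>Up to time N there are N 2^m increments at scale 2^(-m), and by Markov's inequality each
  exceeds M a^m with probability at most C 4^(-m)/(M a^m)^4. A union bound over increments, scales
  and N leaves at most \<epsilon>, for every n \<ge> 1 with the same class of functions.\<close>

lemma tightC_lproc: "tightC lproc"
  unfolding tightC_def
proof (intro allI impI)
  fix \<epsilon> :: real assume \<epsilon>: "0 < \<epsilon>"
  obtain C where C: "0 < C" "\<And>n s t. 1 \<le> n \<Longrightarrow> 0 \<le> s \<Longrightarrow> s \<le> t \<Longrightarrow>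
     (\<Sum>T\<in>trees n. (lproc n T t - lproc n T s) ^ 4) \<le> C * (t - s) ^ 2 * real (card (trees n))"
    using lproc_fourth_moment by blast
  \<comment> \<open>The union bound has ratio 2/(4 a^4), so 2 a^4 > 1 is required; here the ratio is
    about 0.762, below 4/5.\<close>
  define a :: real where "a = 9/10"
  \<comment> \<open>Summing (4/5)^m gives 5, and this choice makes 5 N C/M at most \<epsilon>
    2^(-N-1), which adds up to \<epsilon> over N. The summand 1 ensures M \<ge> 1, so that M^4 \<ge>
    M.\<close>
  define M where "M = (\<lambda>N::nat. 1 + 5 * real N * C * 2 ^ Suc N / \<epsilon>)"
  have M1: "1 \<le> M N" for N using C \<epsilon> by (simp add: M_def)
  define B where "B = (\<lambda>N. M N * (1 + 2 / (1 - a)))"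
  have B: "0 \<le> B N" for N using M1[of N] by (simp add: B_def a_def)
  have K: "compactC (modulus_class a B)" by (rule compactC_modulus_class) (use B in \<open>auto simp: a_def\<close>)
  have "(1 - \<epsilon>) * real (card (trees n)) \<le> real (card {T \<in> trees n. lproc n T \<in> modulus_class a B})" if n: "1 \<le> n" for n
  proof -
    let ?c = "real (card (trees n))"
    define bad where "bad = (\<lambda>N m j. {T \<in> trees n. M N * a ^ m < \<bar>lproc n T (real (Suc j) / 2 ^ m) - lproc n T (real j / 2 ^ m)\<bar>})"
    define badm where "badm = (\<lambda>N m. \<Union>j<N * 2 ^ m. bad N m j)"
    define badN where "badN = (\<lambda>N. \<Union>m. badm N m)"
    have sub: "bad N m j \<subseteq> trees n" "badm N m \<subseteq> trees n" "badN N \<subseteq> trees n" for N m j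
      by (auto simp: bad_def badm_def badN_def)
    have 1: "real (card (bad N m j)) \<le> C * ?c / M N ^ 4 * (1 / (4 * a ^ 4)) ^ m" for N m j
    proof -
      have "real (card (bad N m j)) \<le> (C * (real (Suc j) / 2 ^ m - real j / 2 ^ m) ^ 2 * ?c) / (M N * a ^ m) ^ 4"
        unfolding bad_def using M1[of N]
        by (intro card_markov4 C n) (auto simp: a_def divide_right_mono)
      also have "(real (Suc j) / 2 ^ m - real j / 2 ^ m) ^ 2 = (1 / 4) ^ m"
        by (simp add: diff_divide_distrib[symmetric] power_divide power_even_eq[symmetric] power_mult[symmetric] mult.commute[of m])
           (simp add: power_mult)
      also have "(M N * a ^ m) ^ 4 = M N ^ 4 * (a ^ 4) ^ m"
        by (simp add: power_mult_distrib power_mult[symmetric] mult.commute)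
      finally show ?thesis by (simp add: power_divide power_mult_distrib field_simps)
    qed
    have 2: "real (card (badm N m)) \<le> real N * C * ?c / M N ^ 4 * (4/5) ^ m" for N m
    proof -
      have "real (card (badm N m)) \<le> (\<Sum>j<N * 2 ^ m. real (card (bad N m j)))"
        unfolding badm_def using card_UN_le[of "{..<N * 2 ^ m}" "bad N m"] by (simp flip: of_nat_sum)
      also have "\<dots> \<le> (\<Sum>j<N * 2 ^ m. C * ?c / M N ^ 4 * (1 / (4 * a ^ 4)) ^ m)"
        by (intro sum_mono 1)
      also have "\<dots> = real N * C * ?c / M N ^ 4 * (2 * (1 / (4 * a ^ 4))) ^ m"
        by (simp only: sum_constant card_lessThan of_nat_mult of_nat_power power_mult_distrib) simp
      also have "\<dots> \<le> real N * C * ?c / M N ^ 4 * (4/5) ^ m"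
        using C M1[of N] by (intro mult_left_mono power_mono) (auto simp: a_def eval_nat_numeral)
      finally show ?thesis .
    qed
    have 3: "real (card (badN N)) \<le> \<epsilon> * ?c * (1/2) ^ Suc N" for N
    proof -
      have sg: "summable (\<lambda>m. (4/5::real) ^ m)" by simp
      have "real (card (badN N)) \<le> (\<Sum>m. real N * C * ?c / M N ^ 4 * (4/5) ^ m)"
        unfolding badN_def
      proof (rule card_UN_le_suminf)
        show "finite (\<Union>m. badm N m)"
          by (rule finite_subset[OF UN_least[OF sub(2)]]) simp
      qed (rule 2, rule summable_mult[OF sg])
      also have "\<dots> = real N * C * ?c / M N ^ 4 * (\<Sum>m. (4/5) ^ m)" by (rule suminf_mult[OF sg])
      also have "(\<Sum>m. (4/5::real) ^ m) = 5" by (subst suminf_geometric) auto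
      also have "real N * C * ?c / M N ^ 4 * 5 \<le> real N * C * ?c / M N * 5"
      proof (intro mult_right_mono divide_left_mono)
        show "M N \<le> M N ^ 4" using M1[of N] power_increasing[of 1 4 "M N"] by simp
      qed (use C M1[of N] in auto)
      also have "\<dots> \<le> \<epsilon> * ?c * (1/2) ^ Suc N"
      proof -
        have "5 * real N * C * 2 ^ Suc N \<le> \<epsilon> * M N" using \<epsilon> by (simp add: M_def field_simps)
        then have "5 * real N * C \<le> \<epsilon> * M N * (1/2) ^ Suc N" by (simp add: power_divide field_simps)
        then have "5 * real N * C * ?c \<le> \<epsilon> * M N * (1/2) ^ Suc N * ?c" by (intro mult_right_mono) auto
        then show ?thesis using M1[of N] by (simp add: field_simps)
      qed
      finally show ?thesis .
    qed
    have 4: "real (card (\<Union>N. badN N)) \<le> \<epsilon> * ?c"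
    proof -
      have sg: "summable (\<lambda>N. (1/2::real) ^ Suc N)" by (subst summable_Suc_iff) simp
      have "real (card (\<Union>N. badN N)) \<le> (\<Sum>N. \<epsilon> * ?c * (1/2) ^ Suc N)"
      proof (rule card_UN_le_suminf)
        show "finite (\<Union>N. badN N)"
          by (rule finite_subset[OF UN_least[OF sub(3)]]) simp
      qed (rule 3, rule summable_mult[OF sg])
      also have "\<dots> = \<epsilon> * ?c * (\<Sum>N. (1/2) ^ Suc N)" by (rule suminf_mult[OF sg])
      also have "(\<Sum>N. (1/2::real) ^ Suc N) = 1" using power_half_series by (simp add: sums_iff)
      finally show ?thesis by simp
    qed
    have "trees n - (\<Union>N. badN N) \<subseteq> {T \<in> trees n. lproc n T \<in> modulus_class a B}"
    proof
      fix T assume T: "T \<in> trees n - (\<Union>N. badN N)"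
      have step: "\<bar>lproc n T (real (Suc j) / 2 ^ m) - lproc n T (real j / 2 ^ m)\<bar> \<le> M N * a ^ m" if "j < N * 2 ^ m" for N m j
        using T that by (auto simp: badN_def badm_def bad_def not_less)
      have "\<bar>lproc n T s - lproc n T t\<bar> \<le> B N * a ^ m" if "0 \<le> s" "s \<le> t" "t \<le> real N" "t - s \<le> 1 / 2 ^ m" for N m s t
        unfolding B_def
        by (rule dyadic_chaining[OF continuous_on_lproc _ _ _ step that]) (use M1[of N] in \<open>auto simp: a_def\<close>)
      then have "lproc n T \<in> modulus_class a B" using lproc_0[OF n] by (auto simp: modulus_class_def)
      then show "T \<in> {T \<in> trees n. lproc n T \<in> modulus_class a B}" using T by simp
    qed
    then have "card (trees n - (\<Union>N. badN N)) \<le> card {T \<in> trees n. lproc n T \<in> modulus_class a B}"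
      by (intro card_mono) auto
    moreover have "card (trees n - (\<Union>N. badN N)) = card (trees n) - card (\<Union>N. badN N)"
    proof (rule card_Diff_subset)
      show subN: "(\<Union>N. badN N) \<subseteq> trees n" by (rule UN_least) (rule sub(3))
      show "finite (\<Union>N. badN N)" by (rule finite_subset[OF subN]) simp
    qed
    ultimately have "?c - real (card (\<Union>N. badN N)) \<le> real (card {T \<in> trees n. lproc n T \<in> modulus_class a B})"
      by linarith
    then show ?thesis using 4 by (simp add: algebra_simps)
  qed
  with K show "\<exists>K. compactC K \<and> (\<forall>n\<ge>1. (1 - \<epsilon>) * real (card (trees n)) \<le> real (card {T \<in> trees n. lproc n T \<in> K}))"
    by blast
qed

theorem mainTheorem5:
  shows "\<exists>C>0. (\<forall>n r h::nat.
            Eunif n (\<lambda>T. (real (lev T r) - real (lev T (r + h))) ^ 4)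
              \<le> C * real h ^ 2 * real n)
         \<and> tightC lproc"
proof -
  obtain C where C: "0 < C" "\<And>n r h. level_diff4 h r n \<le> C * real h ^ 2 * real n * real (card (trees n))"
    using fourth_moment_bound by blast
  have "Eunif n (\<lambda>T. (real (lev T r) - real (lev T (r + h))) ^ 4) \<le> C * real h ^ 2 * real n" for n r h
  proof (cases "card (trees n) = 0")
    \<comment> \<open>Without trees, as for n = 0, the expectation is 0/0 = 0 by convention.\<close>
    case True
    then show ?thesis using C(1) by (simp add: Eunif_def)
  next
    case False
    then have "0 < real (card (trees n))" by (simp only: of_nat_0_less_iff)
    then show ?thesis unfolding Eunif_def level_diff4_def[symmetric] using C(2)[of h r n] by (simp only: pos_divide_le_eq)
  qed
  then show ?thesis using C(1) tightC_lproc by blast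
qed

end
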